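(* Let $n\ge 4$ be an integer, let $l,r$ be nonzero complex numbers, and assume that $(r^2)^k\neq 1$ for every $k\in\{1,\dots,n\}$. There exists an irreducible $\frac{n(n-3)}{2}$-dimensional invariant subspace of the Lawrence-Krammer space $\mathcal V^{(n)}$ if and only if $l=r$. If so, it is unique.
   Context: Let $l,r$ be nonzero complex numbers with $r^2\ne1$, $m=\frac1r-r$ and $F=\mathbb{Q}(l,r)\subset\mathbb{C}$. The BMW algebra $B(A_{n-1})$ is the unital associative $F$-algebra generated by invertible elements $g_1,\dots,g_{n-1}$, with $e_i:=\frac{l}{m}(g_i^2+m g_i-1)$, subject to: $g_ig_j=g_jg_i$ for $|i-j|\ge2$; $g_ig_{i+1}g_i=g_{i+1}g_ig_{i+1}$; $g_ie_i=l^{-1}e_i$; $e_ig_{i+1}e_i=l e_i$; $e_ig_{i-1}e_i=l e_i$ (whenever the indices make sense). The Lawrence-Krammer space $\mathcal V^{(n)}$ is the $F$-vector space with basis $\{w_{ij}:1\le i<j\le n\}$. It is a $B(A_{n-1})$-module, $g_k$ acting by the endomorphism $\nu_k$ defined, for $1\le k\le n-1$, by: - $\nu_k(w_{ij})=r\,w_{ij}$ if $\{i,j\}\cap\{k,k+1\}=\emptyset$; - $\nu_k(w_{k,k+1})=l^{-1}w_{k,k+1}$; - $\nu_k(w_{k,j})=w_{k+1,j}$ for $j\ge k+2$; - $\nu_k(w_{k+1,j})=w_{k,j}+m\,r^{j-k-2}\,w_{k,k+1}-m\,w_{k+1,j}$ for $j\ge k+2$; - $\nu_k(w_{i,k})=w_{i,k+1}$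 for $i\le k-1$; - $\nu_k(w_{i,k+1})=w_{i,k}+\frac{m}{l\,r^{k-1-i}}\,w_{k,k+1}-m\,w_{i,k+1}$ for $i\le k-1$. Invariant subspaces are $F$-subspaces stable under $B(A_{n-1})$; an invariant subspace is irreducible if it is nonzero and contains no invariant subspaces other than $0$ and itself; dimensions are over $F$. *)

theory Defs
  imports
    Complex_Main
    "HOL-Library.Poly_Mapping"
    "HOL-Algebra.QuotRing"
    "HOL-Algebra.Generated_Fields"
    "HOL-Algebra.Algebraic_Closure_Type"
    "Jordan_Normal_Form.Missing_VectorSpace"
begin

section \<open>The base field\<close>

definition base_field :: "complex \<Rightarrow> complex \<Rightarrow> complex ring" where
  "base_field l r =
     ring_of_type_algebra\<lparr>carrier := generate_field ring_of_type_algebra {l, r}\<rparr>"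

definition par_m :: "complex \<Rightarrow> complex" where
  "par_m r = 1 / r - r"


section \<open>The BMW algebra\<close>

text \<open>
  The free monoid over \<open>'a\<close>, written additively so that \<open>'a word \<Rightarrow>\<^sub>0 complex\<close>
  with the convolution product of \<^theory>\<open>HOL-Library.Poly_Mapping\<close> is the free unital
  associative algebra over \<open>'a\<close>.
\<close>

datatype 'a word = Word (letters: "'a list")

instantiation word :: (type) monoid_add
begin

definition zero_word :: "'a word" where
  "zero_word = Word []"

definition plus_word :: "'a word \<Rightarrow> 'a word \<Rightarrow> 'a word" where
  "plus_word u v = Word (letters u @ letters v)"

instance
  by standard (simp_all add: zero_word_def plus_word_def)

end

datatype letter = Gen nat | GenInv nat

type_synonym free_alg = "letter word \<Rightarrow>\<^sub>0 complex"

definition scal :: "complex \<Rightarrow> free_alg" where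
  "scal c = Poly_Mapping.single 0 c"

definition gen :: "nat \<Rightarrow> free_alg" where
  "gen i = Poly_Mapping.single (Word [Gen i]) 1"

definition gen_inv :: "nat \<Rightarrow> free_alg" where
  "gen_inv i = Poly_Mapping.single (Word [GenInv i]) 1"

definition elem_e :: "complex \<Rightarrow> complex \<Rightarrow> nat \<Rightarrow> free_alg" where
  "elem_e l r i = scal (l / par_m r) * (gen i * gen i + scal (par_m r) * gen i - 1)"

definition free_algebra :: "nat \<Rightarrow> complex \<Rightarrow> complex \<Rightarrow> free_alg ring" where
  "free_algebra n l r =
     ring_of_type_algebra\<lparr>carrier :=
       {p. \<forall>w \<in> Poly_Mapping.keys p.
             Poly_Mapping.lookup p w \<in> carrier (base_field l r) \<and>
             set (letters w) \<subseteq> Gen ` {1..n - 1} \<union> GenInv ` {1..n - 1}}\<rparr>"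

definition bmw_relators :: "nat \<Rightarrow> complex \<Rightarrow> complex \<Rightarrow> free_alg set" where
  "bmw_relators n l r =
     {gen i * gen_inv i - 1 | i. i \<in> {1..n - 1}} \<union>
     {gen_inv i * gen i - 1 | i. i \<in> {1..n - 1}} \<union>
     {gen i * gen j - gen j * gen i | i j.
        i \<in> {1..n - 1} \<and> j \<in> {1..n - 1} \<and> \<bar>int i - int j\<bar> \<ge> 2} \<union>
     {gen i * gen (i + 1) * gen i - gen (i + 1) * gen i * gen (i + 1) | i.
        i \<in> {1..n - 1} \<and> i + 1 \<in> {1..n - 1}} \<union>
     {gen i * elem_e l r i - scal (inverse l) * elem_e l r i | i. i \<in> {1..n - 1}} \<union>
     {elem_e l r i * gen (i + 1) * elem_e l r i - scal l * elem_e l r i | i.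
        i \<in> {1..n - 1} \<and> i + 1 \<in> {1..n - 1}} \<union>
     {elem_e l r i * gen (i - 1) * elem_e l r i - scal l * elem_e l r i | i.
        i \<in> {1..n - 1} \<and> i - 1 \<in> {1..n - 1}}"

definition bmw_algebra :: "nat \<Rightarrow> complex \<Rightarrow> complex \<Rightarrow> free_alg set ring" where
  "bmw_algebra n l r =
     free_algebra n l r Quot genideal (free_algebra n l r) (bmw_relators n l r)"


section \<open>The Lawrence-Krammer space\<close>

definition index_pairs :: "nat \<Rightarrow> (nat \<times> nat) set" where
  "index_pairs n = {(i, j). 1 \<le> i \<and> i < j \<and> j \<le> n}"

type_synonym lk_vector = "nat \<times> nat \<Rightarrow> complex"

definition lk_space :: "nat \<Rightarrow> complex \<Rightarrow> complex \<Rightarrow> (complex, lk_vector) module" where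
  "lk_space n l r = ring.func_space (base_field l r) (index_pairs n)"

definition lk_basis :: "nat \<Rightarrow> nat \<Rightarrow> nat \<Rightarrow> lk_vector" where
  "lk_basis n i j = (\<lambda>q \<in> index_pairs n. if q = (i, j) then 1 else 0)"

text \<open>The image of a basis vector under \<open>\<nu>\<^sub>k\<close>, for \<open>(i, j)\<close> in \<^const>\<open>index_pairs\<close>.\<close>

definition nu_basis :: "nat \<Rightarrow> complex \<Rightarrow> complex \<Rightarrow> nat \<Rightarrow> nat \<times> nat \<Rightarrow> lk_vector" where
  "nu_basis n l r k =
     (let V = lk_space n l r; w = lk_basis n; m = par_m r in
      (\<lambda>(i, j).
        if {i, j} \<inter> {k, k + 1} = {} then r \<odot>\<^bsub>V\<^esub> w i j
        else if i = k \<and> j = k + 1 then inverse l \<odot>\<^bsub>V\<^esub> w k (k + 1)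
        else if i = k then w (k + 1) j
        else if i = k + 1 then
          w k j \<oplus>\<^bsub>V\<^esub> (m * r ^ (j - k - 2)) \<odot>\<^bsub>V\<^esub> w k (k + 1) \<oplus>\<^bsub>V\<^esub> (- m) \<odot>\<^bsub>V\<^esub> w (k + 1) j
        else if j = k then w i (k + 1)
        else
          w i k \<oplus>\<^bsub>V\<^esub> (m / (l * r ^ (k - 1 - i))) \<odot>\<^bsub>V\<^esub> w k (k + 1) \<oplus>\<^bsub>V\<^esub> (- m) \<odot>\<^bsub>V\<^esub> w i (k + 1)))"

definition nu :: "nat \<Rightarrow> complex \<Rightarrow> complex \<Rightarrow> nat \<Rightarrow> lk_vector \<Rightarrow> lk_vector" where
  "nu n l r k v =
     (\<Oplus>\<^bsub>lk_space n l r\<^esub> p \<in> index_pairs n. v p \<odot>\<^bsub>lk_space n l r\<^esub> nu_basis n l r k p)"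

fun letter_action :: "nat \<Rightarrow> complex \<Rightarrow> complex \<Rightarrow> letter \<Rightarrow> lk_vector \<Rightarrow> lk_vector" where
  "letter_action n l r (Gen k) = nu n l r k"
| "letter_action n l r (GenInv k) = inv_into (carrier (lk_space n l r)) (nu n l r k)"

definition free_action :: "nat \<Rightarrow> complex \<Rightarrow> complex \<Rightarrow> free_alg \<Rightarrow> lk_vector \<Rightarrow> lk_vector" where
  "free_action n l r a v =
     (\<Oplus>\<^bsub>lk_space n l r\<^esub> w \<in> Poly_Mapping.keys a.
        Poly_Mapping.lookup a w \<odot>\<^bsub>lk_space n l r\<^esub> foldr (letter_action n l r) (letters w) v)"

text \<open>
  All representatives of a coset \<open>b\<close> act in the same way, because the \<open>\<nu>\<^sub>k\<close> satisfy the
  defining relations of the BMW algebra; \<^const>\<open>the_elem\<close> picks the common value.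
\<close>

definition bmw_action :: "nat \<Rightarrow> complex \<Rightarrow> complex \<Rightarrow> free_alg set \<Rightarrow> lk_vector \<Rightarrow> lk_vector" where
  "bmw_action n l r b v = the_elem ((\<lambda>a. free_action n l r a v) ` b)"


section \<open>Invariant subspaces\<close>

definition invariant_subspace :: "nat \<Rightarrow> complex \<Rightarrow> complex \<Rightarrow> lk_vector set \<Rightarrow> bool" where
  "invariant_subspace n l r W \<longleftrightarrow>
     VectorSpace.subspace (base_field l r) W (lk_space n l r) \<and>
     (\<forall>b \<in> carrier (bmw_algebra n l r). \<forall>v \<in> W. bmw_action n l r b v \<in> W)"

definition irreducible_invariant_subspace ::
    "nat \<Rightarrow> complex \<Rightarrow> complex \<Rightarrow> lk_vector set \<Rightarrow> bool" where
  "irreducible_invariant_subspace n l r W \<longleftrightarrow>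
     invariant_subspace n l r W \<and> W \<noteq> {\<zero>\<^bsub>lk_space n l r\<^esub>} \<and>
     (\<forall>U. invariant_subspace n l r U \<and> U \<subseteq> W \<longrightarrow> U = {\<zero>\<^bsub>lk_space n l r\<^esub>} \<or> U = W)"

definition subspace_dim :: "nat \<Rightarrow> complex \<Rightarrow> complex \<Rightarrow> lk_vector set \<Rightarrow> nat" where
  "subspace_dim n l r W = vectorspace.dim (base_field l r) ((lk_space n l r)\<lparr>carrier := W\<rparr>)"


section \<open>The field, the vector space and the algebra are what they are meant to be\<close>

lemma field_base_field: "field (base_field l r)"
  unfolding base_field_def
  by (rule field.generate_field_is_field[OF field_from_type_algebra])
    (simp add: ring_of_type_algebra_def)

lemma vectorspace_lk_space: "vectorspace (base_field l r) (lk_space n l r)"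
proof -
  interpret field "base_field l r" by (rule field_base_field)
  show ?thesis unfolding lk_space_def vectorspace_def
    using func_space_is_module field_axioms by auto
qed

lemma base_field_add_mult:
  assumes "x \<in> carrier (base_field l r)" "y \<in> carrier (base_field l r)"
  shows "x + y \<in> carrier (base_field l r)" "x * y \<in> carrier (base_field l r)"
  using assms generate_field.eng_add[of x ring_of_type_algebra "{l,r}" y]
   generate_field.eng_mult[of x ring_of_type_algebra "{l,r}" y]
  by (auto simp: base_field_def ring_of_type_algebra_def)

lemma base_field_consts:
  "0 \<in> carrier (base_field l r)" "1 \<in> carrier (base_field l r)"
  "l \<in> carrier (base_field l r)" "r \<in> carrier (base_field l r)"
  using ring.ring_simprules(2,6)[OF field_base_field[of l r, THEN field.is_ring]]
    generate_field.incl[of _ "{l,r}" ring_of_type_algebra]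
  by (auto simp: base_field_def ring_of_type_algebra_def)

lemma base_field_uminus:
  assumes x: "x \<in> carrier (base_field l r)"
  shows "- x \<in> carrier (base_field l r)"
proof -
  interpret field "base_field l r" by (rule field_base_field)
  have "\<exists>y \<in> carrier (base_field l r). y \<oplus>\<^bsub>base_field l r\<^esub> x = \<zero>\<^bsub>base_field l r\<^esub>"
    using a_inv_closed[OF x] l_neg[OF x] by blast
  then obtain y where "y \<in> carrier (base_field l r)" "y + x = 0"
    by (auto simp: base_field_def ring_of_type_algebra_def)
  moreover from this(2) have "y = - x" by (simp add: eq_neg_iff_add_eq_0)
  ultimately show ?thesis by simp
qed

lemma base_field_inverse:
  assumes x: "x \<in> carrier (base_field l r)"
  shows "inverse x \<in> carrier (base_field l r)"
proof (cases "x = 0")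
  case False
  interpret field "base_field l r" by (rule field_base_field)
  have "x \<in> Units (base_field l r)"
    using False x unfolding field_Units by (simp add: base_field_def ring_of_type_algebra_def)
  then obtain y where "y \<in> carrier (base_field l r)" "y * x = 1"
    by (auto simp: Units_def base_field_def ring_of_type_algebra_def)
  moreover from this(2) have "y = inverse x" by (metis inverse_unique mult.commute)
  ultimately show ?thesis by simp
qed (simp add: base_field_consts)

lemma base_field_diff_divide:
  assumes "x \<in> carrier (base_field l r)" "y \<in> carrier (base_field l r)"
  shows "x - y \<in> carrier (base_field l r)" "x / y \<in> carrier (base_field l r)"
  using base_field_add_mult(1)[OF assms(1) base_field_uminus[OF assms(2)]]
    base_field_add_mult(2)[OF assms(1) base_field_inverse[OF assms(2)]]
  by (simp_all add: divide_inverse)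

lemma carrier_free_algebra:
  "carrier (free_algebra n l r) =
     {p. (\<forall>w. Poly_Mapping.lookup p w \<in> carrier (base_field l r)) \<and>
         (\<forall>w \<in> Poly_Mapping.keys p. set (letters w) \<subseteq> Gen ` {1..n - 1} \<union> GenInv ` {1..n - 1})}"
proof -
  have "Poly_Mapping.lookup p w \<in> carrier (base_field l r)"
    if "w \<in> Poly_Mapping.keys p \<longrightarrow> Poly_Mapping.lookup p w \<in> carrier (base_field l r)" for p :: free_alg and w
    using that base_field_consts(1) by (cases "w \<in> Poly_Mapping.keys p") (auto simp: in_keys_iff)
  then show ?thesis
    unfolding free_algebra_def by auto
qed

lemma free_algebra_add:
  assumes "p \<in> carrier (free_algebra n l r)" "q \<in> carrier (free_algebra n l r)"
  shows "p + q \<in> carrier (free_algebra n l r)"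
proof -
  have "set (letters w) \<subseteq> Gen ` {1..n - 1} \<union> GenInv ` {1..n - 1}"
    if "w \<in> Poly_Mapping.keys (p + q)" for w
    using that Poly_Mapping.keys_add[of p q] assms unfolding carrier_free_algebra by blast
  with assms show ?thesis
    unfolding carrier_free_algebra by (simp add: lookup_add base_field_add_mult)
qed

lemma free_algebra_uminus:
  assumes "p \<in> carrier (free_algebra n l r)"
  shows "- p \<in> carrier (free_algebra n l r)"
  using assms unfolding carrier_free_algebra by (auto simp: base_field_uminus)

lemma free_algebra_diff:
  assumes "p \<in> carrier (free_algebra n l r)" "q \<in> carrier (free_algebra n l r)"
  shows "p - q \<in> carrier (free_algebra n l r)"
  using free_algebra_add[OF assms(1) free_algebra_uminus[OF assms(2)]] by simp

lemma free_algebra_single: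
  assumes "c \<in> carrier (base_field l r)"
    "set (letters w) \<subseteq> Gen ` {1..n - 1} \<union> GenInv ` {1..n - 1}"
  shows "Poly_Mapping.single w c \<in> carrier (free_algebra n l r)"
  using assms unfolding carrier_free_algebra
  by (auto simp: lookup_single when_def base_field_consts split: if_splits)

lemma free_algebra_sum:
  assumes "finite I" "\<And>i. i \<in> I \<Longrightarrow> f i \<in> carrier (free_algebra n l r)"
  shows "sum f I \<in> carrier (free_algebra n l r)"
  using assms
proof (induction I rule: finite_induct)
  case empty
  then show ?case unfolding carrier_free_algebra by (simp add: base_field_consts)
qed (auto intro: free_algebra_add)

lemma poly_mapping_sum_single:
  "p = (\<Sum>u\<in>Poly_Mapping.keys p. Poly_Mapping.single u (Poly_Mapping.lookup p u))"
  by (rule poly_mapping_eqI)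
    (simp add: lookup_sum lookup_single when_def sum.delta in_keys_iff)

lemma free_algebra_mult:
  assumes "p \<in> carrier (free_algebra n l r)" "q \<in> carrier (free_algebra n l r)"
  shows "p * q \<in> carrier (free_algebra n l r)"
proof -
  have "p * q = (\<Sum>u\<in>Poly_Mapping.keys p. \<Sum>v\<in>Poly_Mapping.keys q.
      Poly_Mapping.single (u + v) (Poly_Mapping.lookup p u * Poly_Mapping.lookup q v))"
    using arg_cong2[OF poly_mapping_sum_single[of p] poly_mapping_sum_single[of q],
        of "(*)", unfolded sum_product mult_single] .
  also have "\<dots> \<in> carrier (free_algebra n l r)"
    using assms
    by (intro free_algebra_sum free_algebra_single base_field_add_mult)
      (auto simp: carrier_free_algebra plus_word_def)
  finally show ?thesis .
qed

lemma ring_free_algebra: "ring (free_algebra n l r)"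
proof -
  have one: "1 \<in> carrier (free_algebra n l r)"
    unfolding single_one[symmetric, where 'a = "letter word" and 'b = complex]
    by (intro free_algebra_single) (auto simp: base_field_consts zero_word_def)
  have zero: "0 \<in> carrier (free_algebra n l r)"
    unfolding carrier_free_algebra by (simp add: base_field_consts)
  have ops: "monoid.mult (free_algebra n l r) = (*)" "add (free_algebra n l r) = (+)"
    "one (free_algebra n l r) = 1" "ring.zero (free_algebra n l r) = 0"
    by (simp_all add: free_algebra_def ring_of_type_algebra_def fun_eq_iff)
  show ?thesis
    by (rule ringI; (rule abelian_groupI monoidI)?)
      (auto simp: ops algebra_simps one zero free_algebra_add free_algebra_mult
        intro: bexI[OF _ free_algebra_uminus])
qed

lemma bmw_relators_subset: "bmw_relators n l r \<subseteq> carrier (free_algebra n l r)"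
proof -
  have s: "scal c \<in> carrier (free_algebra n l r)" if "c \<in> carrier (base_field l r)" for c
    using that by (auto simp: scal_def zero_word_def intro!: free_algebra_single)
  have g: "gen i \<in> carrier (free_algebra n l r)" "gen_inv i \<in> carrier (free_algebra n l r)"
    if "i \<in> {1..n - 1}" for i
    using that by (auto simp: gen_def gen_inv_def base_field_consts intro!: free_algebra_single)
  have one: "1 \<in> carrier (free_algebra n l r)"
    using s[of 1] by (simp add: scal_def base_field_consts)
  have m: "par_m r \<in> carrier (base_field l r)"
    unfolding par_m_def by (intro base_field_diff_divide base_field_consts)
  have e: "elem_e l r i \<in> carrier (free_algebra n l r)" if "i \<in> {1..n - 1}" for i
    unfolding elem_e_def using g[OF that]
    by (intro free_algebra_mult free_algebra_diff free_algebra_add s one m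
        base_field_diff_divide base_field_consts)
  show ?thesis
    unfolding bmw_relators_def
    by (auto intro!: free_algebra_diff free_algebra_mult s g e one base_field_inverse
        base_field_consts)
qed

end

theory Submission
  imports Defs
begin

text \<open>
  Let \<open>T\<^sub>k\<close> be the action of \<open>g\<^sub>k\<close> and \<open>D\<^sub>k = T\<^sub>k - r\<close>. The image of \<open>T\<^sub>k\<^sup>2 + m T\<^sub>k - 1\<close> is
  spanned by \<open>w\<^sub>k\<^sub>,\<^sub>k\<^sub>+\<^sub>1\<close>, which generates the whole space, so this operator vanishes on a proper
  invariant subspace \<open>W\<close>. The image of \<open>D\<^sub>1 D\<^sub>3\<close> on the whole space is the line through
  \<open>x = w\<^sub>2\<^sub>4 - r w\<^sub>1\<^sub>4 - r w\<^sub>2\<^sub>3 + r\<^sup>2 w\<^sub>1\<^sub>3\<close>.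

  If \<open>D\<^sub>1 D\<^sub>3\<close> kills \<open>W\<close>, conjugation shows that \<open>D\<^sub>1 D\<^sub>k\<close> kills \<open>W\<close> for \<open>k \<ge> 3\<close>, hence each \<open>D\<^sub>k\<close> has
  rank at most 1 on \<open>W\<close>. The images of \<open>D\<^sub>1, \<dots>, D\<^sub>n\<^sub>-\<^sub>1\<close> then span an invariant subspace, and an
  irreducible such \<open>W\<close> has dimension at most \<open>n - 1\<close>; for \<open>n = 4\<close> its dimension is at most 1 or
  at least 3. Otherwise \<open>x\<close> lies in \<open>W\<close>, and \<open>T\<^sub>2\<^sup>2 + m T\<^sub>2 - 1\<close> vanishes on \<open>x\<close> only for \<open>l = r\<close> or
  \<open>l = -r\<^sup>3\<close>; in the second case \<open>x\<close> generates vectors \<open>w\<^sub>j\<^sub>k + \<dots>\<close> for all \<open>2 \<le> j < k\<close>, which are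
  too many.

  For \<open>l = r\<close> the forms \<open>f\<^sub>i(v) = \<Sum>\<^sub>j\<^sub>>\<^sub>i r\<^sup>j\<^sup>-\<^sup>i\<^sup>-\<^sup>2 v\<^sub>i\<^sub>j + \<Sum>\<^sub>j\<^sub><\<^sub>i r\<^sup>j\<^sup>-\<^sup>i v\<^sub>j\<^sub>i\<close> are permuted up to scalars by
  every \<open>T\<^sub>k\<close>. Their common kernel has dimension \<open>n(n-3)/2\<close>, is generated by \<open>x\<close>, and every
  nonzero invariant subspace of it contains \<open>x\<close>.
\<close>

section \<open>The generators acting on basis vectors\<close>

text \<open>Total functions, unlike \<open>lk_basis\<close>: sums and multiples are then plain
  pointwise expressions, and \<open>restrict\<close> appears only where the module itself is
  met.\<close>

definition wv :: "nat \<Rightarrow> nat \<Rightarrow> lk_vector" where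
  "wv i j = (\<lambda>p. if p = (i, j) then 1 else 0)"

lemma finite_index_pairs [simp]: "finite (index_pairs n)"
  by (rule finite_subset[of _ "{..n} \<times> {..n}"]) (auto simp: index_pairs_def)

locale lk_rep =
  fixes n :: nat and l r :: complex
  assumes n4: "n \<ge> 4" and l0 [simp]: "l \<noteq> 0" and r0 [simp]: "r \<noteq> 0"
    and pow_ne: "\<forall>k \<in> {1..n}. (r\<^sup>2) ^ k \<noteq> 1"
begin

abbreviation "P \<equiv> index_pairs n"
abbreviation "m \<equiv> par_m r"

definition img :: "nat \<Rightarrow> nat \<times> nat \<Rightarrow> lk_vector" where
  "img k = (\<lambda>(i, j) p.
     if i \<noteq> k \<and> i \<noteq> Suc k \<and> j \<noteq> k \<and> j \<noteq> Suc k then r * wv i j p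
     else if i = k \<and> j = Suc k then 1 / l * wv k (Suc k) p
     else if i = k then wv (Suc k) j p
     else if i = Suc k then
       wv k j p + m * r ^ (j - k - 2) * wv k (Suc k) p + (- m) * wv (Suc k) j p
     else if j = k then wv i (Suc k) p
     else wv i k p + m / (l * r ^ (k - 1 - i)) * wv k (Suc k) p + (- m) * wv i (Suc k) p)"

text \<open>Defined on arbitrary complex-valued functions, so that linearity needs no carrier
  conditions. Only the values of \<open>v\<close> on \<open>P\<close> matter.\<close>

definition T :: "nat \<Rightarrow> lk_vector \<Rightarrow> lk_vector" where
  "T k v = (\<lambda>p. \<Sum>q\<in>P. v q * img k q p)"

lemma T_add: "T k (\<lambda>p. u p + v p) = (\<lambda>p. T k u p + T k v p)"
  by (simp add: T_def algebra_simps sum.distrib)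

lemma T_scale: "T k (\<lambda>p. c * v p) = (\<lambda>p. c * T k v p)"
  by (simp add: T_def algebra_simps sum_distrib_left)

lemma T_uminus: "T k (\<lambda>p. - v p) = (\<lambda>p. - T k v p)"
  using T_scale[of k "-1" v] by simp

lemma T_diff: "T k (\<lambda>p. u p - v p) = (\<lambda>p. T k u p - T k v p)"
  by (simp add: T_def algebra_simps sum_subtractf)

lemma T_zero: "T k (\<lambda>p. 0) = (\<lambda>p. 0)"
  by (simp add: T_def)

lemma T_divide: "T k (\<lambda>p. v p / c) = (\<lambda>p. T k v p / c)"
  using T_scale[of k "1 / c" v] by simp

lemmas T_lin = T_add T_divide T_scale T_diff T_uminus T_zero

lemma T_cong: "(\<And>p. p \<in> P \<Longrightarrow> u p = v p) \<Longrightarrow> T k u = T k v"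
  by (simp add: T_def cong: sum.cong)

lemma T_sum: "T k (\<lambda>p. \<Sum>q\<in>Q. c q * f q p) = (\<lambda>p. \<Sum>q\<in>Q. c q * T k (f q) p)"
proof (cases "finite Q")
  case True
  then show ?thesis
    by (induction Q rule: finite_induct) (simp_all add: T_lin)
qed (simp add: T_zero)

lemma T_wv: "1 \<le> i \<Longrightarrow> i < j \<Longrightarrow> j \<le> n \<Longrightarrow> T k (wv i j) = img k (i, j)"
  by (simp add: T_def wv_def if_distrib[of "\<lambda>x. x * _"] cong: if_cong)
    (simp add: index_pairs_def)
 
lemma wv_expand: "p \<in> P \<Longrightarrow> v p = (\<Sum>q\<in>P. v q * wv (fst q) (snd q) p)"
  by (simp add: wv_def if_distrib[of "\<lambda>x. _ * x"] cong: if_cong)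

lemma T_expand: "T k v = (\<lambda>p. \<Sum>q\<in>P. v q * T k (wv (fst q) (snd q)) p)"
  unfolding T_sum[symmetric] by (rule T_cong) (rule wv_expand)

lemma m_eq: "m = 1 / r - r" by (simp add: par_m_def)

section \<open>Braid and commutation relations of the \<open>T k\<close>\<close>

lemma ext_T3:
  assumes "\<And>i j. 1 \<le> i \<Longrightarrow> i < j \<Longrightarrow> j \<le> n \<Longrightarrow> T a (T b (T c (wv i j))) p = T d (T e (T f (wv i j))) p"
  shows "T a (T b (T c v)) p = T d (T e (T f v)) p"
proof -
  have *: "T a (T b (T c v)) = (\<lambda>p. \<Sum>q\<in>P. v q * T a (T b (T c (wv (fst q) (snd q)))) p)" for a b c
    by (subst T_expand) (simp add: T_sum)
  show ?thesis unfolding *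
    by (rule sum.cong) (auto simp: assms index_pairs_def)
qed

lemma ext_T2:
  assumes "\<And>i j. 1 \<le> i \<Longrightarrow> i < j \<Longrightarrow> j \<le> n \<Longrightarrow> T a (T b (wv i j)) p = T d (T e (wv i j)) p"
  shows "T a (T b v) p = T d (T e v) p"
proof -
  have *: "T a (T b v) = (\<lambda>p. \<Sum>q\<in>P. v q * T a (T b (wv (fst q) (snd q))) p)" for a b
    by (subst T_expand) (simp add: T_sum)
  show ?thesis unfolding *
    by (rule sum.cong) (auto simp: assms index_pairs_def)
qed

lemma T_braid:
  assumes k: "1 \<le> k" "k + 2 \<le> n"
  shows "T k (T (Suc k) (T k v)) p = T (Suc k) (T k (T (Suc k) v)) p"
proof (rule ext_T3)
  fix i j assume ij: "1 \<le> i" "i < j" "j \<le> n"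
  consider "i < k" | "i = k" | "i = Suc k" | "i = Suc (Suc k)" | "i > k + 2" by linarith
  note ci = this
  consider "j < k" | "j = k" | "j = Suc k" | "j = Suc (Suc k)" | "j > k + 2" by linarith
  note cj = this
  show "T k (T (Suc k) (T k (wv i j))) p = T (Suc k) (T k (T (Suc k) (wv i j))) p"
    using ci
  proof cases
    case 1
    \<comment> \<open>Naming the gap between i and k turns the truncated exponents of r into sums,
      so that the powers simplify.\<close>
    then obtain e where e: "k = Suc (i + e)" using less_imp_Suc_add by blast
    show ?thesis using cj ij k unfolding e
      by cases ((simp add: T_lin T_wv img_def; simp add: m_eq field_simps)+)
  next
    case 2
    show ?thesis
    proof (cases "j > k + 2")
      case True
      then obtain e where e: "j = Suc (k + 2 + e)" using less_imp_Suc_add by blast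
      show ?thesis using ij k 2 unfolding e
        by (simp add: T_lin T_wv img_def; simp add: m_eq field_simps)
    next
      case False
      then have "j = Suc k \<or> j = Suc (Suc k)" using ij 2 by auto
      then show ?thesis using ij k 2
        by (elim disjE) ((simp add: T_lin T_wv img_def; simp add: m_eq field_simps)+)
    qed
  next
    case 3
    show ?thesis
    proof (cases "j > k + 2")
      case True
      then obtain e where e: "j = Suc (k + 2 + e)" using less_imp_Suc_add by blast
      show ?thesis using ij k 3 unfolding e
        by (simp add: T_lin T_wv img_def; simp add: m_eq field_simps)
    next
      case False
      then have "j = Suc (Suc k)" using ij 3 by auto
      then show ?thesis using ij k 3
        by ((simp add: T_lin T_wv img_def; simp add: m_eq field_simps)+)
    qed
  next
    case 4
    then obtain e where e: "j = Suc (k + 2 + e)" using less_imp_Suc_add[of "k+2" j] ij by auto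
    show ?thesis using ij k 4 unfolding e
      by (simp add: T_lin T_wv img_def; simp add: m_eq field_simps)
  next
    case 5
    show ?thesis using ij k 5
      by (simp_all add: T_lin T_wv img_def)
  qed
qed

text \<open>The gap \<open>e\<close> is exactly the exponent \<open>j - k - 2\<close> or
  \<open>k - 1 - i\<close> in \<open>img\<close>, so no truncated subtraction survives in the case
  analyses.\<close>

lemma pair_cases:
  assumes "i < j"
  obtains "i \<noteq> k" "i \<noteq> Suc k" "j \<noteq> k" "j \<noteq> Suc k" | "i = k" "j = Suc k"
    | e where "i = k" "j = Suc (Suc (k + e))" | e where "i = Suc k" "j = Suc (Suc (k + e))"
    | e where "j = k" "k = Suc (i + e)" | e where "j = Suc k" "k = Suc (i + e)"
proof -
  consider "i \<noteq> k" "i \<noteq> Suc k" "j \<noteq> k" "j \<noteq> Suc k" | "i = k" "j = Suc k"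
    | "i = k" "Suc k < j" | "i = Suc k" "Suc k < j" | "i < k" "j = k" | "i < k" "j = Suc k"
    using assms by linarith
  then show thesis
  proof cases
    case 3
    then show thesis using that(3)[of "j - k - 2"] by simp
  next
    case 4
    then show thesis using that(4)[of "j - k - 2"] by simp
  next
    case 5
    then show thesis using that(5)[of "k - i - 1"] by simp
  next
    case 6
    then show thesis using that(6)[of "k - i - 1"] by simp
  qed (use that in blast)+
qed

lemma T_comm_aux:
  assumes a: "1 \<le> a" "a + 2 \<le> b" "b < n"
  shows "T a (T b v) p = T b (T a v) p"
proof (rule ext_T2)
  fix i j assume ij: "1 \<le> i" "i < j" "j \<le> n"
  obtain e where e: "b = a + 2 + e" using a(2) le_Suc_ex by blast
  note rules = T_lin T_wv img_def
  from ij(2) show "T a (T b (wv i j)) p = T b (T a (wv i j)) p"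
  proof (cases rule: pair_cases[of i j a])
    case 1
    from ij(2) show ?thesis
      by (cases rule: pair_cases[of i j b])
        (use 1 ij a e in \<open>simp_all add: rules\<close>, simp_all add: algebra_simps)
  next
    case 2
    then show ?thesis using ij a e by (simp add: rules)
  next
    case 3
    from ij(2) show ?thesis
      by (cases rule: pair_cases[of i j b]) (use 3 ij a e in \<open>simp_all add: rules\<close>, auto)
  next
    case (4 d)
    \<comment> \<open>For j = b + 1 both generators produce correction terms, and the coefficients
      of w_{a,a+1} agree because m r = 1 - r^2.\<close>
    consider "j \<noteq> b" "j \<noteq> Suc b" | "j = b" | "j = Suc b" by blast
    then show ?thesis
    proof cases
      case 1
      then show ?thesis using 4 ij a e by (simp add: rules; simp add: algebra_simps)
    next
      case 2
      then have "d = e" using 4 e by simp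
      then show ?thesis using 2 4 ij a e by (simp add: rules; simp add: algebra_simps)
    next
      case 3
      then have "d = Suc e" using 4 e by simp
      then show ?thesis using 3 4 ij a e by (simp add: rules; simp add: m_eq field_simps)
    qed
  next
    case 5
    then show ?thesis using ij a e by (simp add: rules)
  next
    case 6
    then show ?thesis using ij a e by (simp add: rules; simp add: algebra_simps)
  qed
qed

lemma T_comm:
  assumes "1 \<le> a" "a < n" "1 \<le> b" "b < n" "\<bar>int a - int b\<bar> \<ge> 2"
  shows "T a (T b v) p = T b (T a v) p"
proof (cases "a < b")
  case True
  then show ?thesis using assms by (intro T_comm_aux) auto
next
  case False
  then show ?thesis using assms by (intro T_comm_aux[symmetric]) auto
qed

text \<open>\<open>E k\<close> is \<open>m / l\<close> times the action of \<open>e\<^sub>k\<close>; it has rank 1, with \<open>e_coeff k\<close> the corresponding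
  linear form.\<close>

definition E :: "nat \<Rightarrow> lk_vector \<Rightarrow> lk_vector" where
  "E k v = (\<lambda>p. T k (T k v) p + m * T k v p - v p)"

definition e_coeff_basis :: "nat \<Rightarrow> nat \<times> nat \<Rightarrow> complex" where
  "e_coeff_basis k = (\<lambda>(i, j).
     if i \<noteq> k \<and> i \<noteq> Suc k \<and> j \<noteq> k \<and> j \<noteq> Suc k then 0
     else if i = k \<and> j = Suc k then (1 / l + 1 / r) * (1 / l - r)
     else if i = k then m * r ^ (j - k - 2)
     else if i = Suc k then m * r ^ (j - k - 2) / l
     else if j = k then m / (l * r ^ (k - 1 - i))
     else m / (l ^ 2 * r ^ (k - 1 - i)))"

definition e_coeff :: "nat \<Rightarrow> lk_vector \<Rightarrow> complex" where
  "e_coeff k v = (\<Sum>q\<in>P. v q * e_coeff_basis k q)"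

lemma E_sum: "E k (\<lambda>p. \<Sum>q\<in>Q. c q * f q p) = (\<lambda>p. \<Sum>q\<in>Q. c q * E k (f q) p)"
  by (simp add: E_def T_sum algebra_simps sum.distrib sum_subtractf sum_distrib_left)

text \<open>Modulo w_{k,k+1}, \<open>T k\<close> acts on the other basis vectors as the scalar r, or
  on a swapped pair by the matrix with rows (0, 1) and (1, -m). Both satisfy X^2 + m X - 1 = 0, so
  only a multiple of w_{k,k+1} is left.\<close>

lemma E_wv:
  assumes k: "1 \<le> k" "k < n" and ij: "1 \<le> i" "i < j" "j \<le> n"
  shows "E k (wv i j) p = e_coeff_basis k (i, j) * wv k (Suc k) p"
proof -
  from ij(2) show ?thesis
    apply (cases rule: pair_cases[of i j k])
    subgoal using k ij by (simp add: E_def e_coeff_basis_def T_lin T_wv img_def) (simp add: m_eq field_simps power2_eq_square)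
    subgoal using k ij by (simp add: E_def e_coeff_basis_def T_lin T_wv img_def m_eq algebra_simps add_divide_distrib diff_divide_distrib)
    subgoal for e using k ij by (simp add: E_def e_coeff_basis_def T_lin T_wv img_def)
    subgoal for e using k ij by (simp add: E_def e_coeff_basis_def T_lin T_wv img_def)
    subgoal for e using k ij by (simp add: E_def e_coeff_basis_def T_lin T_wv img_def)
    subgoal for e using k ij by (simp add: E_def e_coeff_basis_def T_lin T_wv img_def power2_eq_square)
    done
qed

lemma E_eq:
  assumes k: "1 \<le> k" "k < n" and p: "p \<in> P"
  shows "E k v p = e_coeff k v * wv k (Suc k) p"
proof -
  have "E k v p = E k (\<lambda>p. \<Sum>q\<in>P. v q * wv (fst q) (snd q) p) p"
    using p by (simp add: E_def wv_expand[symmetric] T_cong[OF wv_expand[symmetric]]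
        del: prod.collapse)
  also have "\<dots> = (\<Sum>q\<in>P. v q * (e_coeff_basis k q * wv k (Suc k) p))"
    unfolding E_sum by (rule sum.cong) (auto simp: E_wv[OF k] index_pairs_def)
  finally show ?thesis by (simp add: e_coeff_def sum_distrib_right mult.assoc)
qed

lemma e_coeff_add: "e_coeff k (\<lambda>p. u p + v p) = e_coeff k u + e_coeff k v"
  by (simp add: e_coeff_def algebra_simps sum.distrib)
lemma e_coeff_scale: "e_coeff k (\<lambda>p. c * v p) = c * e_coeff k v"
  by (simp add: e_coeff_def algebra_simps sum_distrib_left)
lemma e_coeff_diff: "e_coeff k (\<lambda>p. u p - v p) = e_coeff k u - e_coeff k v"
  by (simp add: e_coeff_def algebra_simps sum_subtractf)
lemma e_coeff_uminus: "e_coeff k (\<lambda>p. - v p) = - e_coeff k v"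
  using e_coeff_scale[of k "-1" v] by simp
lemma e_coeff_divide: "e_coeff k (\<lambda>p. v p / c) = e_coeff k v / c"
  using e_coeff_scale[of k "1 / c" v] by simp
lemmas e_coeff_lin = e_coeff_add e_coeff_scale e_coeff_diff e_coeff_divide e_coeff_uminus

lemma e_coeff_wv: "1 \<le> i \<Longrightarrow> i < j \<Longrightarrow> j \<le> n \<Longrightarrow> e_coeff k (wv i j) = e_coeff_basis k (i, j)"
  by (simp add: e_coeff_def wv_def if_distrib[of "\<lambda>x. x * _"] cong: if_cong)
    (simp add: index_pairs_def)

lemma T_E:
  assumes k: "1 \<le> k" "k < n"
  shows "T k (E k v) p = e_coeff k v / l * wv k (Suc k) p"
proof -
  have "T k (E k v) = T k (\<lambda>p. e_coeff k v * wv k (Suc k) p)"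
    by (rule T_cong) (simp add: E_eq[OF k])
  then show ?thesis using k by (simp add: T_lin T_wv img_def)
qed

text \<open>This is e_i g_j e_i = l e_i with each e_i rescaled by m / l, so l becomes m. As the
  image of \<open>E k\<close> is a line, it reduces to the value of \<open>e_coeff k\<close> on
  \<open>T k' (wv k (Suc k))\<close>.\<close>

lemma E_T_E:
  assumes k: "1 \<le> k" "k < n" and k': "1 \<le> k'" "k' < n" "k' = Suc k \<or> k = Suc k'" and p: "p \<in> P"
  shows "E k (T k' (E k v)) p = m * E k v p"
proof -
  have "T k' (E k v) = T k' (\<lambda>p. e_coeff k v * wv k (Suc k) p)"
    by (rule T_cong) (simp add: E_eq[OF k])
  moreover have "e_coeff k (T k' (wv k (Suc k))) = m"
    using k' k
    by (elim disjE) (simp_all add: T_wv img_def e_coeff_lin e_coeff_wv e_coeff_basis_def,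
       simp_all add: m_eq field_simps power2_eq_square)
  ultimately show ?thesis by (simp add: E_eq[OF k p] e_coeff_lin T_lin)
qed

text \<open>The inverse of \<open>T k\<close>, since \<open>T k (T k + m) = 1 + E k\<close> and \<open>T k E k = E k / l\<close>.\<close>

definition Tinv :: "nat \<Rightarrow> lk_vector \<Rightarrow> lk_vector" where
  "Tinv k v = (\<lambda>p. T k v p + m * v p - l * E k v p)"

lemma T_Tinv:
  assumes k: "1 \<le> k" "k < n" and p: "p \<in> P"
  shows "T k (Tinv k v) p = v p"
proof -
  have "T k (Tinv k v) p = T k (T k v) p + m * T k v p - l * T k (E k v) p"
    by (simp add: Tinv_def T_lin)
  also have "\<dots> = v p + E k v p - l * T k (E k v) p" by (simp add: E_def)
  also have "\<dots> = v p" by (simp add: T_E[OF k] E_eq[OF k p])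
  finally show ?thesis .
qed

lemma Tinv_T:
  assumes k: "1 \<le> k" "k < n" and p: "p \<in> P"
  shows "Tinv k (T k v) p = v p"
proof -
  have "E k (T k v) = T k (E k v)" by (simp add: E_def T_lin)
  then have "Tinv k (T k v) = T k (Tinv k v)" by (simp add: Tinv_def T_lin)
  then show ?thesis using T_Tinv assms by simp
qed

end

section \<open>The action of the BMW algebra\<close>

lemma base_field_simps:
  "x \<oplus>\<^bsub>base_field l r\<^esub> y = x + y" "x \<otimes>\<^bsub>base_field l r\<^esub> y = x * y"
  "\<zero>\<^bsub>base_field l r\<^esub> = 0" "\<one>\<^bsub>base_field l r\<^esub> = 1"
  by (simp_all add: base_field_def ring_of_type_algebra_def)

lemma carrier_lk_space: "carrier (lk_space n l r) = index_pairs n \<rightarrow>\<^sub>E carrier (base_field l r)"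
  and lk_space_add: "u \<oplus>\<^bsub>lk_space n l r\<^esub> v = (\<lambda>p\<in>index_pairs n. u p + v p)"
  and lk_space_smult: "c \<odot>\<^bsub>lk_space n l r\<^esub> v = (\<lambda>p\<in>index_pairs n. c * v p)"
  and lk_space_zero: "\<zero>\<^bsub>lk_space n l r\<^esub> = (\<lambda>p\<in>index_pairs n. 0)"
proof -
  interpret field "base_field l r" by (rule field_base_field)
  show "carrier (lk_space n l r) = index_pairs n \<rightarrow>\<^sub>E carrier (base_field l r)"
    "u \<oplus>\<^bsub>lk_space n l r\<^esub> v = (\<lambda>p\<in>index_pairs n. u p + v p)"
    "c \<odot>\<^bsub>lk_space n l r\<^esub> v = (\<lambda>p\<in>index_pairs n. c * v p)"
    "\<zero>\<^bsub>lk_space n l r\<^esub> = (\<lambda>p\<in>index_pairs n. 0)"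
    unfolding lk_space_def func_space_def by (simp_all add: base_field_simps)
qed

lemma base_field_power:
  "x \<in> carrier (base_field l r) \<Longrightarrow> x ^ k \<in> carrier (base_field l r)"
  by (induction k) (auto simp: base_field_consts base_field_add_mult)

lemma base_field_sum:
  "(\<And>i. i \<in> A \<Longrightarrow> f i \<in> carrier (base_field l r)) \<Longrightarrow> sum f A \<in> carrier (base_field l r)"
  by (induction A rule: infinite_finite_induct) (auto simp: base_field_consts base_field_add_mult)

lemma lk_finsum:
  assumes "finite A" "\<And>a. a \<in> A \<Longrightarrow> f a \<in> carrier (lk_space n l r)"
  shows "(\<Oplus>\<^bsub>lk_space n l r\<^esub> a \<in> A. f a) = (\<lambda>p\<in>index_pairs n. \<Sum>a\<in>A. f a p)"
proof -
  interpret V: vectorspace "base_field l r" "lk_space n l r" by (rule vectorspace_lk_space)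
  show ?thesis using assms
  proof (induction A rule: finite_induct)
    case empty
    then show ?case by (simp add: lk_space_zero)
  next
    case (insert x A)
    then show ?case
      by (subst V.finsum_insert) (auto simp: lk_space_add restrict_def fun_eq_iff)
  qed
qed

context lk_rep begin

abbreviation "F \<equiv> carrier (base_field l r)"
abbreviation "V \<equiv> lk_space n l r"

lemma m_in_F [intro]: "m \<in> F"
  unfolding par_m_def by (intro base_field_diff_divide base_field_consts)

lemmas F_intros = base_field_add_mult base_field_uminus base_field_diff_divide
  base_field_inverse base_field_power base_field_sum base_field_consts m_in_F

lemma restrict_in_V: "restrict v P \<in> carrier V \<longleftrightarrow> (\<forall>p\<in>P. v p \<in> F)"
  by (auto simp: carrier_lk_space)

lemma V_values: "v \<in> carrier V \<Longrightarrow> p \<in> P \<Longrightarrow> v p \<in> F"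
  by (auto simp: carrier_lk_space)

lemma V_eqI: "u \<in> carrier V \<Longrightarrow> v \<in> carrier V \<Longrightarrow> (\<And>p. p \<in> P \<Longrightarrow> u p = v p) \<Longrightarrow> u = v"
  by (metis PiE_ext carrier_lk_space)

lemma V_restrict: "v \<in> carrier V \<Longrightarrow> restrict v P = v"
  by (auto simp: carrier_lk_space)

lemma wv_in_F [intro]: "wv i j p \<in> F"
  by (simp add: wv_def F_intros)

lemma img_in_F: "img k q p \<in> F"
  by (cases q) (auto simp: img_def intro!: F_intros)

lemma T_in_F: "(\<And>p. p \<in> P \<Longrightarrow> v p \<in> F) \<Longrightarrow> T k v p \<in> F"
  unfolding T_def by (intro F_intros img_in_F)

lemma E_in_F: "(\<And>p. p \<in> P \<Longrightarrow> v p \<in> F) \<Longrightarrow> p \<in> P \<Longrightarrow> E k v p \<in> F"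
  unfolding E_def by (intro F_intros T_in_F)

lemma Tinv_in_F: "(\<And>p. p \<in> P \<Longrightarrow> v p \<in> F) \<Longrightarrow> p \<in> P \<Longrightarrow> Tinv k v p \<in> F"
  unfolding Tinv_def by (intro F_intros T_in_F E_in_F)

lemma T_restrict [simp]: "T k (restrict v P) = T k v"
  by (rule T_cong) simp

lemma E_restrict: "p \<in> P \<Longrightarrow> E k (restrict v P) p = E k v p"
  by (simp add: E_def)

lemma Tinv_restrict: "p \<in> P \<Longrightarrow> Tinv k (restrict v P) p = Tinv k v p"
  by (simp add: Tinv_def E_restrict)

lemma lk_basis_eq: "lk_basis n i j = restrict (wv i j) P"
  by (auto simp: lk_basis_def wv_def)

lemma nu_basis_eq: "q \<in> P \<Longrightarrow> nu_basis n l r k q = restrict (img k q) P"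
  by (cases q) (auto simp: nu_basis_def img_def Let_def lk_basis_eq lk_space_smult lk_space_add
      fun_eq_iff restrict_def divide_inverse)

lemma nu_eq:
  assumes "v \<in> carrier V"
  shows "nu n l r k v = restrict (T k v) P"
proof -
  have "nu n l r k v = (\<lambda>p\<in>P. \<Sum>q\<in>P. (v q \<odot>\<^bsub>V\<^esub> nu_basis n l r k q) p)"
    unfolding nu_def
    by (rule lk_finsum) (auto simp: lk_space_smult nu_basis_eq restrict_in_V img_in_F
        intro!: F_intros V_values[OF assms] cong: restrict_cong)
  also have "\<dots> = restrict (T k v) P"
    by (auto simp: restrict_def fun_eq_iff T_def lk_space_smult nu_basis_eq intro!: sum.cong)
  finally show ?thesis .
qed

text \<open>\<open>inv_into\<close> chooses some preimage; the two-sided inverse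
  \<open>Tinv k\<close> makes that choice unique.\<close>

lemma inv_nu_eq:
  assumes k: "1 \<le> k" "k < n" and v: "v \<in> carrier V"
  shows "inv_into (carrier V) (nu n l r k) v = restrict (Tinv k v) P"
proof (rule inv_into_f_eq)
  show "inj_on (nu n l r k) (carrier V)"
  proof (rule inj_on_inverseI[where g = "\<lambda>v. restrict (Tinv k v) P"])
    fix u assume u: "u \<in> carrier V"
    show "restrict (Tinv k (nu n l r k u)) P = u"
      using u by (intro V_eqI)
        (auto simp: restrict_in_V nu_eq Tinv_restrict Tinv_T[OF k] V_values)
  qed
  show "restrict (Tinv k v) P \<in> carrier V"
    using v by (simp add: restrict_in_V Tinv_in_F V_values)
  then show "nu n l r k (restrict (Tinv k v) P) = v"
    using v by (intro V_eqI) (auto simp: nu_eq restrict_in_V T_in_F V_values T_Tinv[OF k] Tinv_in_F)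
qed

end

lemma letters_plus: "letters (u + v) = letters u @ letters v"
  by (simp add: plus_word_def)

context lk_rep begin

section \<open>Linear endomorphisms of the space\<close>

lemma V_add: "u \<in> carrier V \<Longrightarrow> v \<in> carrier V \<Longrightarrow> (\<lambda>p\<in>P. u p + v p) \<in> carrier V"
  by (simp add: restrict_in_V F_intros V_values)

lemma V_scale: "c \<in> F \<Longrightarrow> v \<in> carrier V \<Longrightarrow> (\<lambda>p\<in>P. c * v p) \<in> carrier V"
  by (simp add: restrict_in_V F_intros V_values)

lemma V_sum:
  "(\<And>a. a \<in> A \<Longrightarrow> c a \<in> F) \<Longrightarrow> (\<And>a. a \<in> A \<Longrightarrow> u a \<in> carrier V)
    \<Longrightarrow> (\<lambda>p\<in>P. \<Sum>a\<in>A. c a * u a p) \<in> carrier V"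
  by (simp add: restrict_in_V F_intros V_values)

definition endo :: "(lk_vector \<Rightarrow> lk_vector) \<Rightarrow> bool" where
  "endo f \<longleftrightarrow> f \<in> carrier V \<rightarrow> carrier V \<and>
     (\<forall>u\<in>carrier V. \<forall>v\<in>carrier V. f (\<lambda>p\<in>P. u p + v p) = (\<lambda>p\<in>P. f u p + f v p)) \<and>
     (\<forall>c\<in>F. \<forall>v\<in>carrier V. f (\<lambda>p\<in>P. c * v p) = (\<lambda>p\<in>P. c * f v p))"

lemma endo_closed: "endo f \<Longrightarrow> v \<in> carrier V \<Longrightarrow> f v \<in> carrier V"
  by (auto simp: endo_def)

lemma endo_comp: "endo f \<Longrightarrow> endo g \<Longrightarrow> endo (\<lambda>v. f (g v))"
  unfolding endo_def by (auto simp: Pi_iff)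

lemma endo_zero: "endo f \<Longrightarrow> f (\<lambda>p\<in>P. 0) = (\<lambda>p\<in>P. 0)"
proof -
  assume f: "endo f"
  have "(\<lambda>p\<in>P. 0) \<in> carrier V" by (auto simp: restrict_in_V intro!: F_intros)
  moreover have "\<And>c v. c \<in> F \<Longrightarrow> v \<in> carrier V \<Longrightarrow> f (\<lambda>p\<in>P. c * v p) = (\<lambda>p\<in>P. c * f v p)"
    using f by (simp add: endo_def)
  ultimately show ?thesis
    using base_field_consts(1) by (metis (no_types, lifting) mult_zero_left restrict_ext)
qed

lemma endo_sum:
  assumes f: "endo f" and "finite A" "\<And>a. a \<in> A \<Longrightarrow> c a \<in> F" "\<And>a. a \<in> A \<Longrightarrow> u a \<in> carrier V"
  shows "f (\<lambda>p\<in>P. \<Sum>a\<in>A. c a * u a p) = (\<lambda>p\<in>P. \<Sum>a\<in>A. c a * f (u a) p)"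
  using assms(2-)
proof (induction A rule: finite_induct)
  case empty
  show ?case by (simp only: sum.empty endo_zero[OF f])
next
  case (insert x A)
  have 1: "(\<lambda>p\<in>P. c x * u x p) \<in> carrier V" "(\<lambda>p\<in>P. \<Sum>a\<in>A. c a * u a p) \<in> carrier V"
    using insert.prems by (auto intro!: V_scale V_sum)
  have "f (\<lambda>p\<in>P. \<Sum>a\<in>insert x A. c a * u a p)
      = f (\<lambda>p\<in>P. (\<lambda>p\<in>P. c x * u x p) p + (\<lambda>p\<in>P. \<Sum>a\<in>A. c a * u a p) p)"
    using insert.hyps by (intro arg_cong[of _ _ f]) auto
  also have "\<dots> = (\<lambda>p\<in>P. f (\<lambda>p\<in>P. c x * u x p) p + f (\<lambda>p\<in>P. \<Sum>a\<in>A. c a * u a p) p)"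
    using f 1 unfolding endo_def by blast
  also have "f (\<lambda>p\<in>P. \<Sum>a\<in>A. c a * u a p) = (\<lambda>p\<in>P. \<Sum>a\<in>A. c a * f (u a) p)"
    using insert.IH insert.prems by blast
  also have "f (\<lambda>p\<in>P. c x * u x p) = (\<lambda>p\<in>P. c x * f (u x) p)"
    using f insert.prems unfolding endo_def by blast
  finally show ?case using insert.hyps by (auto intro!: restrict_ext)
qed

definition gens :: "letter set" where "gens = Gen ` {1..n - 1} \<union> GenInv ` {1..n - 1}"

text \<open>Transfers linearity from a map \<open>f\<close> on total functions to its restricted
  version \<open>g\<close> on the module, for \<open>T k\<close> and \<open>Tinv k\<close>
  alike.\<close>

lemma endo_restrict:
  assumes "\<And>v p. (\<And>p. p \<in> P \<Longrightarrow> v p \<in> F) \<Longrightarrow> p \<in> P \<Longrightarrow> f v p \<in> F"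
    and "\<And>u v. f (\<lambda>p. u p + v p) = (\<lambda>p. f u p + f v p)"
    and "\<And>c v. f (\<lambda>p. c * v p) = (\<lambda>p. c * f v p)"
    and "\<And>v p. p \<in> P \<Longrightarrow> f (restrict v P) p = f v p"
    and "\<And>v. v \<in> carrier V \<Longrightarrow> g v = restrict (f v) P"
  shows "endo g"
proof -
  have "g v \<in> carrier V" if "v \<in> carrier V" for v
    using that by (simp add: assms(5) restrict_in_V assms(1) V_values)
  moreover have "g (\<lambda>p\<in>P. u p + v p) = (\<lambda>p\<in>P. g u p + g v p)"
    if uv: "u \<in> carrier V" "v \<in> carrier V" for u v
  proof -
    have "g (\<lambda>p\<in>P. u p + v p) = restrict (f (\<lambda>p\<in>P. u p + v p)) P"
      using uv by (intro assms(5) V_add)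
    then show ?thesis using uv by (auto simp: assms(2,4,5) intro!: restrict_ext)
  qed
  moreover have "g (\<lambda>p\<in>P. c * v p) = (\<lambda>p\<in>P. c * g v p)"
    if cv: "c \<in> F" "v \<in> carrier V" for c v
  proof -
    have "g (\<lambda>p\<in>P. c * v p) = restrict (f (\<lambda>p\<in>P. c * v p)) P"
      using cv by (intro assms(5) V_scale)
    then show ?thesis using cv by (auto simp: assms(3,4,5) intro!: restrict_ext)
  qed
  ultimately show ?thesis unfolding endo_def by blast
qed

lemma E_add: "E k (\<lambda>p. u p + v p) = (\<lambda>p. E k u p + E k v p)"
  by (simp add: E_def T_lin algebra_simps)

lemma E_scale: "E k (\<lambda>p. c * v p) = (\<lambda>p. c * E k v p)"
  by (simp add: E_def T_lin algebra_simps)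

lemma endo_letter: "x \<in> gens \<Longrightarrow> endo (letter_action n l r x)"
proof (cases x)
  case (Gen k)
  then show ?thesis
    by (intro endo_restrict[of "T k"]) (simp_all add: T_in_F T_lin nu_eq)
next
  case (GenInv k)
  assume "x \<in> gens"
  with GenInv have "1 \<le> k" "k < n" using n4 by (auto simp: gens_def)
  with GenInv show ?thesis
    by (intro endo_restrict[of "Tinv k"]) (simp_all add: Tinv_in_F Tinv_restrict inv_nu_eq,
       simp_all add: Tinv_def T_lin E_add E_scale algebra_simps)
qed

abbreviation word_act :: "letter word \<Rightarrow> lk_vector \<Rightarrow> lk_vector" where
  "word_act w v \<equiv> foldr (letter_action n l r) (letters w) v"

lemma endo_word: "set (letters w) \<subseteq> gens \<Longrightarrow> endo (word_act w)"
proof -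
  have "endo (foldr (letter_action n l r) xs)" if "set xs \<subseteq> gens" for xs
    using that
  proof (induction xs)
    case Nil
    show ?case by (simp add: endo_def)
  next
    case (Cons x xs)
    then show ?case using endo_comp[OF endo_letter[of x]] by (simp add: comp_def)
  qed
  then show "set (letters w) \<subseteq> gens \<Longrightarrow> endo (word_act w)" .
qed

section \<open>The free algebra acting on the space\<close>

abbreviation "FA \<equiv> free_algebra n l r"
abbreviation "act \<equiv> free_action n l r"

lemma FA_D:
  assumes "a \<in> carrier FA"
  shows "Poly_Mapping.lookup a w \<in> F"
    "w \<in> Poly_Mapping.keys a \<Longrightarrow> set (letters w) \<subseteq> gens"
  using assms unfolding carrier_free_algebra gens_def by auto

text \<open>The support of a + b may be smaller than the union of the supports. Summing over a
  finite superset gives a, b and a + b a common index set.\<close>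

lemma act_superset:
  assumes a: "a \<in> carrier FA" and v: "v \<in> carrier V" and S: "finite S" "Poly_Mapping.keys a \<subseteq> S"
  shows "act a v = (\<lambda>p\<in>P. \<Sum>w\<in>S. Poly_Mapping.lookup a w * word_act w v p)"
proof -
  have "act a v = (\<lambda>p\<in>P. \<Sum>w\<in>Poly_Mapping.keys a. (Poly_Mapping.lookup a w \<odot>\<^bsub>V\<^esub> word_act w v) p)"
    unfolding free_action_def
    by (rule lk_finsum) (auto simp: lk_space_smult restrict_in_V
        intro!: F_intros FA_D[OF a] V_values[OF endo_closed[OF endo_word v]])
  also have "\<dots> = (\<lambda>p\<in>P. \<Sum>w\<in>Poly_Mapping.keys a. Poly_Mapping.lookup a w * word_act w v p)"
    by (intro restrict_ext) (simp add: lk_space_smult)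
  also have "\<dots> = (\<lambda>p\<in>P. \<Sum>w\<in>S. Poly_Mapping.lookup a w * word_act w v p)"
    by (intro restrict_ext sum.mono_neutral_left) (use S in \<open>auto simp: in_keys_iff\<close>)
  finally show ?thesis .
qed

lemmas act_eq = act_superset[OF _ _ finite_keys subset_refl]

lemma endo_act:
  assumes a: "a \<in> carrier FA"
  shows "endo (act a)"
proof -
  have w: "endo (word_act w)" if "w \<in> Poly_Mapping.keys a" for w
    using endo_word FA_D[OF a] that by blast
  have closed: "act a v \<in> carrier V" if v: "v \<in> carrier V" for v
    unfolding act_eq[OF a v] restrict_in_V
    by (auto intro!: F_intros FA_D[OF a] V_values[OF endo_closed[OF w v]])
  have "act a (\<lambda>p\<in>P. u p + v p) = (\<lambda>p\<in>P. act a u p + act a v p)"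
    if uv: "u \<in> carrier V" "v \<in> carrier V" for u v
  proof -
    have "(\<lambda>p\<in>P. u p + v p) \<in> carrier V"
      using uv by (rule V_add)
    moreover have "word_act w (\<lambda>p\<in>P. u p + v p) = (\<lambda>p\<in>P. word_act w u p + word_act w v p)"
      if "w \<in> Poly_Mapping.keys a" for w
      using w[OF that] uv unfolding endo_def by blast
    ultimately show ?thesis
      using closed[THEN V_values] uv by (intro V_eqI closed V_add)
        (simp_all add: act_eq[OF a] uv algebra_simps sum.distrib)
  qed
  moreover have "act a (\<lambda>p\<in>P. c * v p) = (\<lambda>p\<in>P. c * act a v p)"
    if v: "c \<in> F" "v \<in> carrier V" for c v
  proof -
    have "(\<lambda>p\<in>P. c * v p) \<in> carrier V"
      using v by (rule V_scale)
    moreover have "word_act w (\<lambda>p\<in>P. c * v p) = (\<lambda>p\<in>P. c * word_act w v p)"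
      if "w \<in> Poly_Mapping.keys a" for w
      using w[OF that] v unfolding endo_def by blast
    ultimately show ?thesis
      using closed[THEN V_values] v by (intro V_eqI closed V_scale)
        (simp_all add: act_eq[OF a] v algebra_simps sum_distrib_left)
  qed
  ultimately show ?thesis using closed unfolding endo_def by blast
qed

lemma act_closed: "a \<in> carrier FA \<Longrightarrow> v \<in> carrier V \<Longrightarrow> act a v \<in> carrier V"
  using endo_act endo_closed by blast

lemma act_add:
  assumes "a \<in> carrier FA" "b \<in> carrier FA" "v \<in> carrier V" "p \<in> P"
  shows "act (a + b) v p = act a v p + act b v p"
proof -
  let ?S = "Poly_Mapping.keys a \<union> Poly_Mapping.keys b"
  have "Poly_Mapping.keys (a + b) \<subseteq> ?S" by (rule Poly_Mapping.keys_add)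
  then show ?thesis using assms
    by (simp add: act_superset[of _ _ ?S] free_algebra_add lookup_add algebra_simps sum.distrib)
qed

lemma act_uminus:
  assumes "a \<in> carrier FA" "v \<in> carrier V" "p \<in> P"
  shows "act (- a) v p = - act a v p"
  using assms by (simp add: act_eq free_algebra_uminus sum_negf)

lemma act_diff:
  assumes "a \<in> carrier FA" "b \<in> carrier FA" "v \<in> carrier V" "p \<in> P"
  shows "act (a - b) v p = act a v p - act b v p"
  using act_add[OF assms(1) free_algebra_uminus[OF assms(2)] assms(3,4)] act_uminus[OF assms(2-)]
  by simp

lemma act_single:
  assumes "c \<in> F" "set (letters w) \<subseteq> gens" "v \<in> carrier V" "p \<in> P"
  shows "act (Poly_Mapping.single w c) v p = c * word_act w v p"
proof -
  have "Poly_Mapping.single w c \<in> carrier FA"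
    using assms(1,2) unfolding gens_def by (rule free_algebra_single)
  then show ?thesis using assms(3,4)
    by (subst act_superset[of _ _ "{w}"]) auto
qed

lemma act_sum:
  assumes "finite I" "\<And>i. i \<in> I \<Longrightarrow> f i \<in> carrier FA" "v \<in> carrier V" "p \<in> P"
  shows "act (sum f I) v p = (\<Sum>i\<in>I. act (f i) v p)"
  using assms(1,2)
proof (induction I rule: finite_induct)
  case empty
  have "act 0 v = (\<lambda>p\<in>P. 0)"
    using lk_finsum[of "{}" "\<lambda>w. 0 \<odot>\<^bsub>V\<^esub> word_act w v" n l r] unfolding free_action_def by simp
  then show ?case using assms(4) by simp
next
  case (insert x I)
  then show ?case using assms(3,4) by (simp add: act_add free_algebra_sum)
qed

text \<open>Both factors are expanded into monomials. Concatenated words act as composed operators,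
  and \<open>endo_sum\<close> moves the operator of the left word through the sum over the right
  factor.\<close>

lemma act_mult:
  assumes a: "a \<in> carrier FA" and b: "b \<in> carrier FA" and v: "v \<in> carrier V"
  shows "act (a * b) v = act a (act b v)"
proof (rule V_eqI)
  let ?A = "Poly_Mapping.keys a" and ?B = "Poly_Mapping.keys b"
  let ?a = "Poly_Mapping.lookup a" and ?b = "Poly_Mapping.lookup b"
  show "act (a * b) v \<in> carrier V" "act a (act b v) \<in> carrier V"
    using assms by (auto intro!: act_closed free_algebra_mult)
  fix p assume p: "p \<in> P"
  have mem: "Poly_Mapping.single (u + w) (?a u * ?b w) \<in> carrier FA" if "u \<in> ?A" "w \<in> ?B" for u w
    using FA_D[OF a] FA_D[OF b] that
    by (intro free_algebra_single) (auto simp: letters_plus gens_def intro!: F_intros)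
  have "a * b = (\<Sum>u\<in>?A. \<Sum>w\<in>?B. Poly_Mapping.single (u + w) (?a u * ?b w))"
    using arg_cong2[OF poly_mapping_sum_single[of a] poly_mapping_sum_single[of b],
        of "(*)", unfolded sum_product mult_single] .
  then have "act (a * b) v p = act (\<Sum>u\<in>?A. \<Sum>w\<in>?B. Poly_Mapping.single (u + w) (?a u * ?b w)) v p"
    by simp
  also have "\<dots> = (\<Sum>u\<in>?A. \<Sum>w\<in>?B. act (Poly_Mapping.single (u + w) (?a u * ?b w)) v p)"
    using mem v p by (simp add: act_sum free_algebra_sum)
  also have "\<dots> = (\<Sum>u\<in>?A. ?a u * (\<Sum>w\<in>?B. ?b w * word_act u (word_act w v) p))"
    unfolding sum_distrib_left
  proof (intro sum.cong refl)
    fix u w assume uw: "u \<in> ?A" "w \<in> ?B"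
    then have "set (letters u) \<subseteq> gens" "set (letters w) \<subseteq> gens" "?a u \<in> F" "?b w \<in> F"
      using FA_D a b by blast+
    then show "act (Poly_Mapping.single (u + w) (?a u * ?b w)) v p
        = ?a u * (?b w * word_act u (word_act w v) p)"
      using v p by (subst act_single) (auto simp: letters_plus intro!: F_intros)
  qed
  also have "\<dots> = (\<Sum>u\<in>?A. ?a u * word_act u (act b v) p)"
  proof (intro sum.cong refl arg_cong2[of _ _ _ _ "(*)"])
    fix u assume u: "u \<in> ?A"
    have "word_act u (act b v) = (\<lambda>p\<in>P. \<Sum>w\<in>?B. ?b w * word_act u (word_act w v) p)"
      unfolding act_eq[OF b v]
      by (rule endo_sum[OF endo_word])
        (use FA_D[OF a] FA_D[OF b] u v endo_closed[OF endo_word] in \<open>auto dest: subsetD\<close>)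
    then show "(\<Sum>w\<in>?B. ?b w * word_act u (word_act w v) p) = word_act u (act b v) p"
      using p by simp
  qed
  also have "\<dots> = act a (act b v) p"
    using p by (simp add: act_eq[OF a act_closed[OF b v]])
  finally show "act (a * b) v p = act a (act b v) p" .
qed

lemma act_scal: "c \<in> F \<Longrightarrow> v \<in> carrier V \<Longrightarrow> act (scal c) v = (\<lambda>p\<in>P. c * v p)"
  by (intro V_eqI act_closed V_scale)
    (auto simp: scal_def act_single zero_word_def intro!: free_algebra_single)

lemma act_gen: "i \<in> {1..n - 1} \<Longrightarrow> v \<in> carrier V \<Longrightarrow> act (gen i) v = restrict (T i v) P"
  by (intro V_eqI act_closed)
    (auto simp: gen_def act_single gens_def nu_eq restrict_in_V T_in_F V_values F_intros
      intro!: free_algebra_single)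

lemma act_gen_inv:
  assumes "i \<in> {1..n - 1}" "v \<in> carrier V"
  shows "act (gen_inv i) v = restrict (Tinv i v) P"
proof -
  have "1 \<le> i" "i < n" using assms n4 by auto
  then show ?thesis using assms(2)
    by (intro V_eqI act_closed)
      (auto simp: gen_inv_def act_single gens_def inv_nu_eq restrict_in_V Tinv_in_F V_values F_intros
        intro!: free_algebra_single)
qed

lemma scal_FA: "c \<in> F \<Longrightarrow> scal c \<in> carrier FA"
  by (auto simp: scal_def zero_word_def intro!: free_algebra_single)

lemma gen_FA: "i \<in> {1..n - 1} \<Longrightarrow> gen i \<in> carrier FA" "i \<in> {1..n - 1} \<Longrightarrow> gen_inv i \<in> carrier FA"
  by (auto simp: gen_def gen_inv_def base_field_consts intro!: free_algebra_single)

lemma one_FA: "1 \<in> carrier FA"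
  using scal_FA[of 1] by (simp add: scal_def base_field_consts)

lemma act_one: "v \<in> carrier V \<Longrightarrow> act 1 v = v"
  using act_scal[of 1 v] by (simp add: scal_def base_field_consts V_restrict)

lemma elem_e_FA: "i \<in> {1..n - 1} \<Longrightarrow> elem_e l r i \<in> carrier FA"
  unfolding elem_e_def
  by (intro free_algebra_mult free_algebra_diff free_algebra_add scal_FA one_FA gen_FA F_intros) auto

lemmas FA_intros = free_algebra_mult free_algebra_diff free_algebra_add scal_FA one_FA gen_FA elem_e_FA

lemma act_elem_e:
  assumes i: "i \<in> {1..n - 1}" and v: "v \<in> carrier V"
  shows "act (elem_e l r i) v = restrict (\<lambda>p. l / m * E i v p) P"
proof (rule V_eqI)
  show "act (elem_e l r i) v \<in> carrier V" "restrict (\<lambda>p. l / m * E i v p) P \<in> carrier V"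
    using assms by (auto simp: restrict_in_V intro!: act_closed elem_e_FA F_intros E_in_F V_values[OF v])
  fix p assume p: "p \<in> P"
  have lm: "l / m \<in> F" by (intro F_intros)
  have mem: "gen i * gen i + scal m * gen i \<in> carrier FA" "gen i * gen i \<in> carrier FA"
     "scal m * gen i \<in> carrier FA" "gen i * gen i + scal m * gen i - 1 \<in> carrier FA"
    using i by (intro FA_intros F_intros; simp)+
  have "act (elem_e l r i) v p = l / m * act (gen i * gen i + scal m * gen i - 1) v p"
    unfolding elem_e_def using mem v p lm
    by (simp add: act_mult scal_FA act_scal act_closed)
  also have "act (gen i * gen i + scal m * gen i - 1) v p = E i v p"
    using mem i v p m_in_F
    by (simp add: act_diff act_add one_FA act_one act_mult gen_FA scal_FA act_scal act_closed)
      (simp add: act_gen restrict_in_V T_in_F V_values E_def)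
  finally show "act (elem_e l r i) v p = restrict (\<lambda>p. l / m * E i v p) P p" using p by simp
qed

text \<open>The kernel of the representation of the free algebra. As a two-sided ideal containing
  the relators it contains the ideal they generate, which is what makes the action on cosets well
  defined.\<close>

definition ann :: "free_alg set" where
  "ann = {a \<in> carrier FA. \<forall>v\<in>carrier V. act a v = \<zero>\<^bsub>V\<^esub>}"

lemma ops_FA:
  "monoid.mult FA = (*)" "add FA = (+)" "one FA = 1" "ring.zero FA = 0"
  by (simp_all add: free_algebra_def ring_of_type_algebra_def fun_eq_iff)

lemma annI: "a \<in> carrier FA \<Longrightarrow> (\<And>v p. v \<in> carrier V \<Longrightarrow> p \<in> P \<Longrightarrow> act a v p = 0) \<Longrightarrow> a \<in> ann"
  unfolding ann_def lk_space_zero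
  by (auto intro!: V_eqI act_closed simp: restrict_in_V F_intros)

lemma annD: "a \<in> ann \<Longrightarrow> v \<in> carrier V \<Longrightarrow> p \<in> P \<Longrightarrow> act a v p = 0"
  unfolding ann_def lk_space_zero by simp

lemma a_inv_FA: "a \<in> carrier FA \<Longrightarrow> \<ominus>\<^bsub>FA\<^esub> a = - a"
proof -
  interpret ring FA by (rule ring_free_algebra)
  assume a: "a \<in> carrier FA"
  show ?thesis
    by (rule minus_equality[symmetric, THEN sym]) (use a in \<open>auto simp: ops_FA free_algebra_uminus\<close>)
qed

lemma ideal_ann: "ideal ann FA"
proof -
  interpret ring FA by (rule ring_free_algebra)
  have zeroV: "\<zero>\<^bsub>V\<^esub> \<in> carrier V"
    by (simp add: lk_space_zero restrict_in_V F_intros)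
  show ?thesis
  proof (rule idealI[OF ring_free_algebra])
    show "subgroup ann (add_monoid FA)"
    proof (rule add.subgroupI)
      show "ann \<subseteq> carrier FA" by (auto simp: ann_def)
      have "0 \<in> ann"
        using zero_closed act_diff[OF one_FA one_FA] by (intro annI) (simp_all add: ops_FA)
      then show "ann \<noteq> {}" by blast
      fix a b assume ab: "a \<in> ann" "b \<in> ann"
      then show "a \<oplus>\<^bsub>FA\<^esub> b \<in> ann"
        by (intro annI) (auto simp: ops_FA act_add ann_def lk_space_zero intro: free_algebra_add)
    next
      fix a assume a: "a \<in> ann"
      then have "- a \<in> ann"
        by (intro annI) (auto simp: act_uminus ann_def lk_space_zero intro: free_algebra_uminus)
      then show "\<ominus>\<^bsub>FA\<^esub> a \<in> ann" using a a_inv_FA by (simp add: ann_def)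
    qed
    fix a x assume a: "a \<in> ann" and x: "x \<in> carrier FA"
    show "x \<otimes>\<^bsub>FA\<^esub> a \<in> ann"
      using a x endo_zero[OF endo_act[OF x]] unfolding ann_def
      by (simp add: ops_FA act_mult lk_space_zero free_algebra_mult)
    show "a \<otimes>\<^bsub>FA\<^esub> x \<in> ann"
      using a x unfolding ann_def
      by (simp add: ops_FA act_mult free_algebra_mult act_closed)
  qed
qed

lemma m_ne: "m \<noteq> 0"
proof
  assume "m = 0"
  then have "1 = r * r" by (simp add: m_eq field_simps)
  moreover have "(r\<^sup>2) ^ 1 \<noteq> 1" using pow_ne n4 by (meson atLeastAtMost_iff le_trans one_le_numeral order_refl)
  ultimately show False by (simp add: power2_eq_square)
qed

lemma E_divide: "E k (\<lambda>p. v p / c) = (\<lambda>p. E k v p / c)"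
  using E_scale[of k "1 / c" v] by simp

lemma relators_ann: "bmw_relators n l r \<subseteq> ann"
proof
  fix a assume a: "a \<in> bmw_relators n l r"
  then have aF: "a \<in> carrier FA" using bmw_relators_subset by blast
  have range: "1 \<le> i" "i < n" if "i \<in> {1..n - 1}" for i using that n4 by auto
  note mems = FA_intros F_intros
  note V_mems = restrict_in_V T_in_F Tinv_in_F E_in_F V_values F_intros
  note acts = act_diff act_mult act_one act_gen act_gen_inv act_scal act_elem_e mems V_mems
  show "a \<in> ann"
  proof (rule annI[OF aF])
    fix v p assume v: "v \<in> carrier V" and p: "p \<in> P"
    \<comment> \<open>The families e_i g_j e_i with j = i + 1 and j = i - 1 are merged. Membership
      of \<open>i - 1\<close> in the range forces i to be at least 2, so the truncated subtraction
      does no harm.\<close>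
    from a consider
      i where "i \<in> {1..n - 1}" "a = gen i * gen_inv i - 1"
    | i where "i \<in> {1..n - 1}" "a = gen_inv i * gen i - 1"
    | i j where "i \<in> {1..n - 1}" "j \<in> {1..n - 1}" "\<bar>int i - int j\<bar> \<ge> 2" "a = gen i * gen j - gen j * gen i"
    | i where "i \<in> {1..n - 1}" "i + 1 \<in> {1..n - 1}"
        "a = gen i * gen (i + 1) * gen i - gen (i + 1) * gen i * gen (i + 1)"
    | i where "i \<in> {1..n - 1}" "a = gen i * elem_e l r i - scal (inverse l) * elem_e l r i"
    | i j where "i \<in> {1..n - 1}" "j \<in> {1..n - 1}" "j = Suc i \<or> i = Suc j"
        "a = elem_e l r i * gen j * elem_e l r i - scal l * elem_e l r i"
      unfolding bmw_relators_def by (elim UnE CollectE) fastforce+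
    then show "act a v p = 0"
    proof cases
      case 1
      then show ?thesis using v p range[of i]
        by (simp add: acts T_Tinv)
    next
      case 2
      then show ?thesis using v p range[of i]
        by (simp add: acts Tinv_restrict Tinv_T)
    next
      case 3
      then show ?thesis using v p range[of i] range[of j]
        by (simp add: acts T_comm[of i j])
    next
      case 4
      then show ?thesis using v p range[of i] range[of "Suc i"]
        by (simp add: acts T_braid[of i])
    next
      case 5
      then show ?thesis using v p range[of i]
        by (simp add: acts; simp add: T_lin T_E E_eq)
    next
      case 6
      then have "E i (T j (E i v)) p = m * E i v p"
        using range[of i] range[of j] p by (intro E_T_E) auto
      then show ?thesis using 6 v p m_ne
        by (simp add: acts T_lin E_restrict E_scale E_divide)
    qed
  qed
qed

text \<open>Two representatives of a coset differ by an element of the generated ideal, which lies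
  in \<open>ann\<close>. The set of values is therefore a singleton and \<open>the_elem\<close>
  returns its element.\<close>

lemma bmw_action_coset:
  assumes a: "a \<in> carrier FA" and v: "v \<in> carrier V"
  shows "bmw_action n l r (genideal FA (bmw_relators n l r) +>\<^bsub>FA\<^esub> a) v = act a v"
proof -
  interpret ring FA by (rule ring_free_algebra)
  let ?I = "genideal FA (bmw_relators n l r)"
  interpret I: ideal ?I FA by (rule genideal_ideal[OF bmw_relators_subset])
  have sub: "?I \<subseteq> ann" by (rule genideal_minimal[OF ideal_ann relators_ann])
  have "act (h + a) v = act a v" if h: "h \<in> ?I" for h
  proof (rule V_eqI)
    have hF: "h \<in> carrier FA" using I.Icarr h by blast
    show "act (h + a) v \<in> carrier V" "act a v \<in> carrier V"
      using hF a v by (auto intro!: act_closed free_algebra_add)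
    show "act (h + a) v p = act a v p" if "p \<in> P" for p
      using act_add[OF hF a v that] annD[of h v p] sub h v that by auto
  qed
  moreover have "?I \<noteq> {}" using I.zero_closed by blast
  moreover have "?I +>\<^bsub>FA\<^esub> a = {h + a | h. h \<in> ?I}" by (auto simp: a_r_coset_def' ops_FA)
  moreover have "(\<lambda>a. act a v) ` {h + a | h. h \<in> ?I} = (\<lambda>h. act (h + a) v) ` ?I" by auto
  ultimately have "(\<lambda>a. act a v) ` (?I +>\<^bsub>FA\<^esub> a) = {act a v}"
    by (simp add: image_constant_conv cong: image_cong)
  then show ?thesis by (simp add: bmw_action_def)
qed

lemma carrier_bmw_algebra:
  "carrier (bmw_algebra n l r) = (\<lambda>a. genideal FA (bmw_relators n l r) +>\<^bsub>FA\<^esub> a) ` carrier FA"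
  by (auto simp: bmw_algebra_def FactRing_def A_RCOSETS_def')

section \<open>Invariance reduced to stability under the generators\<close>

lemma subspaceI:
  assumes "W \<subseteq> carrier V" "\<zero>\<^bsub>V\<^esub> \<in> W" "\<And>u v. u \<in> W \<Longrightarrow> v \<in> W \<Longrightarrow> (\<lambda>p\<in>P. u p + v p) \<in> W"
    "\<And>c v. c \<in> F \<Longrightarrow> v \<in> W \<Longrightarrow> (\<lambda>p\<in>P. c * v p) \<in> W"
  shows "VectorSpace.subspace (base_field l r) W V"
proof -
  interpret V: vectorspace "base_field l r" V by (rule vectorspace_lk_space)
  show ?thesis
    unfolding VectorSpace.subspace_def submodule_def
    using assms V.vectorspace_axioms V.module_axioms by (simp add: lk_space_add lk_space_smult)
qed

lemma subspaceD:
  assumes "VectorSpace.subspace (base_field l r) W V"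
  shows "W \<subseteq> carrier V" "(\<lambda>p\<in>P. 0) \<in> W" "\<And>u v. u \<in> W \<Longrightarrow> v \<in> W \<Longrightarrow> (\<lambda>p\<in>P. u p + v p) \<in> W"
    "\<And>c v. c \<in> F \<Longrightarrow> v \<in> W \<Longrightarrow> (\<lambda>p\<in>P. c * v p) \<in> W"
  using assms unfolding VectorSpace.subspace_def submodule_def
  by (auto simp: lk_space_add lk_space_smult lk_space_zero)

lemma subspace_sum:
  assumes W: "VectorSpace.subspace (base_field l r) W V" and "finite A"
    "\<And>a. a \<in> A \<Longrightarrow> c a \<in> F" "\<And>a. a \<in> A \<Longrightarrow> u a \<in> W"
  shows "(\<lambda>p\<in>P. \<Sum>a\<in>A. c a * u a p) \<in> W"
  using assms(2-)
proof (induction A rule: finite_induct)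
  case empty
  show ?case using subspaceD(2)[OF W] by (simp only: sum.empty)
next
  case (insert x A)
  have "(\<lambda>p\<in>P. \<Sum>a\<in>insert x A. c a * u a p)
      = (\<lambda>p\<in>P. (\<lambda>p\<in>P. c x * u x p) p + (\<lambda>p\<in>P. \<Sum>a\<in>A. c a * u a p) p)"
    using insert.hyps by (intro restrict_ext) simp
  also have "\<dots> \<in> W"
    using insert by (intro subspaceD(3,4)[OF W]) auto
  finally show ?case .
qed

text \<open>Stability under the inverse generators is automatic, because \<open>Tinv k\<close> is a
  quadratic polynomial in \<open>T k\<close>.\<close>

lemma invariant_subspace_iff:
  "invariant_subspace n l r W \<longleftrightarrow>
     VectorSpace.subspace (base_field l r) W V \<and> (\<forall>k\<in>{1..n - 1}. \<forall>v\<in>W. restrict (T k v) P \<in> W)"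
proof
  assume W: "invariant_subspace n l r W"
  then have sub: "VectorSpace.subspace (base_field l r) W V" by (simp add: invariant_subspace_def)
  moreover have "restrict (T k v) P \<in> W" if "k \<in> {1..n - 1}" "v \<in> W" for k v
  proof -
    have v: "v \<in> carrier V" using subspaceD(1)[OF sub] that by blast
    have "bmw_action n l r (genideal FA (bmw_relators n l r) +>\<^bsub>FA\<^esub> gen k) v \<in> W"
      using W that gen_FA(1)[of k] unfolding invariant_subspace_def carrier_bmw_algebra by blast
    then show ?thesis
      using that v by (simp add: bmw_action_coset gen_FA act_gen)
  qed
  ultimately show "VectorSpace.subspace (base_field l r) W V \<and>
    (\<forall>k\<in>{1..n - 1}. \<forall>v\<in>W. restrict (T k v) P \<in> W)" by blast
next
  assume "VectorSpace.subspace (base_field l r) W V \<and>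
    (\<forall>k\<in>{1..n - 1}. \<forall>v\<in>W. restrict (T k v) P \<in> W)"
  then have sub: "VectorSpace.subspace (base_field l r) W V"
    and inv: "\<And>k v. k \<in> {1..n - 1} \<Longrightarrow> v \<in> W \<Longrightarrow> restrict (T k v) P \<in> W" by auto
  note D = subspaceD[OF sub]
  have WV: "v \<in> carrier V" if "v \<in> W" for v using D(1) that by blast
  have E: "restrict (Tinv k v) P \<in> W" if k: "k \<in> {1..n - 1}" and v: "v \<in> W" for k v
  proof -
    \<comment> \<open>With T for \<open>T k\<close>, the inverse expands as (1 - l m) T + (m + l) -
      l T^2.\<close>
    let ?u = "\<lambda>i::nat. if i = 0 then restrict (T k v) P else if i = 1 then v
      else restrict (T k (restrict (T k v) P)) P"
    let ?c = "\<lambda>i::nat. if i = 0 then 1 - l * m else if i = 1 then m + l else - l"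
    have "(\<lambda>p\<in>P. \<Sum>i\<in>{0,1,2}. ?c i * ?u i p) \<in> W"
      using v inv[OF k v] inv[OF k inv[OF k v]]
      by (intro subspace_sum[OF sub]) (auto intro!: F_intros)
    also have "(\<lambda>p\<in>P. \<Sum>i\<in>{0,1,2}. ?c i * ?u i p) = restrict (Tinv k v) P"
      by (intro restrict_ext) (simp add: Tinv_def E_def algebra_simps)
    finally show ?thesis .
  qed
  have letter: "letter_action n l r x v \<in> W" if "x \<in> gens" "v \<in> W" for x v
  proof (cases x)
    case (Gen k)
    then show ?thesis using that inv[of k v] WV nu_eq by (auto simp: gens_def)
  next
    case (GenInv k)
    then have "1 \<le> k" "k < n" using that n4 by (auto simp: gens_def)
    with GenInv show ?thesis using that E[of k v] WV[of v] by (auto simp: inv_nu_eq)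
  qed
  have word: "foldr (letter_action n l r) xs v \<in> W" if "set xs \<subseteq> gens" "v \<in> W" for xs v
    using that by (induction xs) (auto intro: letter)
  have "act a v \<in> W" if a: "a \<in> carrier FA" and v: "v \<in> W" for a v
    unfolding act_eq[OF a WV[OF v]]
    by (rule subspace_sum[OF sub]) (use FA_D[OF a] word v in auto)
  then show "invariant_subspace n l r W"
    unfolding invariant_subspace_def carrier_bmw_algebra
    using sub WV by (auto simp: bmw_action_coset)
qed

end

section \<open>Dimensions of subspaces\<close>

text \<open>Independent subsets of W stay independent in V, so their size is bounded by
  \<open>dim\<close>. A maximal one exists, is finite, and generates W.\<close>

lemma (in vectorspace) subspace_fin_dim:
  assumes fd: "fin_dim" and W: "VectorSpace.subspace K W V"
  shows "vectorspace.fin_dim K (vs W)"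
proof -
  have sub: "submodule K W V" using W by simp
  interpret W: vectorspace K "vs W" by (rule subspace_is_vs[OF W])
  have WV: "W \<subseteq> carrier V" using sub by (simp add: submodule_def)
  have "finite A \<and> card A \<le> dim" if "A \<subseteq> W \<and> W.lin_indpt A" for A
    using that WV span_li_not_depend(2)[OF _ sub, of A] li_le_dim[OF fd, of A] by auto
  from maximal_exists[of "\<lambda>A. A \<subseteq> W \<and> W.lin_indpt A", OF this, of "{}"]
  obtain A where A: "finite A" "maximal A (\<lambda>A. A \<subseteq> carrier (vs W) \<and> W.lin_indpt A)"
    by (auto simp: W.lin_dep_def)
  moreover have "W.gen_set A" by (rule W.max_li_is_gen[OF A(2)])
  ultimately show ?thesis unfolding W.fin_dim_def maximal_def by blast
qed

context lk_rep begin

lemma lincomb_eq: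
  assumes "finite A" "A \<subseteq> carrier V" "a \<in> A \<rightarrow> F"
  shows "module.lincomb V a A = (\<lambda>p\<in>P. \<Sum>v\<in>A. a v * v p)"
proof -
  interpret V: vectorspace "base_field l r" V by (rule vectorspace_lk_space)
  have "V.lincomb a A = (\<lambda>p\<in>P. \<Sum>v\<in>A. (a v \<odot>\<^bsub>V\<^esub> v) p)"
    unfolding V.lincomb_def using assms by (intro lk_finsum V.smult_closed) auto
  also have "\<dots> = (\<lambda>p\<in>P. \<Sum>v\<in>A. a v * v p)"
    by (intro restrict_ext) (simp add: lk_space_smult)
  finally show ?thesis .
qed

lemma subspace_in_span:
  assumes W: "VectorSpace.subspace (base_field l r) W V" and I: "finite I" "\<And>i. i \<in> I \<Longrightarrow> u i \<in> W"
    and gen: "\<And>w. w \<in> W \<Longrightarrow> \<exists>c. (\<forall>i\<in>I. c i \<in> F) \<and> (\<forall>p\<in>P. w p = (\<Sum>i\<in>I. c i * u i p))"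
  shows "module.span (base_field l r) (V\<lparr>carrier := W\<rparr>) (u ` I) = W"
proof -
  interpret V: vectorspace "base_field l r" V by (rule vectorspace_lk_space)
  interpret W: vectorspace "base_field l r" "V.vs W" by (rule V.subspace_is_vs[OF W])
  have sub: "submodule (base_field l r) W V" using W by simp
  have uW: "u ` I \<subseteq> W" using I by auto
  have WV: "W \<subseteq> carrier V" using subspaceD(1)[OF W] .
  have eq: "W.span (u ` I) = V.span (u ` I)" by (rule V.span_li_not_depend[OF uW sub])
  have span: "VectorSpace.subspace (base_field l r) (V.span (u ` I)) V"
    by (rule V.span_is_subspace) (use uW WV in blast)
  have "w \<in> V.span (u ` I)" if w: "w \<in> W" for w
  proof -
    from gen[OF w] obtain c where c: "\<forall>i\<in>I. c i \<in> F" "\<forall>p\<in>P. w p = (\<Sum>i\<in>I. c i * u i p)" by blast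
    have "(\<lambda>p\<in>P. \<Sum>i\<in>I. c i * u i p) \<in> V.span (u ` I)"
    proof (rule subspace_sum[OF span I(1)])
      have "u ` I \<subseteq> V.span (u ` I)" by (rule V.in_own_span) (use uW WV in blast)
      then show "u i \<in> V.span (u ` I)" if "i \<in> I" for i using that by blast
    qed (use c in auto)
    moreover have "w = (\<lambda>p\<in>P. \<Sum>i\<in>I. c i * u i p)"
      using V_restrict[of w] w WV c(2) by (metis (no_types, lifting) restrict_ext subsetD)
    ultimately show ?thesis by simp
  qed
  moreover have "V.span (u ` I) \<subseteq> W" by (rule V.span_is_subset[OF uW sub])
  ultimately show ?thesis using eq by blast
qed

lemma subspace_dim_le:
  assumes W: "VectorSpace.subspace (base_field l r) W V" and I: "finite I" "\<And>i. i \<in> I \<Longrightarrow> u i \<in> W"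
    and gen: "\<And>w. w \<in> W \<Longrightarrow> \<exists>c. (\<forall>i\<in>I. c i \<in> F) \<and> (\<forall>p\<in>P. w p = (\<Sum>i\<in>I. c i * u i p))"
  shows "subspace_dim n l r W \<le> card I"
proof -
  interpret V: vectorspace "base_field l r" V by (rule vectorspace_lk_space)
  interpret W: vectorspace "base_field l r" "V.vs W" by (rule V.subspace_is_vs[OF W])
  have "W.dim \<le> card (u ` I)"
    using I subspace_in_span[OF assms] by (intro W.gen_ge_dim) auto
  then show ?thesis
    using card_image_le[OF I(1), of u] by (simp add: subspace_dim_def)
qed

lemma fin_dim_V: "vectorspace.fin_dim (base_field l r) V"
proof -
  interpret V: vectorspace "base_field l r" V by (rule vectorspace_lk_space)
  have V: "VectorSpace.subspace (base_field l r) (carrier V) V"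
    by (rule subspaceI) (auto simp: lk_space_zero restrict_in_V F_intros V_values)
  let ?u = "\<lambda>q. restrict (wv (fst q) (snd q)) P"
  have u: "?u q \<in> carrier V" for q by (simp add: restrict_in_V wv_in_F)
  have "module.span (base_field l r) (V\<lparr>carrier := carrier V\<rparr>) (?u ` P) = carrier V"
  proof (rule subspace_in_span[OF V finite_index_pairs u])
    fix w assume w: "w \<in> carrier V"
    have "w p = (\<Sum>q\<in>P. w q * ?u q p)" if "p \<in> P" for p
      using wv_expand[OF that, of w] that by simp
    then show "\<exists>c. (\<forall>q\<in>P. c q \<in> F) \<and> (\<forall>p\<in>P. w p = (\<Sum>q\<in>P. c q * ?u q p))"
      using V_values[OF w] by blast
  qed
  then have "V.span (?u ` P) = carrier V" by simp
  then show ?thesis unfolding V.fin_dim_def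
    using u finite_index_pairs by (intro exI[of _ "?u ` P"]) blast
qed

lemma subspace_dim_ge:
  assumes W: "VectorSpace.subspace (base_field l r) W V" and I: "finite I" "\<And>i. i \<in> I \<Longrightarrow> u i \<in> W"
    and indep: "\<And>c i. (\<And>i. i \<in> I \<Longrightarrow> c i \<in> F) \<Longrightarrow> (\<And>p. p \<in> P \<Longrightarrow> (\<Sum>i\<in>I. c i * u i p) = 0)
      \<Longrightarrow> i \<in> I \<Longrightarrow> c i = 0"
  shows "card I \<le> subspace_dim n l r W"
proof -
  interpret V: vectorspace "base_field l r" V by (rule vectorspace_lk_space)
  interpret W: vectorspace "base_field l r" "V.vs W" by (rule V.subspace_is_vs[OF W])
  have sub: "submodule (base_field l r) W V" using W by simp
  have uW: "u ` I \<subseteq> W" using I by auto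
  have WV: "W \<subseteq> carrier V" using subspaceD(1)[OF W] .
  have inj: "inj_on u I"
  proof (rule inj_onI, rule ccontr)
    fix i j assume ij: "i \<in> I" "j \<in> I" "u i = u j" "i \<noteq> j"
    \<comment> \<open>If two members of the family coincided, the difference of their indicators
      would be a nontrivial relation. So \<open>u\<close> is injective and its image has full
      cardinality.\<close>
    define c where "c = (\<lambda>k. (if k = i then 1 else 0) - (if k = j then 1 else 0 :: complex))"
    have "(\<Sum>k\<in>I. c k * u k p) = (\<Sum>k\<in>I. if k = i then u k p else 0) - (\<Sum>k\<in>I. if k = j then u k p else 0)" for p
      unfolding sum_subtractf[symmetric] by (intro sum.cong) (auto simp: c_def)
    then have c_sum: "(\<Sum>k\<in>I. c k * u k p) = 0" for p
      unfolding sum.delta[OF I(1)] by (simp only: ij if_True diff_self)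
    have "c k \<in> F" for k by (simp add: c_def F_intros)
    then have "c i = 0" by (rule indep[OF _ c_sum ij(1)])
    then show False using ij(4) by (simp add: c_def)
  qed
  have fin: "finite (u ` I)" using I(1) by simp
  have AV: "u ` I \<subseteq> carrier V" using uW WV by (rule subset_trans)
  have "V.lin_indpt (u ` I)"
  proof (rule V.finite_lin_indpt2[OF fin AV])
    fix a assume a: "a \<in> u ` I \<rightarrow> F" "V.lincomb a (u ` I) = \<zero>\<^bsub>V\<^esub>"
    have "(\<Sum>i\<in>I. a (u i) * u i p) = 0" if p: "p \<in> P" for p
    proof -
      have "(\<Sum>v\<in>u ` I. a v * v p) = (\<lambda>p\<in>P. \<Sum>v\<in>u ` I. a v * v p) p" using p by simp
      also have "\<dots> = V.lincomb a (u ` I) p"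
        by (simp only: lincomb_eq[OF fin AV a(1)])
      also have "\<dots> = 0" using p by (simp add: a(2) lk_space_zero)
      finally show ?thesis by (simp add: sum.reindex[OF inj])
    qed
    then have "a (u i) = 0" if "i \<in> I" for i
      using a(1) by (intro indep[OF _ _ that, of "\<lambda>i. a (u i)"]) (simp_all add: Pi_iff)
    then show "\<forall>v\<in>u ` I. a v = \<zero>\<^bsub>base_field l r\<^esub>" unfolding base_field_simps by blast
  qed
  then have li: "W.lin_indpt (u ` I)" unfolding V.span_li_not_depend(2)[OF uW sub] .
  have "card (u ` I) \<le> W.dim"
    by (rule W.li_le_dim(2)[OF V.subspace_fin_dim[OF fin_dim_V W] _ li]) (simp add: uW)
  then show ?thesis by (simp add: card_image[OF inj] subspace_dim_def)
qed

section \<open>Invariant subspaces\<close>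

lemma coord_wv:
  assumes "(i, j) \<in> P" "\<And>q. q \<in> P \<Longrightarrow> img k q p = c * (if q = (i, j) then 1 else 0)"
  shows "T k v p = c * v (i, j)"
proof -
  have "T k v p = (\<Sum>q\<in>P. if q = (i, j) then c * v (i, j) else 0)"
    unfolding T_def by (intro sum.cong) (auto simp: assms(2))
  then show ?thesis using assms(1) by simp
qed

lemma T_coord_disjoint:
  assumes "(i, j) \<in> P" "{i, j} \<inter> {k, Suc k} = {}"
  shows "T k v (i, j) = r * v (i, j)"
  using assms by (intro coord_wv) (auto simp: img_def wv_def split: if_splits)

lemma T_coord_left:
  assumes "1 \<le> k" "Suc k < j" "j \<le> n"
  shows "T k v (k, j) = v (Suc k, j)"
  using assms coord_wv[of "Suc k" j k "(k, j)" 1 v]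
  by (auto simp: img_def wv_def index_pairs_def split: if_splits)

lemma T_coord_right:
  assumes "1 \<le> i" "i < k" "k < n"
  shows "T k v (i, k) = v (i, Suc k)"
  using assms coord_wv[of i "Suc k" k "(i, k)" 1 v]
  by (auto simp: img_def wv_def index_pairs_def split: if_splits)

lemma T_coord_diff:
  assumes "(i, j) \<in> P" "(i', j') \<in> P" "(i, j) \<noteq> (i', j')"
    "\<And>q. q \<in> P \<Longrightarrow> img k q p = (if q = (i, j) then 1 else 0) - m * (if q = (i', j') then 1 else 0)"
  shows "T k v p = v (i, j) - m * v (i', j')"
proof -
  have "T k v p = (\<Sum>q\<in>P. (if q = (i, j) then v (i, j) else 0) - (if q = (i', j') then m * v (i', j') else 0))"
    unfolding T_def using assms(3) by (intro sum.cong) (auto simp: assms(4))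
  then show ?thesis using assms(1,2) by (simp add: sum_subtractf)
qed

lemma T_coord_left_Suc:
  assumes "1 \<le> k" "Suc k < j" "j \<le> n"
  shows "T k v (Suc k, j) = v (k, j) - m * v (Suc k, j)"
  using assms by (intro T_coord_diff) (auto simp: img_def wv_def index_pairs_def split: if_splits)

lemma T_coord_right_Suc:
  assumes "1 \<le> i" "i < k" "k < n"
  shows "T k v (i, Suc k) = v (i, k) - m * v (i, Suc k)"
  using assms by (intro T_coord_diff) (auto simp: img_def wv_def index_pairs_def split: if_splits)

text \<open>Where \<open>E k\<close> vanishes, \<open>T k\<close> has eigenvalues \<open>r\<close> and \<open>- 1 / r\<close>, and \<open>D k\<close> is a multiple of the
  projection to the second eigenspace.\<close>

definition D :: "nat \<Rightarrow> lk_vector \<Rightarrow> lk_vector" where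
  "D k v = (\<lambda>p. T k v p - r * v p)"

lemma D_lin:
  "D k (\<lambda>p. u p + v p) = (\<lambda>p. D k u p + D k v p)"
  "D k (\<lambda>p. u p - v p) = (\<lambda>p. D k u p - D k v p)"
  "D k (\<lambda>p. c * v p) = (\<lambda>p. c * D k v p)"
  by (simp_all add: D_def T_lin algebra_simps)

lemma D_cong: "(\<And>p. p \<in> P \<Longrightarrow> u p = v p) \<Longrightarrow> p \<in> P \<Longrightarrow> D k u p = D k v p"
  using T_cong[of u v k] by (simp add: D_def)

lemma D_sum: "D k (\<lambda>p. \<Sum>q\<in>Q. c q * f q p) = (\<lambda>p. \<Sum>q\<in>Q. c q * D k (f q) p)"
  by (simp add: D_def T_sum algebra_simps sum_subtractf sum_distrib_left)

text \<open>The analogue of the Garnir relation of the two-row Specht modules: \<open>garnir i j\<close> spans the image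
  of \<open>D i \<circ> D j\<close> for \<open>i + 2 \<le> j\<close>.\<close>

definition garnir :: "nat \<Rightarrow> nat \<Rightarrow> lk_vector" where
  "garnir i j = (\<lambda>p. wv (Suc i) (Suc j) p - r * wv i (Suc j) p - r * wv (Suc i) j p + r\<^sup>2 * wv i j p)"

text \<open>Only pairs with one index in {1, 2} and the other in {3, 4} survive: on the rest
  \<open>D 3\<close> gives 0 or a vector killed by \<open>D 1\<close>. The factors are 1, -1/r, -1/r
  and 1/r^2 for w_13, w_14, w_23 and w_24. They lie in \<open>F\<close>, as membership in a subspace
  requires.\<close>

lemma D1_D3_wv:
  assumes "1 \<le> i" "i < j" "j \<le> n"
  obtains c where "c \<in> F" "\<And>p. D 1 (D 3 (wv i j)) p = c * garnir 1 3 p"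
proof -
  have n: "3 < n" "1 < n" using n4 by auto
  note rules = D_def T_lin T_wv img_def garnir_def eval_nat_numeral
  consider "4 < i" | "i = 4" | "i = 3" "j = 4" | "i = 3" "4 < j" | "i = 1" "j = 2" | "i = 1" "j = 3"
    | "i = 1" "j = 4" | "i = 1" "4 < j" | "i = 2" "j = 3" | "i = 2" "j = 4" | "i = 2" "4 < j"
    using assms by atomize_elim presburger
  then show thesis
  proof cases
    case 1
    then show thesis using assms n4 by (intro that[of 0], simp add: F_intros, simp add: rules)
  next
    case 2
    then show thesis using assms n4 by (intro that[of 0], simp add: F_intros, (simp add: rules; simp add: algebra_simps))
  next
    case 3
    then show thesis using assms n4 by (intro that[of 0], simp add: F_intros, (simp add: rules; simp add: algebra_simps))
  next
    case 4
    then show thesis using assms n4 by (intro that[of 0], simp add: F_intros, (simp add: rules; simp add: algebra_simps))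
  next
    case 5
    then show thesis using assms n4 by (intro that[of 0], simp add: F_intros, (simp add: rules; simp add: algebra_simps))
  next
    case 6
    then show thesis using assms n4 by (intro that[of 1], simp add: F_intros, (simp add: rules; simp add: algebra_simps))
  next
    case 7
    then show thesis using assms n4 by (intro that[of "- (1 / r)"], simp add: F_intros, (simp add: rules; simp add: m_eq field_simps))
  next
    case 8
    then show thesis using assms n4 by (intro that[of 0], simp add: F_intros, (simp add: rules; simp add: algebra_simps))
  next
    case 9
    then show thesis using assms n4 by (intro that[of "- (1 / r)"], simp add: F_intros, (simp add: rules; simp add: m_eq field_simps))
  next
    case 10
    then show thesis using assms n4 by (intro that[of "1 / r\<^sup>2"], simp add: F_intros, (simp add: rules; simp add: m_eq field_simps))
  next
    case 11
    then show thesis using assms n4 by (intro that[of 0], simp add: F_intros, (simp add: rules; simp add: m_eq field_simps))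
  qed
qed

lemma D1_D3_eq:
  assumes v: "\<And>p. p \<in> P \<Longrightarrow> v p \<in> F"
  obtains c where "c \<in> F" "\<And>p. p \<in> P \<Longrightarrow> D 1 (D 3 v) p = c * garnir 1 3 p"
proof -
  have "\<exists>c. \<forall>q\<in>P. c q \<in> F \<and> (\<forall>p. D 1 (D 3 (wv (fst q) (snd q))) p = c q * garnir 1 3 p)"
    by (rule bchoice) (auto simp: index_pairs_def elim!: D1_D3_wv simp del: One_nat_def)
  then obtain c where c: "\<And>q. q \<in> P \<Longrightarrow> c q \<in> F"
    "\<And>q p. q \<in> P \<Longrightarrow> D 1 (D 3 (wv (fst q) (snd q))) p = c q * garnir 1 3 p" by blast
  show thesis
  proof (rule that[of "\<Sum>q\<in>P. v q * c q"])
    show "(\<Sum>q\<in>P. v q * c q) \<in> F" by (intro F_intros v c)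
    fix p assume p: "p \<in> P"
    have "D 1 (D 3 v) p = D 1 (D 3 (\<lambda>p. \<Sum>q\<in>P. v q * wv (fst q) (snd q) p)) p"
      by (intro D_cong p wv_expand)
    also have "\<dots> = (\<Sum>q\<in>P. v q * c q) * garnir 1 3 p"
      by (simp add: D_sum c sum_distrib_right mult.assoc del: One_nat_def)
    finally show "D 1 (D 3 v) p = (\<Sum>q\<in>P. v q * c q) * garnir 1 3 p" .
  qed
qed

end

section \<open>Membership in an invariant subspace\<close>

locale lk_inv = lk_rep +
  fixes W
  assumes inv: "invariant_subspace n l r W"
begin

text \<open>Lets membership in \<open>W\<close> be asserted of total functions, of which only the
  values on \<open>P\<close> count.\<close>

definition M :: "lk_vector \<Rightarrow> bool" where "M v \<longleftrightarrow> restrict v P \<in> W"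

lemma W_sub: "VectorSpace.subspace (base_field l r) W V"
  using inv unfolding invariant_subspace_iff by blast

lemma W_V: "w \<in> W \<Longrightarrow> w \<in> carrier V"
  using subspaceD(1)[OF W_sub] by blast

lemma M_W: "w \<in> W \<Longrightarrow> M w"
  using V_restrict[OF W_V] by (simp only: M_def)

lemma M_F: "M v \<Longrightarrow> p \<in> P \<Longrightarrow> v p \<in> F"
  using W_V[of "restrict v P"] by (simp add: restrict_in_V M_def)

lemma M_cong: "M u \<Longrightarrow> (\<And>p. p \<in> P \<Longrightarrow> v p = u p) \<Longrightarrow> M v"
  unfolding M_def by (metis (no_types, lifting) restrict_ext)

lemma M_zero: "M (\<lambda>p. 0)"
  using subspaceD(2)[OF W_sub] unfolding M_def .

lemma M_add: "M u \<Longrightarrow> M v \<Longrightarrow> M (\<lambda>p. u p + v p)"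
  unfolding M_def using subspaceD(3)[OF W_sub, of "restrict u P" "restrict v P"]
  by (rule back_subst[of "\<lambda>x. x \<in> W"]) auto

lemma M_scale: "c \<in> F \<Longrightarrow> M v \<Longrightarrow> M (\<lambda>p. c * v p)"
  unfolding M_def using subspaceD(4)[OF W_sub, of c "restrict v P"]
  by (rule back_subst[of "\<lambda>x. x \<in> W"]) auto

lemma M_diff: "M u \<Longrightarrow> M v \<Longrightarrow> M (\<lambda>p. u p - v p)"
  using M_add[OF _ M_scale[of "-1" v], of u] by (simp add: F_intros)

lemma M_sum: "finite A \<Longrightarrow> (\<And>a. a \<in> A \<Longrightarrow> c a \<in> F) \<Longrightarrow> (\<And>a. a \<in> A \<Longrightarrow> M (u a))
    \<Longrightarrow> M (\<lambda>p. \<Sum>a\<in>A. c a * u a p)"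
  by (induction A rule: finite_induct) (simp_all add: M_zero M_add M_scale)

lemma M_T: "1 \<le> k \<Longrightarrow> k < n \<Longrightarrow> M v \<Longrightarrow> M (T k v)"
  using inv T_restrict[of k v] unfolding invariant_subspace_iff M_def by fastforce

lemma M_E: "1 \<le> k \<Longrightarrow> k < n \<Longrightarrow> M v \<Longrightarrow> M (E k v)"
  unfolding E_def by (intro M_diff M_add M_scale M_T m_in_F)

lemma M_D: "1 \<le> k \<Longrightarrow> k < n \<Longrightarrow> M v \<Longrightarrow> M (D k v)"
  unfolding D_def by (intro M_diff M_scale M_T F_intros)

lemma M_Tinv: "1 \<le> k \<Longrightarrow> k < n \<Longrightarrow> M v \<Longrightarrow> M (Tinv k v)"
  unfolding Tinv_def by (intro M_diff M_add M_scale M_T M_E F_intros)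

lemma M_T_rev: "1 \<le> k \<Longrightarrow> k < n \<Longrightarrow> M (T k u) \<Longrightarrow> M u"
  by (rule M_cong[OF M_Tinv[of k "T k u"]]) (simp_all add: Tinv_T)

lemma M_scale_rev: "c \<in> F \<Longrightarrow> c \<noteq> 0 \<Longrightarrow> M (\<lambda>p. c * v p) \<Longrightarrow> M v"
  by (rule M_cong[OF M_scale[of "inverse c"]]) (auto simp: F_intros)

text \<open>One has w_{k+1,k+2} = T_k T_{k+1} w_{k,k+1}, and \<open>W\<close> is stable under the
  inverses, so the induction can descend.\<close>

lemma M_wv_down:
  assumes "M (wv k (Suc k))" "1 \<le> k" "k < n"
  shows "M (wv 1 2)"
  using assms
proof (induction k)
  case (Suc k)
  show ?case
  proof (cases "k = 0")
    case True
    then show ?thesis using Suc by (simp add: eval_nat_numeral)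
  next
    case False
    note step = Suc False
  have "T k (wv k (Suc (Suc k))) = wv (Suc k) (Suc (Suc k))"
    using step by (simp add: T_wv img_def)
  then have "M (wv k (Suc (Suc k)))"
    using step M_T_rev[of k "wv k (Suc (Suc k))"] by simp
  moreover have "T (Suc k) (wv k (Suc k)) = wv k (Suc (Suc k))"
    using step by (simp add: T_wv img_def)
  ultimately have "M (wv k (Suc k))"
    using step M_T_rev[of "Suc k" "wv k (Suc k)"] by simp
  then show ?thesis using step by simp
  qed
qed simp

text \<open>\<open>T j\<close> carries w_{1,j} to w_{1,j+1}, and then \<open>T i\<close> carries
  w_{i,j} to w_{i+1,j}, which reaches every basis vector without correction terms.\<close>

lemma M_wv_all:
  assumes "M (wv 1 2)"
  shows "W = carrier V"
proof -
  have 1: "M (wv 1 j)" if "2 \<le> j" "j \<le> n" for j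
    using that
  proof (induction j rule: nat_induct_at_least)
    case (Suc j)
    then have "T j (wv 1 j) = wv 1 (Suc j)" by (simp add: T_wv img_def)
    then show ?case using M_T[of j "wv 1 j"] Suc by simp
  qed (use assms in simp)
  have 2: "M (wv i j)" if "1 \<le> i" "i < j" "j \<le> n" for i j
    using that
  proof (induction i rule: nat_induct_at_least)
    case base
    then show ?case using 1[of j] by simp
  next
    case (Suc i)
    then have "T i (wv i j) = wv (Suc i) j" by (simp add: T_wv img_def)
    then show ?case using M_T[of i "wv i j"] Suc by simp
  qed
  have "v \<in> W" if v: "v \<in> carrier V" for v
  proof -
    have "M (\<lambda>p. \<Sum>q\<in>P. v q * wv (fst q) (snd q) p)"
      by (rule M_sum[OF finite_index_pairs V_values[OF v]]) (auto simp: index_pairs_def intro!: 2)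
    then have "M v" by (rule M_cong) (rule wv_expand)
    then show ?thesis by (simp only: M_def V_restrict[OF v])
  qed
  then show ?thesis using W_V by blast
qed

text \<open>Since \<open>E k v\<close> is \<open>e_coeff k v\<close> times w_{k,k+1}, a nonzero
  coefficient would put w_{k,k+1}, and hence the whole space, into \<open>W\<close>.\<close>

lemma e_coeff_zero:
  assumes proper: "W \<noteq> carrier V" and k: "1 \<le> k" "k < n" and v: "M v"
  shows "e_coeff k v = 0"
proof (rule ccontr)
  assume ne: "e_coeff k v \<noteq> 0"
  have pF: "e_coeff k v \<in> F"
    using M_F[OF M_E[OF k v], of "(k, Suc k)"] k
    by (simp add: E_eq index_pairs_def wv_def)
  have "M (\<lambda>p. e_coeff k v * wv k (Suc k) p)"
    by (rule M_cong[OF M_E[OF k v]]) (simp add: E_eq[OF k])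
  then have "M (wv k (Suc k))" by (rule M_scale_rev[OF pF ne])
  then show False using M_wv_down M_wv_all proper k by blast
qed

lemma garnir_or_D1_D3_zero:
  assumes "\<not> M (garnir 1 3)" "M v" "p \<in> P"
  shows "D 1 (D 3 v) p = 0"
proof (rule ccontr)
  assume ne: "D 1 (D 3 v) p \<noteq> 0"
  obtain c where c: "c \<in> F" "\<And>p. p \<in> P \<Longrightarrow> D 1 (D 3 v) p = c * garnir 1 3 p"
    using D1_D3_eq[of v] M_F[OF assms(2)] by blast
  have "M (D 1 (D 3 v))" using n4 by (intro M_D assms) auto
  then have "M (\<lambda>p. c * garnir 1 3 p)" by (rule M_cong) (rule c(2)[symmetric])
  moreover have "c \<noteq> 0" using ne c assms by auto
  ultimately show False using assms(1) M_scale_rev c(1) by blast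
qed

end

section \<open>Invariant subspaces of dimension n(n-3)/2\<close>

text \<open>Here s and t stand for 1/r and 1/l, which leaves a polynomial identity. The letters A,
  B, C, G, H, K are the values at one point of w_34, w_24, w_14, w_13, w_12, w_23.\<close>

lemma D_T2_garnir_polynomial:
  fixes r s t m A B C G H K :: complex
  assumes "r * s = 1" "t = - (s ^ 3)" "m = s - r"
  shows "r * A - r * (r * B) - r * (G + m * H - m * K) * t
      + r * r * (H * t + m * (G + m * H - m * K) * t - m * K)
      - r * (A - r * (r * C) - r * K * t + r * r * (H + m * K * t - m * G))
    = - (r * r * (B - r * C - r * K + r * r * G)) - (s + r) * (K - r * G + r * r * H)"
  using assms by Groebner_Basis.algebra
lemma D_T2_garnir_identity:
  fixes r l m A B C G H K :: complex
  assumes "r \<noteq> 0" "l = - (r ^ 3)" "m = 1 / r - r"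
  shows "r * A - r * (r * B) - r * (G + m * H - m * K) / l
      + r * r * (H / l + m * (G + m * H - m * K) / l - m * K)
      - r * (A - r * (r * C) - r * K / l + r * r * (H + m * K / l - m * G))
    = - (r * r * (B - r * C - r * K + r * r * G)) - (1 / r + r) * (K - r * G + r * r * H)"
proof -
  have "r * (1/r) = 1" "1 / l = - ((1 / r) ^ 3)"
    using assms(1) by (simp_all add: assms(2) power_one_over)
  from D_T2_garnir_polynomial[OF this assms(3), of A B G H K C] show ?thesis by (simp only: divide_inverse mult_1_left mult.assoc)
qed

section \<open>The Garnir vector and conjugation of the operators \<open>D k\<close>\<close>

context lk_rep begin

lemma r_pow_ne: "1 \<le> k \<Longrightarrow> k \<le> n \<Longrightarrow> r ^ (2 * k) \<noteq> 1"
  using pow_ne by (simp add: power_mult)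

text \<open>Squaring reduces the last two claims to (r^2)^k = 1 with k = 2 and k = 4, both excluded
  because n is at least 4.\<close>

lemma r2_ne: "r\<^sup>2 \<noteq> 1" "r\<^sup>2 \<noteq> -1" "r ^ 4 \<noteq> -1"
proof -
  show "r\<^sup>2 \<noteq> 1" using r_pow_ne[of 1] n4 by simp
  show "r\<^sup>2 \<noteq> -1"
  proof
    assume "r\<^sup>2 = -1"
    then have "(r\<^sup>2)\<^sup>2 = 1" by simp
    then show False using r_pow_ne[of 2] n4 by simp
  qed
  show "r ^ 4 \<noteq> -1"
  proof
    assume "r ^ 4 = -1"
    then have "(r ^ 4)\<^sup>2 = 1" by simp
    then show False using r_pow_ne[of 4] n4 by simp
  qed
qed

text \<open>By \<open>e_coeff_zero\<close> this number must vanish if a proper invariant subspace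
  contains the Garnir vector, which leaves the two values of l.\<close>

lemma e_coeff_garnir: "e_coeff 2 (garnir 1 3) = (l - r) * (l + r ^ 3) / (l\<^sup>2 * r)"
  using n4 by (simp add: garnir_def e_coeff_lin e_coeff_wv e_coeff_basis_def eval_nat_numeral)
    (simp add: m_eq field_simps)

text \<open>For this l the Garnir vector thus generates w_23 - r w_13 + r^2 w_12, whose only term
  without the index 1 is w_23.\<close>

lemma D_T2_garnir:
  assumes "l = - (r ^ 3)"
  shows "D 1 (T 2 (garnir 1 3)) p =
    - r\<^sup>2 * garnir 1 3 p - (1 / r + r) * (wv 2 3 p - r * wv 1 3 p + r\<^sup>2 * wv 1 2 p)"
  using n4
  by (simp add: D_def garnir_def T_lin T_wv img_def eval_nat_numeral)
    (rule D_T2_garnir_identity[OF r0 assms m_eq])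

lemma D_comm:
  assumes "1 \<le> a" "a < n" "1 \<le> b" "b < n" "\<bar>int a - int b\<bar> \<ge> 2"
  shows "D a (D b v) p = D b (D a v) p"
  using T_comm[OF assms, of v p] by (simp add: D_def T_lin algebra_simps)

text \<open>By the braid relation, conjugation by T_k T_{k+1} turns T_k into T_{k+1}, hence
  \<open>D k\<close> into \<open>D (Suc k)\<close>.\<close>

lemma D_conj:
  assumes "1 \<le> k" "k + 2 \<le> n"
  shows "D (Suc k) (T k (T (Suc k) u)) p = T k (T (Suc k) (D k u)) p"
  using T_braid[OF assms, of u p] by (simp add: D_def T_lin)

lemma T_zero_on: "(\<And>p. p \<in> P \<Longrightarrow> v p = 0) \<Longrightarrow> T k v p = 0"
  using T_cong[of v "\<lambda>p. 0" k] by (simp add: T_zero)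

lemma T_D_comm:
  assumes "1 \<le> a" "a < n" "1 \<le> b" "b < n" "\<bar>int a - int b\<bar> \<ge> 2"
  shows "D a (T b v) p = T b (D a v) p"
  using T_comm[OF assms, of v p] by (simp add: D_def T_lin)

end

context lk_inv begin

lemma M_conj:
  assumes "1 \<le> k" "k + 2 \<le> n" "M v"
  obtains u where "M u" "\<And>p. p \<in> P \<Longrightarrow> v p = T k (T (Suc k) u) p"
proof (rule that[of "Tinv (Suc k) (Tinv k v)"])
  show "M (Tinv (Suc k) (Tinv k v))" using assms by (intro M_Tinv) auto
  fix p assume p: "p \<in> P"
  have "T k (T (Suc k) (Tinv (Suc k) (Tinv k v))) = T k (Tinv k v)"
    by (rule T_cong) (use assms in \<open>simp add: T_Tinv\<close>)
  then show "v p = T k (T (Suc k) (Tinv (Suc k) (Tinv k v))) p"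
    using assms p by (simp add: T_Tinv)
qed

text \<open>The coordinates indexed by \<open>Q\<close> separate the given vectors, so these are
  independent.\<close>

lemma M_dim_ge:
  assumes Q: "Q \<subseteq> P" and ex: "\<And>q. q \<in> Q \<Longrightarrow> \<exists>u. M u \<and> (\<forall>p\<in>Q. u p = (if p = q then 1 else 0))"
  shows "card Q \<le> subspace_dim n l r W"
proof -
  from ex have "\<exists>u. \<forall>q\<in>Q. M (u q) \<and> (\<forall>p\<in>Q. u q p = (if p = q then 1 else 0))"
    by (intro bchoice) blast
  then obtain u where u: "\<And>q. q \<in> Q \<Longrightarrow> M (u q)"
    "\<And>q p. q \<in> Q \<Longrightarrow> p \<in> Q \<Longrightarrow> u q p = (if p = q then 1 else 0)" by blast
  have fin: "finite Q" using Q finite_index_pairs finite_subset by blast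
  show ?thesis
  proof (rule subspace_dim_ge[OF W_sub fin, of "\<lambda>q. restrict (u q) P"])
    show "restrict (u q) P \<in> W" if "q \<in> Q" for q using u(1)[OF that] by (simp only: M_def)
    fix c i assume c: "\<And>p. p \<in> P \<Longrightarrow> (\<Sum>q\<in>Q. c q * restrict (u q) P p) = 0" and i: "i \<in> Q"
    have "(\<Sum>q\<in>Q. c q * restrict (u q) P i) = (\<Sum>q\<in>Q. if i = q then c q else 0)"
      using i Q by (intro sum.cong) (auto simp: u(2))
    then show "c i = 0" using c[of i] i Q fin by auto
  qed
qed

lemma garnir_mem_imp:
  assumes "W \<noteq> carrier V" "M (garnir 1 3)"
  shows "l = r \<or> l = - (r ^ 3)"
proof -
  have "e_coeff 2 (garnir 1 3) = 0" using n4 by (intro e_coeff_zero assms) auto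
  then show ?thesis unfolding e_coeff_garnir by (auto simp: eq_neg_iff_add_eq_0)
qed

text \<open>Modulo vectors with an index 1, every w_jk with j at least 2 is found in
  \<open>W\<close>; the coordinates without the index 1 then give the bound.\<close>

lemma dim_ge_of_neg_cube:
  assumes l: "l = - (r ^ 3)" and x: "M (garnir 1 3)"
  shows "card {(j, k). 2 \<le> j \<and> j < k \<and> k \<le> n} \<le> subspace_dim n l r W"
proof -
  let ?t = "\<lambda>a b j k p. wv j k p + a * wv 1 k p + b * wv 1 j p"
  \<comment> \<open>This is \<open>D_T2_garnir\<close> solved for the new vector; its factor 1/r + r
    is invertible because r^2 is not -1.\<close>
  have "M (\<lambda>p. (1 / r + r) * ?t (- r) (r\<^sup>2) 2 3 p)"
  proof (rule M_cong)
    show "M (\<lambda>p. (- r\<^sup>2) * garnir 1 3 p - D 1 (T 2 (garnir 1 3)) p)"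
      using n4 by (intro M_diff M_scale M_D M_T x F_intros) auto
  qed (simp add: D_T2_garnir[OF l] algebra_simps del: One_nat_def)
  moreover have "1 / r + r \<noteq> 0"
  proof
    assume "1 / r + r = 0"
    moreover have "r * (1 / r + r) = r\<^sup>2 + 1"
      by (simp add: distrib_left power2_eq_square)
    ultimately have "r\<^sup>2 = -1" by (simp add: eq_neg_iff_add_eq_0)
    then show False using r2_ne by blast
  qed
  ultimately have t23: "M (?t (- r) (r\<^sup>2) 2 3)"
    using M_scale_rev[of "1 / r + r"] by (simp add: F_intros)
  \<comment> \<open>Raising k by \<open>T k\<close> only multiplies the coefficient b by r. Below,
    raising j by \<open>T j\<close> only multiplies a by r.\<close>
  have t2: "\<exists>a b. M (?t a b 2 k)" if "3 \<le> k" "k \<le> n" for k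
    using that
  proof (induction k rule: nat_induct_at_least)
    case (Suc k)
    then obtain a b where ab: "M (?t a b 2 k)" by auto
    have "M (T k (?t a b 2 k))" using Suc by (intro M_T ab) auto
    moreover have "T k (?t a b 2 k) = ?t a (r * b) 2 (Suc k)"
      using Suc by (simp add: T_lin T_wv img_def mult_ac)
    ultimately show ?case by metis
  qed (use t23 in blast)
  have t: "\<exists>a b. M (?t a b j k)" if "2 \<le> j" "j < k" "k \<le> n" for j k
    using that
  proof (induction j rule: nat_induct_at_least)
    case (Suc j)
    then obtain a b where ab: "M (?t a b j k)" by auto
    have "M (T j (?t a b j k))" using Suc by (intro M_T ab) auto
    moreover have "T j (?t a b j k) = ?t (r * a) b (Suc j) k"
      using Suc by (simp add: T_lin T_wv img_def mult_ac)
    ultimately show ?case by metis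
  qed (use t2 in auto)
  show ?thesis
  proof (rule M_dim_ge)
    show "{(j, k). 2 \<le> j \<and> j < k \<and> k \<le> n} \<subseteq> P" by (auto simp: index_pairs_def)
    fix q assume "q \<in> {(j, k). 2 \<le> j \<and> j < k \<and> k \<le> n}"
    then obtain j k where q: "q = (j, k)" "2 \<le> j" "j < k" "k \<le> n" by auto
    with t obtain a b where "M (?t a b j k)" by blast
    then show "\<exists>u. M u \<and> (\<forall>p\<in>{(j, k). 2 \<le> j \<and> j < k \<and> k \<le> n}. u p = (if p = q then 1 else 0))"
      by (intro exI[of _ "?t a b j k"] conjI) (auto simp: q(1) wv_def)
  qed
qed

text \<open>The case k = 3 propagates by conjugation with T_k T_{k+1}, which commutes with
  \<open>D 1\<close> as soon as k is at least 3.\<close>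

lemma D1_Dk_zero:
  assumes "\<not> M (garnir 1 3)" "3 \<le> k" "k < n" "M v" "p \<in> P"
  shows "D 1 (D k v) p = 0"
  using assms(2-)
proof (induction k arbitrary: v p rule: nat_induct_at_least)
  case base
  then show ?case using garnir_or_D1_D3_zero[OF assms(1)] by blast
next
  case (Suc k)
  have k: "1 \<le> k" "k + 2 \<le> n" using Suc by auto
  obtain u where u: "M u" "\<And>p. p \<in> P \<Longrightarrow> v p = T k (T (Suc k) u) p"
    by (rule M_conj[OF k Suc.prems(2)]) blast
  have "D 1 (D (Suc k) v) p = D 1 (D (Suc k) (T k (T (Suc k) u))) p"
    by (intro D_cong u Suc.prems)
  also have "D (Suc k) (T k (T (Suc k) u)) = T k (T (Suc k) (D k u))"
    by (rule ext) (rule D_conj[OF k])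
  also have "D 1 (T k (T (Suc k) (D k u))) p = T k (T (Suc k) (D 1 (D k u))) p"
    using k Suc.hyps by (subst T_D_comm) (auto intro!: T_cong[THEN fun_cong] simp: T_D_comm)
  also have "\<dots> = 0"
    using Suc k u(1) by (intro T_zero_on) auto
  finally show ?case .
qed

text \<open>The choice y = 0 is allowed and then says that \<open>D k\<close> vanishes on the
  subspace; \<open>D_zero_all\<close> relies on it.\<close>

definition rank1 :: "nat \<Rightarrow> lk_vector \<Rightarrow> bool" where
  "rank1 k y \<longleftrightarrow> M y \<and> (\<forall>v. M v \<longrightarrow> (\<exists>c\<in>F. \<forall>p\<in>P. D k v p = c * y p))"

lemma rank1_Suc:
  assumes k: "1 \<le> k" "k + 2 \<le> n" and y: "rank1 k y"
  shows "rank1 (Suc k) (T k (T (Suc k) y))"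
  unfolding rank1_def
proof (intro conjI allI impI)
  show "M (T k (T (Suc k) y))" using k y by (intro M_T) (auto simp: rank1_def)
  fix v assume "M v"
  then obtain u where u: "M u" "\<And>p. p \<in> P \<Longrightarrow> v p = T k (T (Suc k) u) p"
    by (rule M_conj[OF k]) blast
  obtain c where c: "c \<in> F" "\<And>p. p \<in> P \<Longrightarrow> D k u p = c * y p"
    using y u(1) unfolding rank1_def by blast
  have "D (Suc k) v p = c * T k (T (Suc k) y) p" if "p \<in> P" for p
  proof -
    have "D (Suc k) v p = D (Suc k) (T k (T (Suc k) u)) p" by (intro D_cong u that)
    also have "\<dots> = T k (T (Suc k) (D k u)) p" by (rule D_conj[OF k])
    also have "T (Suc k) (D k u) = T (Suc k) (\<lambda>p. c * y p)" by (intro T_cong c)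
    finally show ?thesis by (simp add: T_lin)
  qed
  with c(1) show "\<exists>c\<in>F. \<forall>p\<in>P. D (Suc k) v p = c * T k (T (Suc k) y) p" by blast
qed

text \<open>The shape of \<open>D 1 v\<close> when the Garnir vector is missing, with a and b its
  coordinates at (1, 2) and (2, 3). The exponent \<open>j - 3\<close> is meant for j at least
  3.\<close>

definition rank1_vec :: "complex \<Rightarrow> complex \<Rightarrow> lk_vector" where
  "rank1_vec a b = (\<lambda>(i, j). if i = 1 \<and> j = 2 then a else if i = 1 then - r * (b * r ^ (j - 3))
     else if i = 2 then b * r ^ (j - 3) else 0)"

text \<open>Away from (1, 2), row 1 is -r times row 2 because \<open>D 1 v\<close> lies in the other
  eigenspace. Rows from 3 on vanish. Row 2 is geometric because \<open>D k (D 1 v)\<close> vanishes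
  at (2, k) for k at least 3.\<close>

lemma D1_shape:
  assumes x: "\<not> M (garnir 1 3)" and v: "M v" and p: "p \<in> P"
  shows "D 1 v p = rank1_vec (D 1 v (1, 2)) (D 1 v (2, 3)) p"
proof -
  let ?y = "D 1 v"
  have row1: "?y (1, j) = - r * ?y (2, j)" if "3 \<le> j" "j \<le> n" for j
    using that T_coord_left[of 1 j v] T_coord_left_Suc[of 1 j v]
    by (simp add: D_def m_eq eval_nat_numeral field_simps)
  have rest: "?y (i, j) = 0" if "3 \<le> i" "i < j" "j \<le> n" for i j
    using that T_coord_disjoint[of i j 1 v] by (simp add: D_def index_pairs_def)
  have step: "?y (2, Suc k) = r * ?y (2, k)" if k: "3 \<le> k" "k < n" for k
  proof -
    have "D k (D 1 v) (2, k) = D 1 (D k v) (2, k)" using k by (intro D_comm) auto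
    also have "\<dots> = 0" using k by (intro D1_Dk_zero[OF x]) (auto simp: v index_pairs_def)
    finally show ?thesis using k T_coord_right[of 2 k "D 1 v"] by (simp add: D_def[of k])
  qed
  have row2: "?y (2, j) = ?y (2, 3) * r ^ (j - 3)" if "3 \<le> j" "j \<le> n" for j
    using that
  proof (induction j rule: nat_induct_at_least)
    case (Suc j)
    then have "Suc j - 3 = Suc (j - 3)" by simp
    with Suc show ?case using step[of j] by (simp only: power_Suc) simp
  qed simp
  obtain i j where ij: "p = (i, j)" "1 \<le> i" "i < j" "j \<le> n" using p by (auto simp: index_pairs_def)
  consider "i = 1" "j = 2" | "i = 1" "3 \<le> j" | "i = 2" "3 \<le> j" | "3 \<le> i" using ij by linarith
  then show ?thesis
  proof cases
    case 2
    then show ?thesis using ij row1[of j] row2[of j] by (simp add: rank1_vec_def del: One_nat_def)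
  next
    case 3
    then show ?thesis using ij row2[of j] by (simp add: rank1_vec_def del: One_nat_def)
  next
    case 4
    then show ?thesis using ij rest[of i j] by (simp add: rank1_vec_def del: One_nat_def)
  qed (simp add: ij rank1_vec_def)
qed

end

section \<open>Spans of stable families and auxiliary identities\<close>

context lk_rep begin

lemma span_invariant:
  assumes I: "finite I" and u: "\<And>i p. i \<in> I \<Longrightarrow> p \<in> P \<Longrightarrow> u i p \<in> F"
    and T: "\<And>k i. 1 \<le> k \<Longrightarrow> k < n \<Longrightarrow> i \<in> I \<Longrightarrow>
      \<exists>c. (\<forall>j\<in>I. c j \<in> F) \<and> (\<forall>p\<in>P. T k (u i) p = (\<Sum>j\<in>I. c j * u j p))"
  shows "invariant_subspace n l r {\<lambda>p\<in>P. \<Sum>i\<in>I. c i * u i p | c. \<forall>i\<in>I. c i \<in> F}" (is "invariant_subspace _ _ _ ?U")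
proof -
  have "VectorSpace.subspace (base_field l r) ?U V"
  proof (rule subspaceI)
    show "?U \<subseteq> carrier V" using u by (auto simp only: restrict_in_V intro!: F_intros)
    show "\<zero>\<^bsub>V\<^esub> \<in> ?U"
      unfolding lk_space_zero by (intro CollectI exI[of _ "\<lambda>i. 0"]) (simp add: F_intros)
  next
    fix v w assume "v \<in> ?U" "w \<in> ?U"
    then obtain c d where cd: "\<forall>i\<in>I. c i \<in> F" "\<forall>i\<in>I. d i \<in> F"
      "v = (\<lambda>p\<in>P. \<Sum>i\<in>I. c i * u i p)" "w = (\<lambda>p\<in>P. \<Sum>i\<in>I. d i * u i p)" by blast
    show "(\<lambda>p\<in>P. v p + w p) \<in> ?U"
      by (intro CollectI exI[of _ "\<lambda>i. c i + d i"] conjI restrict_ext)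
        (simp_all add: cd F_intros algebra_simps sum.distrib)
  next
    fix a v assume a: "a \<in> F" and "v \<in> ?U"
    then obtain c where c: "\<forall>i\<in>I. c i \<in> F" "v = (\<lambda>p\<in>P. \<Sum>i\<in>I. c i * u i p)" by blast
    show "(\<lambda>p\<in>P. a * v p) \<in> ?U"
      by (intro CollectI exI[of _ "\<lambda>i. a * c i"] conjI restrict_ext)
        (simp_all add: a c F_intros sum_distrib_left mult.assoc)
  qed
  moreover have "restrict (T k v) P \<in> ?U" if k: "k \<in> {1..n - 1}" and v: "v \<in> ?U" for k v
  proof -
    obtain c where c: "\<forall>i\<in>I. c i \<in> F" "v = (\<lambda>p\<in>P. \<Sum>i\<in>I. c i * u i p)" using v by blast
    have "\<exists>d. \<forall>i\<in>I. (\<forall>j\<in>I. d i j \<in> F) \<and> (\<forall>p\<in>P. T k (u i) p = (\<Sum>j\<in>I. d i j * u j p))"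
      using T[of k] k n4 by (intro bchoice) auto
    then obtain d where d: "\<And>i j. i \<in> I \<Longrightarrow> j \<in> I \<Longrightarrow> d i j \<in> F"
      "\<And>i p. i \<in> I \<Longrightarrow> p \<in> P \<Longrightarrow> T k (u i) p = (\<Sum>j\<in>I. d i j * u j p)" by blast
    have "T k v p = (\<Sum>j\<in>I. (\<Sum>i\<in>I. c i * d i j) * u j p)" if p: "p \<in> P" for p
    proof -
      have "T k v p = (\<Sum>i\<in>I. c i * T k (u i) p)" unfolding c(2) T_restrict T_sum ..
      also have "\<dots> = (\<Sum>i\<in>I. \<Sum>j\<in>I. c i * d i j * u j p)"
        by (intro sum.cong refl) (simp add: d(2) p sum_distrib_left mult.assoc)
      also have "\<dots> = (\<Sum>j\<in>I. (\<Sum>i\<in>I. c i * d i j) * u j p)"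
        unfolding sum_distrib_right by (rule sum.swap)
      finally show ?thesis .
    qed
    then show ?thesis
      using c(1) d(1)
      by (intro CollectI exI[of _ "\<lambda>j. \<Sum>i\<in>I. c i * d i j"] conjI restrict_ext ballI F_intros) blast+
  qed
  ultimately show ?thesis unfolding invariant_subspace_iff by blast
qed

lemma T_eq_zeroD:
  assumes "1 \<le> k" "k < n" "\<And>p. p \<in> P \<Longrightarrow> T k v p = 0" "p \<in> P"
  shows "v p = 0"
proof -
  have "v p = Tinv k (T k v) p" using assms by (simp add: Tinv_T)
  also have "\<dots> = 0" using assms(3,4) T_zero_on[of "T k v" k] T_zero_on[of "T k (T k v)" k]
    by (simp add: Tinv_def E_def T_zero_on)
  finally show ?thesis .
qed

lemma m_r: "m * r = 1 - r * r"
  by (simp add: m_eq left_diff_distrib)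

text \<open>Applied to two coordinates swapped by \<open>T k\<close>, this says that
  \<open>D k v\<close> has ratio -r between them.\<close>

lemma eigenvector_identity: "b - r * a = - (r * (a - m * b - r * b))"
proof -
  have "r * (m * b) = b - r * (r * b)"
    using arg_cong[OF m_r, of "\<lambda>x. x * b"] by (simp add: algebra_simps)
  then show ?thesis by (simp add: algebra_simps)
qed

text \<open>The fourth equation gives c2 = -c0. If c1 were nonzero, the second would force a = r^2 -
  1, and eliminating c0 from the first and third would leave r (r^4 + 1) c1 = 0.\<close>

lemma indep_system:
  fixes a c0 c1 c2 :: complex
  assumes 1: "c0 * a - r * c1 = 0" and 2: "- r * c0 + (a + m * r) * c1 - r * c2 = 0"
    and 3: "- r\<^sup>2 * c0 - r ^ 3 * c1 + c2 = 0" and 4: "r * c0 + r * c2 = 0"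
  shows "c0 = 0 \<and> c1 = 0 \<and> c2 = 0"
proof -
  have "r * (c0 + c2) = 0" using 4 by (simp add: distrib_left)
  then have c2: "c2 = - c0" by (simp add: eq_neg_iff_add_eq_0 add.commute)
  have mr: "m * r = 1 - r\<^sup>2" by (simp add: m_r power2_eq_square)
  have p2: "(a + m * r) * c1 = 0" using 2 by (simp add: c2)
  have p3: "(r\<^sup>2 + 1) * c0 = - (r ^ 3 * c1)" using 3 c2 by Groebner_Basis.algebra
  have r1: "r\<^sup>2 + 1 \<noteq> 0" using r2_ne by (simp add: eq_neg_iff_add_eq_0)
  have "c1 = 0"
  proof (rule ccontr)
    assume c1: "c1 \<noteq> 0"
    then have "a = r\<^sup>2 - 1" using p2 mr by Groebner_Basis.algebra
    then have "(r * (r ^ 4 + 1)) * c1 = 0" using 1 p3 by Groebner_Basis.algebra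
    then have "r ^ 4 + 1 = 0" using c1 by simp
    then show False using r2_ne by (simp add: eq_neg_iff_add_eq_0)
  qed
  moreover from this have "c0 = 0" using p3 r1 by simp
  ultimately show ?thesis using c2 by simp
qed

end

section \<open>Dimension bounds in the absence of the Garnir vector\<close>

context lk_inv begin

text \<open>The span of the \<open>u i\<close> is a nonzero invariant subspace of \<open>W\<close>,
  hence all of \<open>W\<close> by irreducibility.\<close>

lemma irreducible_span:
  assumes irr: "irreducible_invariant_subspace n l r W"
    and I: "finite I" and u: "\<And>i. i \<in> I \<Longrightarrow> M (u i)"
    and T: "\<And>k i. 1 \<le> k \<Longrightarrow> k < n \<Longrightarrow> i \<in> I \<Longrightarrow>
      \<exists>c. (\<forall>j\<in>I. c j \<in> F) \<and> (\<forall>p\<in>P. T k (u i) p = (\<Sum>j\<in>I. c j * u j p))"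
    and ne: "i \<in> I" "p \<in> P" "u i p \<noteq> 0"
  shows "subspace_dim n l r W \<le> card I"
proof -
  let ?U = "{\<lambda>p\<in>P. \<Sum>i\<in>I. c i * u i p | c. \<forall>i\<in>I. c i \<in> F}"
  have "invariant_subspace n l r ?U"
    using M_F[OF u] by (intro span_invariant I T) auto
  moreover have "?U \<subseteq> W"
    using M_sum[OF I _ u] by (auto simp: M_def)
  moreover have "?U \<noteq> {\<zero>\<^bsub>V\<^esub>}"
  proof
    assume U: "?U = {\<zero>\<^bsub>V\<^esub>}"
    have "(\<lambda>p\<in>P. \<Sum>j\<in>I. (if j = i then 1 else 0) * u j p) \<in> ?U"
      by (intro CollectI exI[of _ "\<lambda>j. if j = i then 1 else 0"]) (simp add: F_intros)
    then have "(\<lambda>p\<in>P. \<Sum>j\<in>I. (if j = i then 1 else 0) * u j p) p = 0"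
      unfolding U lk_space_zero using ne by simp
    then show False using ne I by (simp add: if_distrib[of "\<lambda>x. x * _"] cong: if_cong)
  qed
  ultimately have WU: "?U = W"
    using irr unfolding irreducible_invariant_subspace_def by blast
  show ?thesis
  proof (rule subspace_dim_le[OF W_sub I, of "\<lambda>i. restrict (u i) P"])
    show "restrict (u i) P \<in> W" if "i \<in> I" for i using u[OF that] by (simp only: M_def)
    fix w assume "w \<in> W"
    then obtain c where c: "\<forall>i\<in>I. c i \<in> F" "w = (\<lambda>p\<in>P. \<Sum>i\<in>I. c i * u i p)"
      unfolding WU[symmetric] by blast
    then show "\<exists>c. (\<forall>i\<in>I. c i \<in> F) \<and> (\<forall>p\<in>P. w p = (\<Sum>i\<in>I. c i * restrict (u i) P p))"
      by (intro exI[of _ c]) simp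
  qed
qed

lemma D_zero_all:
  assumes "\<And>v p. M v \<Longrightarrow> p \<in> P \<Longrightarrow> D 1 v p = 0" "1 \<le> k" "k < n" "M v" "p \<in> P"
  shows "D k v p = 0"
proof -
  have "rank1 k (\<lambda>p. 0)" using assms(2,3)
  proof (induction k rule: nat_induct_at_least)
    case base
    show ?case unfolding rank1_def using assms(1) M_zero base_field_consts(1) by auto
  next
    case (Suc k)
    then show ?case using rank1_Suc[of k "\<lambda>p. 0"] by (simp add: T_zero)
  qed
  then show ?thesis using assms(4,5) unfolding rank1_def by auto
qed

text \<open>All \<open>T k\<close> act on \<open>W\<close> as the scalar r, so any nonzero vector
  spans an invariant line.\<close>

lemma dim_le_of_D_zero:
  assumes irr: "irreducible_invariant_subspace n l r W"
    and D: "\<And>v p. M v \<Longrightarrow> p \<in> P \<Longrightarrow> D 1 v p = 0"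
  shows "subspace_dim n l r W \<le> 1"
proof -
  obtain v where v: "v \<in> W" "v \<noteq> \<zero>\<^bsub>V\<^esub>"
    using irr subspaceD(2)[OF W_sub] unfolding irreducible_invariant_subspace_def lk_space_zero by blast
  then obtain p where p: "p \<in> P" "v p \<noteq> 0"
    using V_eqI[of v "\<zero>\<^bsub>V\<^esub>"] W_V subspaceD(2)[OF W_sub] unfolding lk_space_zero by fastforce
  have "subspace_dim n l r W \<le> card {()}"
  proof (rule irreducible_span[OF irr, of "{()}" "\<lambda>_. v" "()" p])
    fix k assume k: "1 \<le> k" "k < n"
    have "T k v p = r * v p" if "p \<in> P" for p
      using D_zero_all[OF D k M_W[OF v(1)] that] by (simp add: D_def)
    then show "\<exists>c. (\<forall>j\<in>{()}. c j \<in> F) \<and> (\<forall>p\<in>P. T k v p = (\<Sum>j\<in>{()}. c j * v p))"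
      by (intro exI[of _ "\<lambda>_. r"]) (simp add: F_intros)
  qed (use p M_W[OF v(1)] in auto)
  then show ?thesis by simp
qed

text \<open>By \<open>D1_shape\<close> only a multiple of w_12 remains, and w_12 cannot lie in a
  proper invariant subspace. So the coordinate (2, 3) determines \<open>D 1 v\<close>.\<close>

lemma D1_zero_of_coord:
  assumes proper: "W \<noteq> carrier V" and x: "\<not> M (garnir 1 3)" and v: "M v" and b: "D 1 v (2, 3) = 0"
    and p: "p \<in> P"
  shows "D 1 v p = 0"
proof -
  let ?a = "D 1 v (1, 2)"
  have eq: "D 1 v p = ?a * wv 1 2 p" if "p \<in> P" for p
    using D1_shape[OF x v that] b by (auto simp: rank1_vec_def wv_def split: prod.splits)
  have MD: "M (D 1 v)" using n4 v by (intro M_D) auto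
  have "?a = 0"
  proof (rule ccontr)
    assume "?a \<noteq> 0"
    moreover have "?a \<in> F" using M_F[OF MD] n4 by (simp add: index_pairs_def)
    moreover have "M (\<lambda>p. ?a * wv 1 2 p)" by (rule M_cong[OF MD]) (simp only: eq)
    ultimately have "M (wv 1 2)" using M_scale_rev by blast
    then show False using M_wv_all proper by blast
  qed
  then show ?thesis using eq[OF p] by simp
qed

text \<open>Subtracting the multiple of v0 that clears the coordinate (2, 3) brings every v into the
  scope of \<open>D1_zero_of_coord\<close>.\<close>

lemma rank1_one:
  assumes proper: "W \<noteq> carrier V" and x: "\<not> M (garnir 1 3)"
    and v0: "M v0" "p0 \<in> P" "D 1 v0 p0 \<noteq> 0"
  shows "rank1 1 (D 1 v0)"
  unfolding rank1_def
proof (intro conjI allI impI)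
  show MD0: "M (D 1 v0)" using n4 v0 by (intro M_D) auto
  fix v assume v: "M v"
  have MD: "M (D 1 v)" using n4 v by (intro M_D) auto
  let ?c0 = "D 1 v0 (2, 3)" and ?b = "D 1 v (2, 3)"
  have b0: "?c0 \<noteq> 0" using D1_zero_of_coord[OF proper x v0(1) _ v0(2)] v0(3) by blast
  have "(2, 3) \<in> P" using n4 by (simp add: index_pairs_def)
  then have c: "?b / ?c0 \<in> F" using M_F[OF MD] M_F[OF MD0] by (intro F_intros) auto
  have M: "M (\<lambda>p. v p - ?b / ?c0 * v0 p)" by (intro M_diff M_scale c v v0)
  have "D 1 (\<lambda>p. v p - ?b / ?c0 * v0 p) (2, 3) = 0" using b0 by (simp only: D_lin) simp
  from D1_zero_of_coord[OF proper x M this]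
  have "D 1 v p = ?b / ?c0 * D 1 v0 p" if "p \<in> P" for p
    using that by (simp only: D_lin right_minus_eq)
  with c show "\<exists>c\<in>F. \<forall>p\<in>P. D 1 v p = c * D 1 v0 p" by blast
qed

lemma dim_le_of_not_garnir:
  assumes irr: "irreducible_invariant_subspace n l r W"
    and proper: "W \<noteq> carrier V" and x: "\<not> M (garnir 1 3)"
    and v0: "M v0" "p0 \<in> P" "D 1 v0 p0 \<noteq> 0"
  shows "subspace_dim n l r W \<le> n - 1"
proof -
  \<comment> \<open>\<open>y k\<close> spans the image of \<open>D k\<close>, transported from
    \<open>D 1 v0\<close> by the conjugation in \<open>rank1_Suc\<close>. The value at 0 is a
    placeholder.\<close>
  define y where "y = rec_nat (\<lambda>p. 0) (\<lambda>k y. if k = 0 then D 1 v0 else T k (T (Suc k) y))"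
  have y1: "y 1 = D 1 v0" by (simp add: y_def)
  have ySuc: "y (Suc k) = T k (T (Suc k) (y k))" if "1 \<le> k" for k using that by (simp add: y_def)
  have y: "rank1 k (y k)" if "1 \<le> k" "k < n" for k
    using that
  proof (induction k rule: nat_induct_at_least)
    case base
    show ?case unfolding y1 by (rule rank1_one[OF proper x v0])
  next
    case (Suc k)
    then show ?case unfolding ySuc[OF Suc.hyps] by (intro rank1_Suc) auto
  qed
  have "subspace_dim n l r W \<le> card {1..<n}"
  proof (rule irreducible_span[OF irr, of "{1..<n}" y 1 p0])
    show My: "M (y i)" if "i \<in> {1..<n}" for i using y that by (auto simp: rank1_def)
    fix k i assume k: "1 \<le> k" "k < n" and i: "i \<in> {1..<n}"
    obtain c where c: "c \<in> F" "\<And>p. p \<in> P \<Longrightarrow> D k (y i) p = c * y k p"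
      using y[OF k] My[OF i] unfolding rank1_def by blast
    \<comment> \<open>T_k y_i = r y_i + c y_k, written as a sum of two indicators because i and k
      may coincide.\<close>
    let ?c = "\<lambda>j. (if j = i then r else 0) + (if j = k then c else 0)"
    have "T k (y i) p = (\<Sum>j\<in>{1..<n}. ?c j * y j p)" if "p \<in> P" for p
    proof -
      have "(\<Sum>j\<in>{1..<n}. ?c j * y j p)
          = (\<Sum>j\<in>{1..<n}. if j = i then r * y j p else 0) + (\<Sum>j\<in>{1..<n}. if j = k then c * y j p else 0)"
        unfolding sum.distrib[symmetric] by (intro sum.cong refl) (simp add: distrib_right)
      also have "\<dots> = r * y i p + c * y k p" using i k by simp
      also have "\<dots> = T k (y i) p" using c(2)[OF that] by (simp add: D_def algebra_simps)
      finally show ?thesis by simp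
    qed
    then show "\<exists>c. (\<forall>j\<in>{1..<n}. c j \<in> F) \<and> (\<forall>p\<in>P. T k (y i) p = (\<Sum>j\<in>{1..<n}. c j * y j p))"
      using c(1) by (intro exI[of _ ?c]) (simp add: F_intros)
  qed (use v0 y1 n4 in auto)
  then show ?thesis by simp
qed

text \<open>For n = 4 the dimension sought is 2, which the bound n - 1 = 3 does not exclude. Three
  independent vectors are exhibited instead: y in the image of \<open>D 1\<close>, then
  \<open>T 2 y\<close>, and y' in the image of \<open>D 3\<close>.\<close>

lemma dim_ge_of_n4:
  assumes n: "n = 4" and proper: "W \<noteq> carrier V" and x: "\<not> M (garnir 1 3)"
    and v0: "M v0" "p0 \<in> P" "D 1 v0 p0 \<noteq> 0"
  shows "3 \<le> subspace_dim n l r W"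
proof -
  have P: "(1,2) \<in> P" "(1,3) \<in> P" "(1,4) \<in> P" "(2,3) \<in> P" "(2,4) \<in> P" "(3,4) \<in> P"
    using n4 by (simp_all add: index_pairs_def)
  let ?b = "D 1 v0 (2, 3)"
  have b: "?b \<noteq> 0" using D1_zero_of_coord[OF proper x v0(1) _ v0(2)] v0(3) by blast
  have MD: "M (D 1 v0)" using n4 v0 by (intro M_D) auto
  define y where "y = (\<lambda>p. 1 / ?b * D 1 v0 p)"
  have My: "M y" unfolding y_def using M_F[OF MD P(4)] by (intro M_scale MD F_intros) auto
  have y_eq: "y p = rank1_vec (y (1, 2)) 1 p" if "p \<in> P" for p
    using D1_shape[OF x v0(1) that] b by (auto simp: y_def rank1_vec_def split: prod.splits)
  have y: "y (1, 3) = - r" "y (1, 4) = - r\<^sup>2" "y (2, 4) = r" "y (3, 4) = 0"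
    using y_eq[OF P(2)] y_eq[OF P(3)] y_eq[OF P(5)] y_eq[OF P(6)]
    by (simp_all add: rank1_vec_def power2_eq_square)
  \<comment> \<open>Conjugating twice, from \<open>D 1\<close> to \<open>D 2\<close> to
    \<open>D 3\<close>, makes \<open>D 3 w\<close> an invertible image of \<open>D 1 v0\<close>, so
    it is nonzero.\<close>
  define w where "w = T 2 (T 3 (T 1 (T 2 v0)))"
  have Mw: "M w" unfolding w_def using n4 by (intro M_T v0) auto
  let ?z = "D 3 w"
  have Mz: "M ?z" using n4 Mw by (intro M_D) auto
  have z_conj: "?z = T 2 (T 3 (T 1 (T 2 (D 1 v0))))"
  proof -
    have "D 3 (T 2 (T 3 v)) = T 2 (T 3 (D 2 v))" for v
      using D_conj[of 2 v] n4 by (auto simp: eval_nat_numeral)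
    moreover have "D 2 (T 1 (T 2 v)) = T 1 (T 2 (D 1 v))" for v
      using D_conj[of 1 v] n4 by (auto simp: eval_nat_numeral)
    ultimately show ?thesis by (simp add: w_def)
  qed
  have z_ne: "\<exists>p\<in>P. ?z p \<noteq> 0"
  proof (rule ccontr)
    assume "\<not> ?thesis"
    then have "\<And>p. p \<in> P \<Longrightarrow> T 2 (T 3 (T 1 (T 2 (D 1 v0)))) p = 0" by (simp add: z_conj)
    then have "\<And>p. p \<in> P \<Longrightarrow> T 3 (T 1 (T 2 (D 1 v0))) p = 0"
      by (rule T_eq_zeroD[of 2, rotated 2]) (use n4 in auto)
    then have "\<And>p. p \<in> P \<Longrightarrow> T 1 (T 2 (D 1 v0)) p = 0"
      by (rule T_eq_zeroD[of 3, rotated 2]) (use n4 in auto)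
    then have "\<And>p. p \<in> P \<Longrightarrow> T 2 (D 1 v0) p = 0"
      by (rule T_eq_zeroD[of 1, rotated 2]) (use n4 in auto)
    then have "\<And>p. p \<in> P \<Longrightarrow> D 1 v0 p = 0"
      by (rule T_eq_zeroD[of 2, rotated 2]) (use n4 in auto)
    then show False using v0 by blast
  qed
  have z: "?z (1, 2) = 0" "?z (1, 3) = - r * ?z (1, 4)" "?z (2, 3) = - r * ?z (2, 4)"
  proof -
    show "?z (1, 2) = 0" using T_coord_disjoint[OF P(1), of 3 w] by (simp add: D_def)
    show "?z (1, 3) = - r * ?z (1, 4)"
      using T_coord_right[of 1 3 w] T_coord_right_Suc[of 1 3 w] n4 eigenvector_identity[of "w (1, 4)" "w (1, 3)"]
      by (simp add: D_def)
    show "?z (2, 3) = - r * ?z (2, 4)"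
      using T_coord_right[of 2 3 w] T_coord_right_Suc[of 2 3 w] n4 eigenvector_identity[of "w (2, 4)" "w (2, 3)"]
      by (simp add: D_def)
  qed
  \<comment> \<open>The vanishing of \<open>D 1 (D 3 w)\<close>, read at (1, 4).\<close>
  have z4: "?z (2, 4) = r * ?z (1, 4)"
  proof -
    have "D 1 ?z (1, 4) = 0" using n4 by (intro D1_Dk_zero[OF x] Mw P) auto
    then show ?thesis using T_coord_left[of 1 4 ?z] n4 by (simp add: D_def[of "Suc 0"] eval_nat_numeral)
  qed
  \<comment> \<open>Otherwise all coordinates of \<open>D 3 w\<close> except the one at (3, 4)
    vanish, and w_34 would generate the whole space.\<close>
  have z_ne': "?z (1, 4) \<noteq> 0"
  proof
    assume z0: "?z (1, 4) = 0"
    have z_eq: "?z p = ?z (3, 4) * wv 3 4 p" if p: "p \<in> P" for p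
    proof -
      have "p = (1,2) \<or> p = (1,3) \<or> p = (1,4) \<or> p = (2,3) \<or> p = (2,4) \<or> p = (3,4)"
        using p unfolding n index_pairs_def by (auto simp: eval_nat_numeral le_Suc_eq)
      then show ?thesis using z z0 z4 by (elim disjE) (simp_all add: wv_def)
    qed
    then have "?z (3, 4) \<noteq> 0" using z_ne by auto
    moreover have "?z (3, 4) \<in> F" by (rule M_F[OF Mz P(6)])
    moreover have "M (\<lambda>p. ?z (3, 4) * wv 3 4 p)" by (rule M_cong[OF Mz]) (simp only: z_eq)
    ultimately have "M (wv 3 (Suc 3))" using M_scale_rev by simp
    then show False using M_wv_down[of 3] M_wv_all proper n4 by simp
  qed
  define y' where "y' = (\<lambda>p. 1 / ?z (1, 4) * ?z p)"
  have My': "M y'" unfolding y'_def using M_F[OF Mz P(3)] by (intro M_scale Mz F_intros) auto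
  have y': "y' (1, 2) = 0" "y' (1, 3) = - r" "y' (1, 4) = 1" "y' (2, 4) = r"
    using z z4 z_ne' by (simp_all add: y'_def)
  have Ty: "T 2 y (1, 2) = - r" "T 2 y (1, 3) = y (1, 2) + m * r" "T 2 y (1, 4) = - (r ^ 3)"
    "T 2 y (2, 4) = 0"
    using T_coord_right[of 1 2 y] T_coord_right_Suc[of 1 2 y] T_coord_disjoint[OF P(3), of 2 y]
      T_coord_left[of 2 4 y] n4 y by (simp_all add: eval_nat_numeral)
  define u where "u = (\<lambda>i::nat. if i = 0 then y else if i = 1 then T 2 y else y')"
  have Mu: "M (u i)" for i using My My' n4 by (auto simp: u_def intro!: M_T)
  have "card {0, 1, 2::nat} \<le> subspace_dim n l r W"
  proof (rule subspace_dim_ge[OF W_sub, of _ "\<lambda>i. restrict (u i) P"])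
    show "restrict (u i) P \<in> W" for i using Mu by (simp only: M_def)
    fix c i assume c: "\<And>p. p \<in> P \<Longrightarrow> (\<Sum>i\<in>{0, 1, 2}. c i * restrict (u i) P p) = 0" and i: "i \<in> {0, 1, 2::nat}"
    have lin: "c 0 * y p + c 1 * T 2 y p + c 2 * y' p = 0" if "p \<in> P" for p
      using c[OF that] that by (simp add: u_def add.assoc)
    \<comment> \<open>The relation is read at (1, 2), (1, 3), (1, 4) and (2, 4), where all three
      vectors are known up to the one parameter \<open>y (1, 2)\<close>.\<close>
    have "c 0 = 0 \<and> c 1 = 0 \<and> c 2 = 0"
    proof (rule indep_system[of "c 0" "y (1, 2)"])
      show "c 0 * y (1, 2) - r * c 1 = 0"
        using lin[OF P(1)] unfolding y y' Ty by (simp add: mult.commute)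
      show "- r * c 0 + (y (1, 2) + m * r) * c 1 - r * c 2 = 0"
        using lin[OF P(2)] unfolding y y' Ty by (simp add: mult.commute)
      show "- r\<^sup>2 * c 0 - r ^ 3 * c 1 + c 2 = 0"
        using lin[OF P(3)] unfolding y y' Ty by (simp add: mult.commute)
      show "r * c 0 + r * c 2 = 0"
        using lin[OF P(5)] unfolding y y' Ty by (simp add: mult.commute)
    qed
    with i show "c i = 0" by auto
  qed simp
  then show ?thesis by simp
qed

end

context lk_rep begin

section \<open>The case l = r\<close>

text \<open>The coefficients of the forms f_i. Dividing by \<open>r\<^sup>2\<close> avoids the
  exponent b - i - 2, which is -1 for b = i + 1.\<close>

definition form_basis :: "nat \<Rightarrow> nat \<times> nat \<Rightarrow> complex" where
  "form_basis i = (\<lambda>(a, b). if a = i then r ^ (b - i) / r\<^sup>2 else if b = i then 1 / r ^ (i - a) else 0)"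

definition form :: "nat \<Rightarrow> lk_vector \<Rightarrow> complex" where
  "form i v = (\<Sum>q\<in>P. v q * form_basis i q)"

lemma form_add: "form k (\<lambda>p. u p + v p) = form k u + form k v"
  by (simp add: form_def algebra_simps sum.distrib)
lemma form_scale: "form k (\<lambda>p. c * v p) = c * form k v"
  by (simp add: form_def algebra_simps sum_distrib_left)
lemma form_diff: "form k (\<lambda>p. u p - v p) = form k u - form k v"
  by (simp add: form_def algebra_simps sum_subtractf)
lemma form_uminus: "form k (\<lambda>p. - v p) = - form k v"
  using form_scale[of k "-1" v] by simp
lemma form_divide: "form k (\<lambda>p. v p / c) = form k v / c"
  using form_scale[of k "1 / c" v] by simp
lemmas form_lin = form_add form_scale form_diff form_divide form_uminus

lemma form_sum: "finite A \<Longrightarrow> form k (\<lambda>p. \<Sum>a\<in>A. c a * u a p) = (\<Sum>a\<in>A. c a * form k (u a))"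
  by (induction A rule: finite_induct) (simp_all add: form_lin, simp add: form_def)

lemma form_cong: "(\<And>p. p \<in> P \<Longrightarrow> u p = v p) \<Longrightarrow> form k u = form k v"
  by (simp add: form_def cong: sum.cong)

lemma form_wv: "1 \<le> i \<Longrightarrow> i < j \<Longrightarrow> j \<le> n \<Longrightarrow> form k (wv i j) = form_basis k (i, j)"
  by (simp add: form_def wv_def if_distrib[of "\<lambda>x. x * _"] cong: if_cong)
    (simp add: index_pairs_def)

lemma form_T_ext:
  assumes "\<And>a b. 1 \<le> a \<Longrightarrow> a < b \<Longrightarrow> b \<le> n \<Longrightarrow> form i (T k (wv a b)) = c * form_basis i' (a, b)"
  shows "form i (T k v) = c * form i' v"
proof -
  have "form i (T k v) = form i (\<lambda>p. \<Sum>q\<in>P. v q * T k (wv (fst q) (snd q)) p)"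
    by (subst T_expand) (rule refl)
  also have "\<dots> = (\<Sum>q\<in>P. v q * (c * form_basis i' q))"
    unfolding form_sum[OF finite_index_pairs]
    by (intro sum.cong refl) (auto simp: assms index_pairs_def)
  finally show ?thesis by (simp add: form_def sum_distrib_left mult.left_commute)
qed

text \<open>Checked on basis vectors. The condition l = r enters through the coefficients 1/l of
  w_{k,k+1}, which only f_k and f_{k+1} detect.\<close>

lemma form_T:
  assumes lr: "l = r" and k: "1 \<le> k" "k < n"
  shows "i \<noteq> k \<Longrightarrow> i \<noteq> Suc k \<Longrightarrow> form i (T k v) = r * form i v"
    and "form k (T k v) = 1 / r * form (Suc k) v" and "form (Suc k) (T k v) = 1 / r * form k v"
proof -
  note rules = T_lin T_wv img_def form_lin form_wv form_basis_def
  show "form i (T k v) = r * form i v" if "i \<noteq> k" "i \<noteq> Suc k"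
  proof (rule form_T_ext)
    fix a b assume ab: "1 \<le> a" "a < b" "b \<le> n"
    from ab(2) show "form i (T k (wv a b)) = r * form_basis i (a, b)"
    proof (cases rule: pair_cases[of a b k])
      case 1
      then show ?thesis using ab k by (simp add: rules)
    next
      case 2
      then show ?thesis using ab k that by (simp add: rules)
    next
      case 3
      then show ?thesis using ab k that by (simp add: rules; auto)
    next
      case 4
      then show ?thesis using ab k that
        by (simp add: rules; simp add: m_eq power2_eq_square divide_simps; auto simp: algebra_simps)
    next
      case (5 e)
      then show ?thesis using ab k that by (simp add: rules)
    next
      case (6 e)
      then show ?thesis using ab k that
        by (simp add: rules; simp add: m_eq power2_eq_square divide_simps; auto simp: algebra_simps)
    qed
  qed
  show "form k (T k v) = 1 / r * form (Suc k) v"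
  proof (rule form_T_ext)
    fix a b assume ab: "1 \<le> a" "a < b" "b \<le> n"
    from ab(2) show "form k (T k (wv a b)) = 1 / r * form_basis (Suc k) (a, b)"
    proof (cases rule: pair_cases[of a b k])
      case 1
      then show ?thesis using ab k by (simp add: rules)
    next
      case 2
      then show ?thesis using ab k by (simp add: rules; simp add: lr power2_eq_square)
    next
      case 3
      then show ?thesis using ab k by (simp add: rules)
    next
      case 4
      then show ?thesis using ab k
        by (simp add: rules; simp add: m_eq power2_eq_square left_diff_distrib right_diff_distrib diff_divide_distrib)
    next
      case (5 e)
      then show ?thesis using ab k by (simp add: rules)
    next
      case (6 e)
      then show ?thesis using ab k
        by (simp add: rules; simp add: lr m_eq power2_eq_square left_diff_distrib right_diff_distrib diff_divide_distrib)
    qed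
  qed
  show "form (Suc k) (T k v) = 1 / r * form k v"
  proof (rule form_T_ext)
    fix a b assume ab: "1 \<le> a" "a < b" "b \<le> n"
    from ab(2) show "form (Suc k) (T k (wv a b)) = 1 / r * form_basis k (a, b)"
    proof (cases rule: pair_cases[of a b k])
      case 1
      then show ?thesis using ab k by (simp add: rules)
    next
      case 2
      then show ?thesis using ab k by (simp add: rules; simp add: lr power2_eq_square)
    next
      case 3
      then show ?thesis using ab k by (simp add: rules; simp add: power2_eq_square)
    next
      case 4
      then show ?thesis using ab k
        by (simp add: rules; simp add: m_eq power2_eq_square left_diff_distrib right_diff_distrib diff_divide_distrib)
    next
      case (5 e)
      then show ?thesis using ab k by (simp add: rules)
    next
      case (6 e)
      then show ?thesis using ab k
        by (simp add: rules; simp add: lr m_eq power2_eq_square left_diff_distrib right_diff_distrib diff_divide_distrib)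
    qed
  qed
qed

definition form_kernel :: "lk_vector set" where
  "form_kernel = {v \<in> carrier V. \<forall>i\<in>{1..n}. form i v = 0}"

lemma form_restrict: "form i (restrict v P) = form i v"
  by (rule form_cong) simp

lemma form_kernel_invariant:
  assumes lr: "l = r"
  shows "invariant_subspace n l r form_kernel"
  unfolding invariant_subspace_iff
proof (intro conjI ballI)
  show "VectorSpace.subspace (base_field l r) form_kernel V"
  proof (rule subspaceI)
    show "\<zero>\<^bsub>V\<^esub> \<in> form_kernel"
      unfolding form_kernel_def lk_space_zero by (simp only: form_restrict restrict_in_V mem_Collect_eq)
        (simp add: form_def F_intros)
    show "(\<lambda>p\<in>P. u p + v p) \<in> form_kernel" if "u \<in> form_kernel" "v \<in> form_kernel" for u v
      using that unfolding form_kernel_def mem_Collect_eq form_restrict form_add by (auto intro: V_add)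
    show "(\<lambda>p\<in>P. c * v p) \<in> form_kernel" if "c \<in> F" "v \<in> form_kernel" for c v
      using that unfolding form_kernel_def mem_Collect_eq form_restrict form_scale by (auto intro: V_scale)
  qed (auto simp: form_kernel_def)
  fix k v assume k: "k \<in> {1..n - 1}" and v: "v \<in> form_kernel"
  then have k': "1 \<le> k" "k < n" using n4 by auto
  have "form i (T k v) = 0" if "i \<in> {1..n}" for i
  proof -
    consider "i = k" | "i = Suc k" | "i \<noteq> k" "i \<noteq> Suc k" by blast
    then show ?thesis
      using v that k' by cases (simp_all add: form_T[OF lr k'] form_kernel_def)
  qed
  moreover have "restrict (T k v) P \<in> carrier V"
    using v unfolding restrict_in_V form_kernel_def by (auto intro!: T_in_F V_values)
  ultimately show "restrict (T k v) P \<in> form_kernel"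
    unfolding form_kernel_def mem_Collect_eq form_restrict by blast
qed

text \<open>The second rows of the standard tableaux of shape \<open>(n - 2, 2)\<close>.\<close>

definition kernel_pairs :: "(nat \<times> nat) set" where
  "kernel_pairs = {(j, k). 2 \<le> j \<and> j < k \<and> 4 \<le> k \<and> k \<le> n}"

section \<open>Coordinates on the common kernel of the forms\<close>

lemma kernel_pairs_subset: "kernel_pairs \<subseteq> P" by (auto simp: kernel_pairs_def index_pairs_def)

lemma finite_kernel_pairs: "finite kernel_pairs" using kernel_pairs_subset finite_index_pairs finite_subset by blast

text \<open>Outside \<open>kernel_pairs\<close> only (2, 3) and row 1 remain. For i at least 4 the
  form f_i isolates v_{1i}; then f_1, f_2 and f_3 give a nonsingular system for v_12, v_13 and
  v_23.\<close>

lemma form_kernel_zero: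
  assumes form: "\<And>i. 1 \<le> i \<Longrightarrow> i \<le> n \<Longrightarrow> form i v = 0" and kernel_pairs: "\<And>q. q \<in> kernel_pairs \<Longrightarrow> v q = 0" and p: "p \<in> P"
  shows "v p = 0"
proof -
  have sub: "form i v = (\<Sum>q\<in>A. v q * form_basis i q)"
    if "A \<subseteq> P" "\<And>q. q \<in> P - kernel_pairs - A \<Longrightarrow> v q * form_basis i q = 0" for A i
    unfolding form_def
  proof (rule sum.mono_neutral_right)
    show "\<forall>q\<in>P - A. v q * form_basis i q = 0"
    proof
      fix q assume "q \<in> P - A"
      then show "v q * form_basis i q = 0" using that(2)[of q] kernel_pairs[of q] by (cases "q \<in> kernel_pairs") auto
    qed
  qed (use that in simp_all)
  have PJ: "q = (2, 3) \<or> (\<exists>b\<ge>2. b \<le> n \<and> q = (1, b))" if "q \<in> P - kernel_pairs" for q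
    using that by (auto simp: index_pairs_def kernel_pairs_def)
  have 1: "v (1, i) = 0" if "4 \<le> i" "i \<le> n" for i
  proof -
    have "form i v = (\<Sum>q\<in>{(1, i)}. v q * form_basis i q)"
    proof (rule sub)
      fix q assume "q \<in> P - kernel_pairs - {(1, i)}"
      then show "v q * form_basis i q = 0" using that PJ[of q] by (auto simp: form_basis_def split: if_splits)
    qed (use that in \<open>simp add: index_pairs_def\<close>)
    then show ?thesis using form[of i] that by (simp add: form_basis_def)
  qed
  have "form 2 v = (\<Sum>q\<in>{(1, 2), (2, 3)}. v q * form_basis 2 q)"
  proof (rule sub)
    fix q assume "q \<in> P - kernel_pairs - {(1, 2), (2, 3)}"
    then show "v q * form_basis 2 q = 0" using PJ[of q] by (auto simp: form_basis_def split: if_splits)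
  qed (use n4 in \<open>simp add: index_pairs_def\<close>)
  then have f2: "v (1, 2) / r + v (2, 3) / r = 0"
    using form[of 2] n4 by (simp add: form_basis_def power2_eq_square)
  have "form 3 v = (\<Sum>q\<in>{(1, 3), (2, 3)}. v q * form_basis 3 q)"
  proof (rule sub)
    fix q assume "q \<in> P - kernel_pairs - {(1, 3), (2, 3)}"
    then show "v q * form_basis 3 q = 0" using PJ[of q] by (auto simp: form_basis_def split: if_splits)
  qed (use n4 in \<open>simp add: index_pairs_def\<close>)
  then have f3: "v (1, 3) / r\<^sup>2 + v (2, 3) / r = 0"
    using form[of 3] n4 by (simp add: form_basis_def)
  have "form 1 v = (\<Sum>q\<in>{(1, 2), (1, 3)}. v q * form_basis 1 q)"
  proof (rule sub)
    show "{(1, 2), (1, 3)} \<subseteq> P" using n4 by (auto simp: index_pairs_def)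
    fix q assume q: "q \<in> P - kernel_pairs - {(1, 2), (1, 3)}"
    then consider "q = (2, 3)" | b where "2 \<le> b" "b \<le> n" "q = (1, b)" using PJ[of q] by blast
    then show "v q * form_basis 1 q = 0"
    proof cases
      case 2
      then have "4 \<le> b" using q by (cases "b = 2"; cases "b = 3") auto
      then show ?thesis using 1[of b] 2 by simp
    qed (simp add: form_basis_def)
  qed
  then have f1: "v (1, 2) / r + v (1, 3) = 0"
    using form[of 1] n4 by (simp add: form_basis_def power2_eq_square)
  have a: "v (1, 2) = - v (2, 3)"
    using f2 by (simp add: add_divide_distrib[symmetric] eq_neg_iff_add_eq_0)
  have "v (1, 3) / r\<^sup>2 + v (2, 3) / r = (v (1, 3) + r * v (2, 3)) / r\<^sup>2"
    by (simp add: add_divide_distrib power2_eq_square)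
  then have b: "v (1, 3) = - (r * v (2, 3))"
    using f3 by (simp add: eq_neg_iff_add_eq_0)
  \<comment> \<open>With v_12 and v_13 expressed by v_23 through f_2 and f_3, the form f_1 leaves
    (r^2 + 1) v_23 = 0.\<close>
  have "v (2, 3) * (r\<^sup>2 + 1) = - r * (v (1, 2) / r + v (1, 3))"
    unfolding a b by (simp add: algebra_simps power2_eq_square)
  moreover have "r\<^sup>2 + 1 \<noteq> 0" using r2_ne by (simp add: eq_neg_iff_add_eq_0)
  ultimately have c: "v (2, 3) = 0" unfolding f1 by simp
  show ?thesis
  proof (cases "p \<in> kernel_pairs")
    case False
    then consider "p = (2, 3)" | b' where "2 \<le> b'" "b' \<le> n" "p = (1, b')"
      using PJ[of p] p by blast
    then show ?thesis
    proof cases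
      case 2
      then consider "b' = 2" | "b' = 3" | "4 \<le> b'" by linarith
      then show ?thesis using 2 a b c 1[of b'] by cases simp_all
    qed (simp add: c)
  qed (rule kernel_pairs)
qed

section \<open>Moving Garnir vectors, and geometric sums in the forms\<close>

lemma garnir_shift_right:
  assumes "1 \<le> i" "i + 2 \<le> j" "j + 2 \<le> n"
  shows "T j (T (Suc j) (garnir i j)) = (\<lambda>p. r * garnir i (Suc j) p)"
  using assms by (simp add: garnir_def T_lin T_wv img_def, simp add: algebra_simps)

lemma garnir_shift_left:
  assumes "1 \<le> i" "i + 3 \<le> j" "j < n"
  shows "T i (T (Suc i) (garnir i j)) = (\<lambda>p. r * garnir (Suc i) j p)"
  using assms by (simp add: garnir_def T_lin T_wv img_def, simp add: algebra_simps)

text \<open>Supplies vectors whose leading term w_{k+2,k+3} has adjacent indices; the Garnir vectors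
  themselves lead with w_{i+1,j+1} where j is at least i + 2.\<close>

lemma T_garnir:
  assumes "1 \<le> k" "k + 3 \<le> n"
  shows "T (Suc k) (garnir k (Suc (Suc k))) p = wv (Suc (Suc k)) (Suc (Suc (Suc k))) p
    - r\<^sup>2 * wv k (Suc (Suc (Suc k))) p - (r / l - r\<^sup>2 * m / l) * wv (Suc k) (Suc (Suc k)) p
    + r\<^sup>2 * wv k (Suc k) p - r\<^sup>2 * m * wv k (Suc (Suc k)) p"
  using assms by (simp add: garnir_def T_lin T_wv img_def, simp add: algebra_simps power2_eq_square)

text \<open>Counting columns from 3 by d exposes the geometric sums that arise on eigenvectors and
  on \<open>rank1_vec\<close>.\<close>

lemma form_1_eq: "form 1 v = v (1, 2) / r + (\<Sum>d<n - 2. v (1, 3 + d) * r ^ d)"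
  and form_2_eq: "form 2 v = v (1, 2) / r + (\<Sum>d<n - 2. v (2, 3 + d) * (r ^ d / r))"
proof -
  have sub: "form i v = v (1, 2) * form_basis i (1, 2) + (\<Sum>d<n - 2. v (i, 3 + d) * form_basis i (i, 3 + d))"
    if i: "i = 1 \<or> i = 2" for i
  proof -
    let ?R = "(\<lambda>d. (i, 3 + d)) ` {..<n - 2}"
    have "form i v = (\<Sum>q\<in>insert (1, 2) ?R. v q * form_basis i q)"
      unfolding form_def
    proof (rule sum.mono_neutral_right)
      show "insert (1, 2) ?R \<subseteq> P" using n4 i by (auto simp: index_pairs_def)
      show "\<forall>q\<in>P - insert (1, 2) ?R. v q * form_basis i q = 0"
      proof
        fix q assume q: "q \<in> P - insert (1, 2) ?R"
        obtain a b where ab: "q = (a, b)" by (cases q)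
        have "a \<noteq> i"
        proof
          assume "a = i"
          then have "3 \<le> b" "b \<le> n" using q ab i by (auto simp: index_pairs_def)
          then have "q = (i, 3 + (b - 3))" "b - 3 < n - 2" using ab \<open>a = i\<close> by auto
          then show False using q by blast
        qed
        moreover have "b \<noteq> i" using q ab i by (auto simp: index_pairs_def)
        ultimately show "v q * form_basis i q = 0" by (simp add: ab form_basis_def)
      qed
    qed simp
    also have "\<dots> = v (1, 2) * form_basis i (1, 2) + (\<Sum>q\<in>?R. v q * form_basis i q)"
      by (subst sum.insert) auto
    also have "(\<Sum>q\<in>?R. v q * form_basis i q) = (\<Sum>d<n - 2. v (i, 3 + d) * form_basis i (i, 3 + d))"
      by (subst sum.reindex) (auto simp: inj_on_def)
    finally show ?thesis .
  qed
  have e: "3 + d - 1 = Suc (Suc d)" "3 + d - 2 = Suc d" for d :: nat by auto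
  show "form 1 v = v (1, 2) / r + (\<Sum>d<n - 2. v (1, 3 + d) * r ^ d)"
    unfolding sub[OF disjI1[OF refl]] form_basis_def prod.case e by (simp add: power2_eq_square)
  show "form 2 v = v (1, 2) / r + (\<Sum>d<n - 2. v (2, 3 + d) * (r ^ d / r))"
    unfolding sub[OF disjI2[OF refl]] form_basis_def prod.case e by (simp add: power2_eq_square)
qed

lemma geometric_ne:
  assumes "1 \<le> N" "N \<le> n"
  shows "(\<Sum>d<N. (r\<^sup>2) ^ d) \<noteq> 0"
  using power_diff_1_eq[of "r\<^sup>2" N] pow_ne assms by auto

lemma card_kernel_pairs: "card kernel_pairs = n * (n - 3) div 2"
proof -
  \<comment> \<open>Doubling avoids division. Passing from N to N + 1 adds the N - 1 pairs whose
    second entry is N + 1.\<close>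
  have "2 * card {(j, k). 2 \<le> j \<and> j < k \<and> 4 \<le> k \<and> k \<le> N} = N * (N - 3)" if "3 \<le> N" for N :: nat
    using that
  proof (induction N rule: nat_induct_at_least)
    case base
    have "{(j, k). 2 \<le> j \<and> j < k \<and> 4 \<le> k \<and> k \<le> 3} = ({} :: (nat \<times> nat) set)" by auto
    then show ?case by (simp only: card.empty)
  next
    case (Suc N)
    have "{(j, k). 2 \<le> j \<and> j < k \<and> 4 \<le> k \<and> k \<le> Suc N} =
      {(j, k). 2 \<le> j \<and> j < k \<and> 4 \<le> k \<and> k \<le> N} \<union> (\<lambda>j. (j, Suc N)) ` {2..N}"
      using Suc.hyps by (auto simp: le_Suc_eq)
    moreover have "finite {(j, k). 2 \<le> j \<and> j < k \<and> 4 \<le> k \<and> k \<le> N}"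
      by (rule finite_subset[of _ "{..N} \<times> {..N}"]) auto
    ultimately have "card {(j, k). 2 \<le> j \<and> j < k \<and> 4 \<le> k \<and> k \<le> Suc N} =
      card {(j, k). 2 \<le> j \<and> j < k \<and> 4 \<le> k \<and> k \<le> N} + card ((\<lambda>j. (j, Suc N)) ` {2..N})"
      by (simp only:, subst card_Un_disjoint) auto
    also have "card ((\<lambda>j. (j, Suc N)) ` {2..N}) = N - 1"
      by (subst card_image) (auto simp: inj_on_def)
    finally have "2 * card {(j, k). 2 \<le> j \<and> j < k \<and> 4 \<le> k \<and> k \<le> Suc N} = N * (N - 3) + 2 * (N - 1)"
      using Suc.IH by simp
    moreover obtain e where "N = 3 + e" using Suc.hyps le_Suc_ex by blast
    ultimately show ?case by (simp add: algebra_simps)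
  qed
  from this[of n] show ?thesis using n4 by (simp add: kernel_pairs_def)
qed

end

section \<open>The Garnir vector generates the common kernel\<close>

context lk_inv begin

lemma garnir_mem:
  assumes x: "M (garnir 1 3)" and ij: "1 \<le> i" "i + 2 \<le> j" "j < n"
  shows "M (garnir i j)"
proof -
  have 1: "M (garnir 1 j)" if "3 \<le> j" "j < n" for j
    using that
  proof (induction j rule: nat_induct_at_least)
    case (Suc j)
    have "M (T j (T (Suc j) (garnir 1 j)))" using Suc by (intro M_T) auto
    then have "M (\<lambda>p. r * garnir 1 (Suc j) p)" using Suc by (subst (asm) garnir_shift_right) auto
    then show ?case using M_scale_rev[of r] by (simp add: F_intros)
  qed (use x in simp)
  show ?thesis using ij(1,2)
  proof (induction i rule: nat_induct_at_least)
    case base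
    then show ?case using 1 ij by simp
  next
    case (Suc i)
    have "M (T i (T (Suc i) (garnir i j)))" using Suc ij by (intro M_T) auto
    then have "M (\<lambda>p. r * garnir (Suc i) j p)" using Suc ij by (subst (asm) garnir_shift_left) auto
    then show ?case using M_scale_rev[of r] by (simp add: F_intros)
  qed
qed

text \<open>Modulo vectors vanishing on \<open>kernel_pairs\<close>, each w_ij lies in
  \<open>W\<close>. It is the leading term of a Garnir vector or, for adjacent indices, of
  \<open>T_garnir\<close>, and all other terms have smaller i + j. Row 1 and (2, 3) lie outside
  \<open>kernel_pairs\<close>, so 0 serves there.\<close>

lemma kernel_pairs_coord:
  assumes x: "M (garnir 1 3)" and ij: "1 \<le> i" "i < j" "j \<le> n"
  shows "\<exists>u. M u \<and> (\<forall>q\<in>kernel_pairs. u q = wv i j q)"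
  using ij
proof (induction "i + j" arbitrary: i j rule: less_induct)
  case less
  consider "i = 1 \<or> i = 2 \<and> j = 3" | "2 \<le> i" "i + 2 \<le> j" | "3 \<le> i" "j = Suc i"
    using less.prems by linarith
  then show ?case
  proof cases
    case 1
    then show ?thesis
      by (intro exI[of _ "\<lambda>p. 0"] conjI M_zero) (auto simp: wv_def kernel_pairs_def)
  next
    case 2
    obtain a where a: "i = Suc a" "1 \<le> a" using 2 by (cases i) auto
    obtain b where b: "j = Suc b" using 2 by (cases j) auto
    have ab: "a + 2 \<le> b" using a b 2 by simp
    obtain u1 where u1: "M u1" "\<forall>q\<in>kernel_pairs. u1 q = wv a j q"
      using less.hyps[of a j] a ab b less.prems by auto
    obtain u2 where u2: "M u2" "\<forall>q\<in>kernel_pairs. u2 q = wv i b q"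
      using less.hyps[of i b] a ab b less.prems by auto
    obtain u3 where u3: "M u3" "\<forall>q\<in>kernel_pairs. u3 q = wv a b q"
      using less.hyps[of a b] a ab b less.prems by auto
    have Mx: "M (garnir a b)" using a ab b less.prems by (intro garnir_mem[OF x]) auto
    show ?thesis
    proof (intro exI conjI)
      show "M (\<lambda>p. garnir a b p + r * u1 p + r * u2 p - r\<^sup>2 * u3 p)"
        by (intro M_diff M_add M_scale Mx u1 u2 u3 F_intros)
      show "\<forall>q\<in>kernel_pairs. garnir a b q + r * u1 q + r * u2 q - r\<^sup>2 * u3 q = wv i j q"
        using u1 u2 u3 by (simp add: garnir_def a b)
    qed
  next
    case 3
    obtain k where k: "i = Suc (Suc k)" "1 \<le> k" using 3 by (cases i; cases "i - 1") auto
    have j: "j = Suc (Suc (Suc k))" using k 3 by simp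
    have kn: "k + 3 \<le> n" using j less.prems by simp
    obtain u1 where u1: "M u1" "\<forall>q\<in>kernel_pairs. u1 q = wv k (Suc (Suc (Suc k))) q"
      using less.hyps[of k "Suc (Suc (Suc k))"] k j kn by auto
    obtain u2 where u2: "M u2" "\<forall>q\<in>kernel_pairs. u2 q = wv (Suc k) (Suc (Suc k)) q"
      using less.hyps[of "Suc k" "Suc (Suc k)"] k j kn by auto
    obtain u3 where u3: "M u3" "\<forall>q\<in>kernel_pairs. u3 q = wv k (Suc k) q"
      using less.hyps[of k "Suc k"] k j kn by auto
    obtain u4 where u4: "M u4" "\<forall>q\<in>kernel_pairs. u4 q = wv k (Suc (Suc k)) q"
      using less.hyps[of k "Suc (Suc k)"] k j kn by auto
    have Mx: "M (T (Suc k) (garnir k (Suc (Suc k))))" using k kn by (intro M_T garnir_mem[OF x]) auto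
    let ?c = "r / l - r\<^sup>2 * m / l"
    show ?thesis
    proof (intro exI conjI)
      show "M (\<lambda>p. T (Suc k) (garnir k (Suc (Suc k))) p + r\<^sup>2 * u1 p + ?c * u2 p - r\<^sup>2 * u3 p
          + (r\<^sup>2 * m) * u4 p)"
        by (intro M_diff M_add M_scale Mx u1 u2 u3 u4 F_intros)
      show "\<forall>q\<in>kernel_pairs. T (Suc k) (garnir k (Suc (Suc k))) q + r\<^sup>2 * u1 q + ?c * u2 q - r\<^sup>2 * u3 q
          + (r\<^sup>2 * m) * u4 q = wv i j q"
        using u1 u2 u3 u4 by (simp add: T_garnir[OF k(2) kn] k(1) j)
    qed
  qed
qed

lemma kernel_pairs_dual:
  assumes x: "M (garnir 1 3)"
  shows "\<exists>u. \<forall>q\<in>kernel_pairs. M (u q) \<and> (\<forall>p\<in>kernel_pairs. u q p = (if p = q then 1 else 0))"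
proof (rule bchoice, rule ballI)
  fix q assume "q \<in> kernel_pairs"
  then obtain i j where "q = (i, j)" "1 \<le> i" "i < j" "j \<le> n" by (auto simp: kernel_pairs_def)
  then show "\<exists>u. M u \<and> (\<forall>p\<in>kernel_pairs. u p = (if p = q then 1 else 0))"
    using kernel_pairs_coord[OF x, of i j] by (auto simp: wv_def)
qed

lemma M_form:
  assumes "W \<subseteq> form_kernel" "M v" "1 \<le> i" "i \<le> n"
  shows "form i v = 0"
proof -
  have "restrict v P \<in> form_kernel" using assms(1,2) by (auto simp only: M_def)
  then have "form i (restrict v P) = 0" unfolding form_kernel_def using assms(3,4) by force
  then show ?thesis by (simp only: form_restrict)
qed

text \<open>The difference of the two sides is killed by all forms and vanishes on
  \<open>kernel_pairs\<close>, so \<open>form_kernel_zero\<close> applies.\<close>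

lemma form_kernel_expand:
  assumes sub: "W \<subseteq> form_kernel"
    and u: "\<And>q. q \<in> kernel_pairs \<Longrightarrow> M (u q)" "\<And>q p. q \<in> kernel_pairs \<Longrightarrow> p \<in> kernel_pairs \<Longrightarrow> u q p = (if p = q then 1 else 0)"
    and v: "v \<in> form_kernel" and p: "p \<in> P"
  shows "v p = (\<Sum>q\<in>kernel_pairs. v q * u q p)"
proof -
  have "v p - (\<Sum>q\<in>kernel_pairs. v q * u q p) = 0"
  proof (rule form_kernel_zero[OF _ _ p])
    fix i assume i: "1 \<le> i" "i \<le> n"
    have "form i (u q) = 0" if "q \<in> kernel_pairs" for q by (rule M_form[OF sub u(1)[OF that] i])
    then show "form i (\<lambda>p. v p - (\<Sum>q\<in>kernel_pairs. v q * u q p)) = 0"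
      using v i by (simp add: form_diff form_sum[OF finite_kernel_pairs] form_kernel_def)
  next
    fix p assume p: "p \<in> kernel_pairs"
    have "(\<Sum>q\<in>kernel_pairs. v q * u q p) = (\<Sum>q\<in>kernel_pairs. if p = q then v q else 0)"
      using p by (intro sum.cong) (auto simp: u(2))
    then show "v p - (\<Sum>q\<in>kernel_pairs. v q * u q p) = 0" using p finite_kernel_pairs by simp
  qed
  then show ?thesis by simp
qed

lemma eq_form_kernel:
  assumes sub: "W \<subseteq> form_kernel" and x: "M (garnir 1 3)"
  shows "W = form_kernel"
proof
  obtain u where u: "\<And>q. q \<in> kernel_pairs \<Longrightarrow> M (u q)"
    "\<And>q p. q \<in> kernel_pairs \<Longrightarrow> p \<in> kernel_pairs \<Longrightarrow> u q p = (if p = q then 1 else 0)"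
    using kernel_pairs_dual[OF x] by blast
  show "form_kernel \<subseteq> W"
  proof
    fix v assume v: "v \<in> form_kernel"
    then have vV: "v \<in> carrier V" by (simp add: form_kernel_def)
    have "M (\<lambda>p. \<Sum>q\<in>kernel_pairs. v q * u q p)"
      using kernel_pairs_subset V_values[OF vV] by (intro M_sum[OF finite_kernel_pairs] u) auto
    then have "M v" by (rule M_cong) (rule form_kernel_expand[OF sub u v])
    then show "v \<in> W" by (simp only: M_def V_restrict[OF vV])
  qed
qed (rule sub)

lemma dim_eq_of_form_kernel:
  assumes W: "W = form_kernel" and x: "M (garnir 1 3)"
  shows "subspace_dim n l r W = card kernel_pairs"
proof (rule antisym)
  obtain u where u: "\<And>q. q \<in> kernel_pairs \<Longrightarrow> M (u q)"
    "\<And>q p. q \<in> kernel_pairs \<Longrightarrow> p \<in> kernel_pairs \<Longrightarrow> u q p = (if p = q then 1 else 0)"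
    using kernel_pairs_dual[OF x] by blast
  show "card kernel_pairs \<le> subspace_dim n l r W"
    using u by (intro M_dim_ge kernel_pairs_subset) blast
  show "subspace_dim n l r W \<le> card kernel_pairs"
  proof (rule subspace_dim_le[OF W_sub finite_kernel_pairs, of "\<lambda>q. restrict (u q) P"])
    show "restrict (u q) P \<in> W" if "q \<in> kernel_pairs" for q using u(1)[OF that] by (simp only: M_def)
    fix w assume w: "w \<in> W"
    then have wK: "w \<in> form_kernel" by (simp only: W)
    have "w q \<in> F" if "q \<in> kernel_pairs" for q using V_values[OF W_V[OF w]] that kernel_pairs_subset by blast
    moreover have "w p = (\<Sum>q\<in>kernel_pairs. w q * restrict (u q) P p)" if p: "p \<in> P" for p
      using form_kernel_expand[OF equalityD1[OF W] u wK p] p by simp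
    ultimately show "\<exists>c. (\<forall>i\<in>kernel_pairs. c i \<in> F) \<and> (\<forall>p\<in>P. w p = (\<Sum>i\<in>kernel_pairs. c i * restrict (u i) P p))"
      by blast
  qed
qed

text \<open>If the Garnir vector is missing, either \<open>D 1\<close> vanishes on \<open>W\<close>
  and every \<open>T k\<close> is the scalar r, or some nonzero \<open>D 1 v0\<close> has the shape
  \<open>rank1_vec a b\<close>. The forms f_1 and f_2 exclude both.\<close>

lemma form_kernel_garnir:
  assumes sub: "W \<subseteq> form_kernel" and ne: "W \<noteq> {\<zero>\<^bsub>V\<^esub>}"
  shows "M (garnir 1 3)"
proof (rule ccontr)
  assume x: "\<not> M (garnir 1 3)"
  obtain v where v: "v \<in> W" "v \<noteq> \<zero>\<^bsub>V\<^esub>"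
    using ne subspaceD(2)[OF W_sub] unfolding lk_space_zero by blast
  then obtain p where p: "p \<in> P" "v p \<noteq> 0"
    using V_eqI[of v "\<zero>\<^bsub>V\<^esub>"] W_V subspaceD(2)[OF W_sub] unfolding lk_space_zero by fastforce
  have Mv: "M v" by (rule M_W[OF v(1)])
  show False
  proof (cases "\<forall>v p. M v \<longrightarrow> p \<in> P \<longrightarrow> D 1 v p = 0")
    case True
    have T: "T k v q = r * v q" if "1 \<le> k" "k < n" "q \<in> P" for k q
      using D_zero_all[OF True[rule_format] that(1,2) Mv that(3)] by (simp add: D_def)
    have row: "v (1, 3 + d) = r ^ Suc d * v (1, 2)" if "3 + d \<le> n" for d
      using that
    proof (induction d)
      case 0
      then show ?case using T[of 2 "(1, 2)"] T_coord_right[of 1 2 v] n4 by (simp add: index_pairs_def)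
    next
      case (Suc d)
      then show ?case
        using T[of "3 + d" "(1, 3 + d)"] T_coord_right[of 1 "3 + d" v] by (simp add: index_pairs_def mult.assoc)
    qed
    have "0 = r * form 1 v" using M_form[OF sub Mv, of 1] n4 by simp
    also have "\<dots> = v (1, 2) * (1 + (\<Sum>d<n - 2. r * (r ^ Suc d * r ^ d)))"
      unfolding form_1_eq using row by (simp add: distrib_left sum_distrib_left mult_ac)
    \<comment> \<open>With v_12 as the zeroth term the sum has n - 1 terms, and it is nonzero
      because (r^2)^(n-1) is not 1.\<close>
    also have "1 + (\<Sum>d<n - 2. r * (r ^ Suc d * r ^ d)) = (\<Sum>d<Suc (n - 2). (r\<^sup>2) ^ d)"
      unfolding sum.lessThan_Suc_shift by (simp add: power_mult_distrib power2_eq_square mult_ac)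
    finally have v12: "v (1, 2) = 0" using geometric_ne[of "Suc (n - 2)"] n4 by auto
    have v1: "v (1, j) = 0" if "2 \<le> j" "j \<le> n" for j
    proof (cases "j = 2")
      case False
      then have "j = 3 + (j - 3)" using that by simp
      then show ?thesis using row[of "j - 3"] v12 that by simp
    qed (use v12 in simp)
    have "v (i, j) = 0" if "1 \<le> i" "i < j" "j \<le> n" for i j
      using that
    proof (induction i rule: nat_induct_at_least)
      case base
      then show ?case using v1[of j] by simp
    next
      case (Suc i)
      then show ?case using T[of i "(i, j)"] T_coord_left[of i j v] by (simp add: index_pairs_def)
    qed
    then show False using p by (auto simp: index_pairs_def)
  next
    case False
    then obtain v0 p0 where v0: "M v0" "p0 \<in> P" "D 1 v0 p0 \<noteq> 0" by blast
    define a b where "a = D 1 v0 (1, 2)" and "b = D 1 v0 (2, 3)"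
    have y: "D 1 v0 q = rank1_vec a b q" if "q \<in> P" for q
      unfolding a_def b_def by (rule D1_shape[OF x v0(1) that])
    have MD: "M (D 1 v0)" using n4 v0 by (intro M_D) auto
    have MY: "M (rank1_vec a b)" by (rule M_cong[OF MD]) (rule y[symmetric])
    let ?S = "\<Sum>d<n - 2. (r\<^sup>2) ^ d"
    have f1: "a / r - r * b * ?S = 0"
      using M_form[OF sub MY, of 1] n4 unfolding form_1_eq
      by (simp add: rank1_vec_def sum_distrib_left sum_negf mult_ac power_mult_distrib power2_eq_square)
    have f2: "a / r + b / r * ?S = 0"
      using M_form[OF sub MY, of 2] n4 unfolding form_2_eq
      by (simp add: rank1_vec_def sum_distrib_left mult_ac power_mult_distrib power2_eq_square)
    \<comment> \<open>Subtracting the two equations leaves b times two nonzero factors, the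
      geometric sum and r^2 + 1.\<close>
    have "(b * ?S) * (r\<^sup>2 + 1) = r * ((a / r + b / r * ?S) - (a / r - r * b * ?S))"
      by (simp add: algebra_simps power2_eq_square)
    moreover have "r\<^sup>2 + 1 \<noteq> 0" using r2_ne by (simp add: eq_neg_iff_add_eq_0)
    ultimately have b: "b = 0" using geometric_ne[of "n - 2"] n4 unfolding f1 f2 by auto
    then have "a = 0" using f1 by simp
    then show False using v0 y b by (auto simp: rank1_vec_def split: prod.splits if_splits)
  qed
qed

lemma dim_full:
  assumes "W = carrier V"
  shows "card P \<le> subspace_dim n l r W"
proof (rule M_dim_ge[OF subset_refl])
  fix q assume "q \<in> P"
  have "restrict (wv (fst q) (snd q)) P \<in> W" using assms by (simp add: restrict_in_V wv_in_F)
  then have "M (wv (fst q) (snd q))" by (simp only: M_def)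
  then show "\<exists>u. M u \<and> (\<forall>p\<in>P. u p = (if p = q then 1 else 0))"
    by (intro exI[of _ "wv (fst q) (snd q)"]) (auto simp: wv_def)
qed

lemma irreducible_dim_imp:
  assumes irr: "irreducible_invariant_subspace n l r W"
    and dim: "subspace_dim n l r W = card kernel_pairs"
  shows "M (garnir 1 3)" "l = r"
proof -
  have finJ3: "finite {(j, k). 2 \<le> j \<and> j < k \<and> k \<le> n}"
    by (rule finite_subset[OF _ finite_index_pairs[of n]]) (auto simp: index_pairs_def)
  \<comment> \<open>The pair (2, 3) makes the inclusion strict. This bound excludes both the whole
    space and the case l = -r^3.\<close>
  have lt: "card kernel_pairs < card {(j, k). 2 \<le> j \<and> j < k \<and> k \<le> n}"
  proof (rule psubset_card_mono[OF finJ3])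
    have "(2, 3) \<in> {(j, k). 2 \<le> j \<and> j < k \<and> k \<le> n} - kernel_pairs" using n4 by (simp add: kernel_pairs_def)
    moreover have "kernel_pairs \<subseteq> {(j, k). 2 \<le> j \<and> j < k \<and> k \<le> n}" by (auto simp: kernel_pairs_def)
    ultimately show "kernel_pairs \<subset> {(j, k). 2 \<le> j \<and> j < k \<and> k \<le> n}" by blast
  qed
  also have "\<dots> \<le> card P"
    by (rule card_mono[OF finite_index_pairs]) (auto simp: index_pairs_def)
  finally have proper: "W \<noteq> carrier V" using dim_full dim by auto
  have dimJ: "2 * card kernel_pairs = n * (n - 3)"
    unfolding card_kernel_pairs by (cases "even n") auto
  show x: "M (garnir 1 3)"
  proof (rule ccontr)
    assume x: "\<not> M (garnir 1 3)"
    show False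
    proof (cases "\<forall>v p. M v \<longrightarrow> p \<in> P \<longrightarrow> D 1 v p = 0")
      case True
      then have "card kernel_pairs \<le> 1" using dim_le_of_D_zero[OF irr] dim by auto
      moreover have "4 * 1 \<le> n * (n - 3)" using n4 by (intro mult_mono) auto
      ultimately show False using dimJ by simp
    next
      case False
      then obtain v0 p0 where v0: "M v0" "p0 \<in> P" "D 1 v0 p0 \<noteq> 0" by blast
      show False
      proof (cases "n = 4")
        case True
        then show False using dim_ge_of_n4[OF True proper x v0] dim dimJ by simp
      next
        case False
        have "card kernel_pairs \<le> n - 1" using dim_le_of_not_garnir[OF irr proper x v0] dim by simp
        \<comment> \<open>From n = 5 on, the dimension n (n - 3) / 2 is at least n and so exceeds n
          - 1.\<close>
        moreover have "n * 2 \<le> n * (n - 3)" using n4 False by (intro mult_mono) auto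
        ultimately show False using dimJ n4 by linarith
      qed
    qed
  qed
  show "l = r"
  proof (rule ccontr)
    assume "l \<noteq> r"
    then have "l = - (r ^ 3)" using garnir_mem_imp[OF proper x] by blast
    then show False using dim_ge_of_neg_cube x lt dim by simp
  qed
qed

end

section \<open>Existence and uniqueness for l = r\<close>

lemma (in lk_rep) lk_invI: "invariant_subspace n l r W \<Longrightarrow> lk_inv n l r W"
  by unfold_locales

lemma (in lk_rep) garnir_in_form_kernel: "restrict (garnir 1 3) P \<in> form_kernel"
proof -
  have "restrict (garnir 1 3) P \<in> carrier V"
    by (auto simp only: restrict_in_V garnir_def intro!: F_intros wv_in_F)
  moreover have "form i (garnir 1 3) = 0" for i
    using n4 by (auto simp: garnir_def form_lin form_wv form_basis_def eval_nat_numeral)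
  ultimately show ?thesis unfolding form_kernel_def by (simp only: form_restrict mem_Collect_eq) simp
qed

lemma (in lk_rep) garnir_nonzero: "restrict (garnir 1 3) P \<noteq> \<zero>\<^bsub>V\<^esub>"
proof
  assume "restrict (garnir 1 3) P = \<zero>\<^bsub>V\<^esub>"
  then have "restrict (garnir 1 3) P (2, 4) = 0" using n4 by (simp add: lk_space_zero index_pairs_def)
  then show False using n4 by (simp add: garnir_def wv_def index_pairs_def)
qed

lemma (in lk_rep) irreducible_form_kernel:
  assumes "l = r"
  shows "irreducible_invariant_subspace n l r form_kernel" "subspace_dim n l r form_kernel = card kernel_pairs"
proof -
  interpret K: lk_inv n l r form_kernel by (rule lk_invI[OF form_kernel_invariant[OF assms]])
  have x: "K.M (garnir 1 3)" unfolding K.M_def by (rule garnir_in_form_kernel)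
  show "subspace_dim n l r form_kernel = card kernel_pairs" by (rule K.dim_eq_of_form_kernel[OF refl x])
  have "U = {\<zero>\<^bsub>V\<^esub>} \<or> U = form_kernel" if "invariant_subspace n l r U" "U \<subseteq> form_kernel" for U
  proof -
    interpret U: lk_inv n l r U by (rule lk_invI[OF that(1)])
    show ?thesis using U.form_kernel_garnir U.eq_form_kernel that(2) by blast
  qed
  then show "irreducible_invariant_subspace n l r form_kernel"
    unfolding irreducible_invariant_subspace_def
    using form_kernel_invariant[OF assms] garnir_in_form_kernel garnir_nonzero by blast
qed

text \<open>Both subspaces contain the Garnir vector, so their intersection is a nonzero invariant
  subspace of the irreducible \<open>W\<close>. Hence \<open>W\<close> lies in the kernel, and
  \<open>eq_form_kernel\<close> gives equality.\<close>

lemma (in lk_rep) irreducible_eq_form_kernel: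
  assumes lr: "l = r" and irr: "irreducible_invariant_subspace n l r W"
    and dim: "subspace_dim n l r W = card kernel_pairs"
  shows "W = form_kernel"
proof -
  have inv: "invariant_subspace n l r W" using irr by (simp add: irreducible_invariant_subspace_def)
  interpret W: lk_inv n l r W by (rule lk_invI[OF inv])
  note KI = form_kernel_invariant[OF lr]
  have x: "W.M (garnir 1 3)" by (rule W.irreducible_dim_imp[OF irr dim])
  have "invariant_subspace n l r (W \<inter> form_kernel)"
    unfolding invariant_subspace_iff
  proof (intro conjI ballI subspaceI)
    note W = inv[unfolded invariant_subspace_iff] and K = KI[unfolded invariant_subspace_iff]
    note WD = subspaceD[OF W[THEN conjunct1]] and KD = subspaceD[OF K[THEN conjunct1]]
    show "W \<inter> form_kernel \<subseteq> carrier V" using WD(1) by blast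
    show "\<zero>\<^bsub>V\<^esub> \<in> W \<inter> form_kernel" unfolding lk_space_zero using WD(2) KD(2) by blast
    show "(\<lambda>p\<in>P. u p + v p) \<in> W \<inter> form_kernel" if "u \<in> W \<inter> form_kernel" "v \<in> W \<inter> form_kernel" for u v
      using that WD(3) KD(3) by blast
    show "(\<lambda>p\<in>P. c * v p) \<in> W \<inter> form_kernel" if "c \<in> F" "v \<in> W \<inter> form_kernel" for c v
      using that WD(4) KD(4) by blast
    show "restrict (T k v) P \<in> W \<inter> form_kernel" if "k \<in> {1..n - 1}" "v \<in> W \<inter> form_kernel" for k v
      using that W K by blast
  qed
  moreover have "W \<inter> form_kernel \<noteq> {\<zero>\<^bsub>V\<^esub>}"
    using x garnir_in_form_kernel garnir_nonzero unfolding W.M_def by blast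
  ultimately have "W \<inter> form_kernel = W"
    using irr unfolding irreducible_invariant_subspace_def by blast
  then show ?thesis using W.eq_form_kernel[OF _ x] by blast
qed

theorem theoremC:
  fixes n :: nat and l r :: complex
  assumes "n \<ge> 4"
    and "l \<noteq> 0" and "r \<noteq> 0"
    and "\<forall>k \<in> {1..n}. (r\<^sup>2) ^ k \<noteq> 1"
  shows "((\<exists>W. irreducible_invariant_subspace n l r W \<and>
               subspace_dim n l r W = n * (n - 3) div 2) \<longleftrightarrow> l = r) \<and>
         (l = r \<longrightarrow>
           (\<exists>!W. irreducible_invariant_subspace n l r W \<and>
                 subspace_dim n l r W = n * (n - 3) div 2))"
proof -
  interpret lk_rep n l r using assms by unfold_locales
  have "l = r" if "irreducible_invariant_subspace n l r W" "subspace_dim n l r W = card kernel_pairs" for W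
  proof -
    interpret W: lk_inv n l r W
      using that(1) by (intro lk_invI) (simp add: irreducible_invariant_subspace_def)
    show ?thesis by (rule W.irreducible_dim_imp[OF that])
  qed
  then show ?thesis
    unfolding card_kernel_pairs[symmetric] using irreducible_form_kernel irreducible_eq_form_kernel by blast
qed

end
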